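(* Let $Q=Q(d,d_0)$ be any compact connected two-point homogeneous space (normalized as in the context), and let $\alpha=\frac12d-1$, $\beta=\frac12d_0-1$. Then the following expansions hold for all $y_1,y_2\in Q$. (i) For every $r\in[0,\pi]$, $$\lambda_r(y_1,y_2)=\kappa(d,d_0)\sum_{l\ge1}l^{-2}M_l\,a_l(r)\,\frac{P^{(\alpha,\beta)}_l(\cos\theta(y_1,y_2))}{P^{(\alpha,\beta)}_l(1)},$$ $$\theta^{\Delta}_r(y_1,y_2)=\langle\theta^{\Delta}_r\rangle-\kappa(d,d_0)\sum_{l\ge1}l^{-2}M_l\,a_l(r)\,\frac{P^{(\alpha,\beta)}_l(\cos\theta(y_1,y_2))}{P^{(\alpha,\beta)}_l(1)} =\kappa(d,d_0)\sum_{l\ge1}l^{-2}M_l\,a_l(r)\left[1-\frac{P^{(\alpha,\beta)}_l(\cos\theta(y_1,y_2))}{P^{(\alpha,\beta)}_l(1)}\right],$$ where $\langle\theta^{\Delta}_r\rangle=v_rv'_r$ is the average value of the metric $\theta^{\Delta}_r$. (ii) If $\eta\in W(d,d_0)$, then $$\lambda(\eta,y_1,y_2)=\kappa(d,d_0)\sum_{l\ge1}l^{-2}M_l\,A_l(\eta)\,\frac{P^{(\alpha,\beta)}_l(\cos\theta(y_1,y_2))}{P^{(\alpha,\beta)}_l(1)},$$ $$\theta^{\Delta}(\eta,y_1,y_2)=\langle\theta^{\Delta}(\eta)\rangle-\kappa(d,d_0)\sum_{l\ge1}l^{-2}M_l\,A_l(\eta)\,\frac{P^{(\alpha,\beta)}_l(\cos\theta(y_1,y_2))}{P^{(\alpha,\beta)}_l(1)}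 =\kappa(d,d_0)\sum_{l\ge1}l^{-2}M_l\,A_l(\eta)\left[1-\frac{P^{(\alpha,\beta)}_l(\cos\theta(y_1,y_2))}{P^{(\alpha,\beta)}_l(1)}\right],$$ where $\langle\theta^{\Delta}(\eta)\rangle$ is the average value of the metric $\theta^{\Delta}(\eta)$ and $A_l(\eta)=\int_0^\pi\eta(u)\,a_l(u)\,du$.
   Context: Spaces. $Q=Q(d,d_0)$ is one of the following: the sphere $S^d$, $d\ge 1$, with the convention $d_0=d$; or a projective space $\mathbb{F}P^n$ with $\mathbb F=\mathbb R,\mathbb C,\mathbb H$, $n\ge2$, or the octonionic projective plane $\mathbb{O}P^2$ ($\mathbb F=\mathbb O$, $n=2$), where $d_0=\dim_{\mathbb R}\mathbb F=1,2,4,8$ for $\mathbb F=\mathbb R,\mathbb C,\mathbb H,\mathbb O$ respectively and $d=nd_0$. $Q$ carries the isometry-invariant Riemannian distance $\theta$, rescaled so that $\operatorname{diam}(Q,\theta)=\pi$, and the isometry-invariant Riemannian measure $\mu$ with $\mu(Q)=1$. Concretely, $S^d=\{x\in\mathbb R^{d+1}:\|x\|=1\}$ with $\cos\theta(x_1,x_2)=(x_1,x_2)$; and $\mathbb{F}P^n$ is the set of Hermitian $(n+1)\times(n+1)$ matrices $\Pi$ over $\mathbb F$ with $\Pi^2=\Pi$, $\operatorname{Tr}\Pi=1$, with $\sin\frac12\theta(\Pi_1,\Pi_2)=\frac1{\sqrt2}\|\Pi_1-\Pi_2\|$, $0\le\theta\le\pi$, where $\|A\|^2=\sum_{i,j}|a_{ij}|^2$.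 Balls: $B_r(y)=\{x\in Q:\theta(x,y)<r\}$, $r\in[0,\pi]$; $v_r=\mu(B_r(y))$ (independent of $y$), $v'_r=1-v_r$; $\chi(B_r(y),\cdot)$ is the characteristic function of $B_r(y)$. Kernels: with $\Lambda(B_r(y),x)=\chi(B_r(y),x)-v_r$, put $\lambda_r(y_1,y_2)=\int_Q\Lambda(B_r(y),y_1)\Lambda(B_r(y),y_2)\,d\mu(y)$ and $\lambda(\eta,y_1,y_2)=\int_0^\pi\lambda_r(y_1,y_2)\,\eta(r)\,dr$. Metrics: $\theta^{\Delta}_r(y_1,y_2)=\frac12\mu\big(B_r(y_1)\Delta B_r(y_2)\big)$, $\theta^{\Delta}(\eta,y_1,y_2)=\int_0^\pi\theta^{\Delta}_r(y_1,y_2)\,\eta(r)\,dr$; $\langle\rho\rangle=\iint_{Q\times Q}\rho\,d\mu\,d\mu$. Weight classes: for $a\ge b\ge1$, $W(a,b)$ is the class of (measurable) functions $\eta\ge0$ on $[0,\pi]$ with $\int_0^\pi(\sin\frac12r)^{a-1}(\cos\frac12r)^{b-1}\eta(r)\,dr<\infty$. Constants and polynomials: $P^{(\alpha,\beta)}_l$ is the standard Jacobi polynomial of degree $l$, normalized by $P^{(\alpha,\beta)}_l(1)=\binom{\alpha+l}{l}$; $$\kappa(d,d_0)=\frac{\Gamma(d/2+d_0/2)}{\Gamma(d/2)\Gamma(d_0/2)},\qquad M_l=(2l+\alpha+\beta+1)\frac{\Gamma(l+1)\Gamma(l+\alpha+\beta+1)}{\Gamma(l+\alpha+1)\Gamma(l+\beta+1)}\quad(l\ge1),$$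 $$a_l(r)=(\sin\tfrac12r)^{2d}(\cos\tfrac12r)^{2d_0}\left\{P^{(\alpha+1,\beta+1)}_{l-1}(\cos r)\right\}^2.$$ *)

theory Defs
  imports "HOL-Analysis.Analysis"
begin

section \<open>The algebras of real, complex, quaternionic and octonionic numbers\<close>

class hypercomplex = real_normed_vector + one + times +
  fixes hconj :: "'a \<Rightarrow> 'a"

instantiation real :: hypercomplex
begin
definition hconj_real :: "real \<Rightarrow> real" where "hconj_real x = x"
instance ..
end

instantiation complex :: hypercomplex
begin
definition hconj_complex :: "complex \<Rightarrow> complex" where "hconj_complex z = cnj z"
instance ..
end

text \<open>Cayley--Dickson doubling, in the convention
  $(a,b)(c,d) = (ac - d^*b,\; da + bc^*)$, $(a,b)^* = (a^*,-b)$.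
  Doubling the complex numbers once gives the quaternions, and twice the octonions (which are
  not associative, so that the doubled type is not an instance of the ring classes).\<close>

datatype 'a cayley_dickson = CD (cd_fst: 'a) (cd_snd: 'a)

instantiation cayley_dickson :: (hypercomplex) hypercomplex
begin

definition zero_cayley_dickson :: "'a cayley_dickson" where
  "0 = CD 0 0"

definition one_cayley_dickson :: "'a cayley_dickson" where
  "1 = CD 1 0"

definition plus_cayley_dickson :: "'a cayley_dickson \<Rightarrow> 'a cayley_dickson \<Rightarrow> 'a cayley_dickson" where
  "x + y = CD (cd_fst x + cd_fst y) (cd_snd x + cd_snd y)"

definition minus_cayley_dickson :: "'a cayley_dickson \<Rightarrow> 'a cayley_dickson \<Rightarrow> 'a cayley_dickson" where
  "x - y = CD (cd_fst x - cd_fst y) (cd_snd x - cd_snd y)"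

definition uminus_cayley_dickson :: "'a cayley_dickson \<Rightarrow> 'a cayley_dickson" where
  "- x = CD (- cd_fst x) (- cd_snd x)"

definition times_cayley_dickson :: "'a cayley_dickson \<Rightarrow> 'a cayley_dickson \<Rightarrow> 'a cayley_dickson" where
  "x * y = CD (cd_fst x * cd_fst y - hconj (cd_snd y) * cd_snd x)
              (cd_snd y * cd_fst x + cd_snd x * hconj (cd_fst y))"

definition scaleR_cayley_dickson :: "real \<Rightarrow> 'a cayley_dickson \<Rightarrow> 'a cayley_dickson" where
  "c *\<^sub>R x = CD (c *\<^sub>R cd_fst x) (c *\<^sub>R cd_snd x)"

definition norm_cayley_dickson :: "'a cayley_dickson \<Rightarrow> real" where
  "norm x = sqrt ((norm (cd_fst x))\<^sup>2 + (norm (cd_snd x))\<^sup>2)"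

definition hconj_cayley_dickson :: "'a cayley_dickson \<Rightarrow> 'a cayley_dickson" where
  "hconj x = CD (hconj (cd_fst x)) (- cd_snd x)"

definition dist_cayley_dickson :: "'a cayley_dickson \<Rightarrow> 'a cayley_dickson \<Rightarrow> real" where
  "dist_cayley_dickson x y = norm (x - y)"

definition sgn_cayley_dickson :: "'a cayley_dickson \<Rightarrow> 'a cayley_dickson" where
  "sgn_cayley_dickson x = inverse (norm x) *\<^sub>R x"

definition uniformity_cayley_dickson :: "('a cayley_dickson \<times> 'a cayley_dickson) filter" where
  "uniformity_cayley_dickson = (INF e\<in>{0<..}. principal {(x, y). dist x y < e})"

definition open_cayley_dickson :: "'a cayley_dickson set \<Rightarrow> bool" where
  "open_cayley_dickson U \<longleftrightarrow> (\<forall>x\<in>U. eventually (\<lambda>(x', y). x' = x \<longrightarrow> y \<in> U) uniformity)"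

instance
proof
  fix x y :: "'a cayley_dickson" and c :: real
  show "norm (x + y) \<le> norm x + norm y"
    unfolding norm_cayley_dickson_def plus_cayley_dickson_def
    by (simp, rule order_trans[OF _ real_sqrt_sum_squares_triangle_ineq])
      (simp add: add_mono power_mono norm_triangle_ineq)
  show "norm (c *\<^sub>R x) = \<bar>c\<bar> * norm x"
    unfolding norm_cayley_dickson_def scaleR_cayley_dickson_def
    by (simp add: power_mult_distrib distrib_left[symmetric] real_sqrt_mult)
  show "norm x = 0 \<longleftrightarrow> x = 0"
    by (cases x) (simp add: norm_cayley_dickson_def zero_cayley_dickson_def sum_power2_eq_zero_iff)
qed (simp_all add: plus_cayley_dickson_def zero_cayley_dickson_def minus_cayley_dickson_def
      uminus_cayley_dickson_def scaleR_cayley_dickson_def dist_cayley_dickson_def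
      sgn_cayley_dickson_def uniformity_cayley_dickson_def open_cayley_dickson_def algebra_simps)

end

type_synonym quaternion = "complex cayley_dickson"
type_synonym octonion = "quaternion cayley_dickson"


section \<open>Two-point homogeneous spaces\<close>

text \<open>The dimension is a natural number rather than a type, so points of $\mathbb{R}^{d+1}$ and
  $(n+1)\times(n+1)$ matrices are functions on indices $0,\dots,d$ and $0,\dots,n$ that vanish
  at all other indices.\<close>

definition std_sphere :: "nat \<Rightarrow> (nat \<Rightarrow> real) set" where
  "std_sphere d = {x. (\<forall>i>d. x i = 0) \<and> (\<Sum>i\<le>d. (x i)\<^sup>2) = 1}"

definition sphere_dist :: "nat \<Rightarrow> (nat \<Rightarrow> real) \<Rightarrow> (nat \<Rightarrow> real) \<Rightarrow> real" where
  "sphere_dist d x y = arccos (\<Sum>i\<le>d. x i * y i)"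

type_synonym 'f sqmat = "nat \<Rightarrow> nat \<Rightarrow> 'f"

definition proj_space :: "nat \<Rightarrow> ('f::hypercomplex) sqmat set" where
  "proj_space n = {A.
     (\<forall>i j. i > n \<or> j > n \<longrightarrow> A i j = 0) \<and>
     (\<forall>i\<le>n. \<forall>j\<le>n. A j i = hconj (A i j)) \<and>
     (\<forall>i\<le>n. \<forall>j\<le>n. (\<Sum>k\<le>n. A i k * A k j) = A i j) \<and>
     (\<Sum>i\<le>n. A i i) = 1}"

text \<open>The solution $\theta \in [0,\pi]$ of
  $\sin\frac12\theta = \frac1{\sqrt2}\|A - B\|$.\<close>

definition proj_dist :: "nat \<Rightarrow> ('f::hypercomplex) sqmat \<Rightarrow> 'f sqmat \<Rightarrow> real" where
  "proj_dist n A B = 2 * arcsin (sqrt (\<Sum>i\<le>n. \<Sum>j\<le>n. (norm (A i j - B i j))\<^sup>2) / sqrt 2)"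

definition isometry_betw ::
  "('a \<Rightarrow> 'b) \<Rightarrow> 'a set \<Rightarrow> ('a \<Rightarrow> 'a \<Rightarrow> real) \<Rightarrow> 'b set \<Rightarrow> ('b \<Rightarrow> 'b \<Rightarrow> real) \<Rightarrow> bool" where
  "isometry_betw f X \<rho> Y \<sigma> \<longleftrightarrow>
     bij_betw f X Y \<and> (\<forall>x\<in>X. \<forall>y\<in>X. \<sigma> (f x) (f y) = \<rho> x y)"

definition isometric ::
  "'a set \<Rightarrow> ('a \<Rightarrow> 'a \<Rightarrow> real) \<Rightarrow> 'b set \<Rightarrow> ('b \<Rightarrow> 'b \<Rightarrow> real) \<Rightarrow> bool" where
  "isometric X \<rho> Y \<sigma> \<longleftrightarrow> (\<exists>f. isometry_betw f X \<rho> Y \<sigma>)"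

text \<open>The space $Q(d,d_0)$ with its distance $\theta$, up to isometry; each model is isometric to
  itself and thus included.\<close>

inductive two_point_homogeneous ::
  "'a set \<Rightarrow> ('a \<Rightarrow> 'a \<Rightarrow> real) \<Rightarrow> nat \<Rightarrow> nat \<Rightarrow> bool"
  for Q :: "'a set" and \<theta> :: "'a \<Rightarrow> 'a \<Rightarrow> real"
where
  Sphere: "d \<ge> 1 \<Longrightarrow> isometric Q \<theta> (std_sphere d) (sphere_dist d) \<Longrightarrow>
    two_point_homogeneous Q \<theta> d d"
| Real_Proj: "n \<ge> 2 \<Longrightarrow> isometric Q \<theta> (proj_space n :: real sqmat set) (proj_dist n) \<Longrightarrow>
    two_point_homogeneous Q \<theta> n 1"
| Complex_Proj: "n \<ge> 2 \<Longrightarrow> isometric Q \<theta> (proj_space n :: complex sqmat set) (proj_dist n) \<Longrightarrow>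
    two_point_homogeneous Q \<theta> (n * 2) 2"
| Quaternion_Proj: "n \<ge> 2 \<Longrightarrow> isometric Q \<theta> (proj_space n :: quaternion sqmat set) (proj_dist n) \<Longrightarrow>
    two_point_homogeneous Q \<theta> (n * 4) 4"
| Octonion_Plane: "isometric Q \<theta> (proj_space 2 :: octonion sqmat set) (proj_dist 2) \<Longrightarrow>
    two_point_homogeneous Q \<theta> (2 * 8) 8"

definition metric_ball :: "'a set \<Rightarrow> ('a \<Rightarrow> 'a \<Rightarrow> real) \<Rightarrow> 'a \<Rightarrow> real \<Rightarrow> 'a set" where
  "metric_ball Q \<theta> y r = {x \<in> Q. \<theta> x y < r}"

text \<open>The normalized Riemannian measure is the unique Borel probability measure on $Q$ (with the
  topology of $\theta$) that is invariant under all isometries of $(Q,\theta)$.\<close>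

definition invariant_measure :: "'a set \<Rightarrow> ('a \<Rightarrow> 'a \<Rightarrow> real) \<Rightarrow> 'a measure \<Rightarrow> bool" where
  "invariant_measure Q \<theta> \<mu> \<longleftrightarrow>
     space \<mu> = Q \<and>
     sets \<mu> = sigma_sets Q {U. U \<subseteq> Q \<and> (\<forall>x\<in>U. \<exists>r>0. metric_ball Q \<theta> x r \<subseteq> U)} \<and>
     emeasure \<mu> Q = 1 \<and>
     (\<forall>g. isometry_betw g Q \<theta> Q \<theta> \<longrightarrow> (\<forall>A\<in>sets \<mu>. emeasure \<mu> (g ` A) = emeasure \<mu> A))"


section \<open>Kernels and metrics\<close>

definition \<Lambda> :: "'a measure \<Rightarrow> 'a set \<Rightarrow> 'a \<Rightarrow> real" where
  "\<Lambda> \<mu> S x = indicator S x - measure \<mu> S"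

definition lam :: "'a set \<Rightarrow> ('a \<Rightarrow> 'a \<Rightarrow> real) \<Rightarrow> 'a measure \<Rightarrow> real \<Rightarrow> 'a \<Rightarrow> 'a \<Rightarrow> real" where
  "lam Q \<theta> \<mu> r y1 y2 = (\<integral>y. \<Lambda> \<mu> (metric_ball Q \<theta> y r) y1 * \<Lambda> \<mu> (metric_ball Q \<theta> y r) y2 \<partial>\<mu>)"

definition lam_weighted ::
  "'a set \<Rightarrow> ('a \<Rightarrow> 'a \<Rightarrow> real) \<Rightarrow> 'a measure \<Rightarrow> (real \<Rightarrow> real) \<Rightarrow> 'a \<Rightarrow> 'a \<Rightarrow> real" where
  "lam_weighted Q \<theta> \<mu> \<eta> y1 y2 = (LINT r:{0..pi}|lebesgue. lam Q \<theta> \<mu> r y1 y2 * \<eta> r)"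

definition symdiff_metric ::
  "'a set \<Rightarrow> ('a \<Rightarrow> 'a \<Rightarrow> real) \<Rightarrow> 'a measure \<Rightarrow> real \<Rightarrow> 'a \<Rightarrow> 'a \<Rightarrow> real" where
  "symdiff_metric Q \<theta> \<mu> r y1 y2 = 1 / 2 * measure \<mu> (sym_diff (metric_ball Q \<theta> y1 r) (metric_ball Q \<theta> y2 r))"

definition symdiff_metric_weighted ::
  "'a set \<Rightarrow> ('a \<Rightarrow> 'a \<Rightarrow> real) \<Rightarrow> 'a measure \<Rightarrow> (real \<Rightarrow> real) \<Rightarrow> 'a \<Rightarrow> 'a \<Rightarrow> real" where
  "symdiff_metric_weighted Q \<theta> \<mu> \<eta> y1 y2 =
     (LINT r:{0..pi}|lebesgue. symdiff_metric Q \<theta> \<mu> r y1 y2 * \<eta> r)"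

definition average :: "'a measure \<Rightarrow> ('a \<Rightarrow> 'a \<Rightarrow> real) \<Rightarrow> real" where
  "average \<mu> \<rho> = (\<integral>x. \<integral>y. \<rho> x y \<partial>\<mu> \<partial>\<mu>)"

text \<open>Meant for $a \ge b \ge 1$, so that the subtractions in the exponents do not truncate.\<close>

definition weight_class :: "nat \<Rightarrow> nat \<Rightarrow> (real \<Rightarrow> real) set" where
  "weight_class a b = {\<eta>. set_borel_measurable lebesgue {0..pi} \<eta> \<and>
     (\<forall>r\<in>{0..pi}. \<eta> r \<ge> 0) \<and>
     (\<integral>\<^sup>+r\<in>{0..pi}. ennreal (sin (r / 2) ^ (a - 1) * cos (r / 2) ^ (b - 1) * \<eta> r) \<partial>lebesgue) < \<infinity>}"


section \<open>Jacobi polynomials and the coefficients\<close>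

text \<open>The formula obtained from Rodrigues' formula by the Leibniz rule; it is valid for all
  real $\alpha$, $\beta$.\<close>

definition jacobi :: "real \<Rightarrow> real \<Rightarrow> nat \<Rightarrow> real \<Rightarrow> real" where
  "jacobi \<alpha> \<beta> l x =
     (\<Sum>s\<le>l. ((real l + \<alpha>) gchoose (l - s)) * ((real l + \<beta>) gchoose s) *
        ((x - 1) / 2) ^ s * ((x + 1) / 2) ^ (l - s))"

lemma jacobi_at_1: "jacobi \<alpha> \<beta> l 1 = (\<alpha> + real l) gchoose l"
proof -
  have "jacobi \<alpha> \<beta> l 1 = (\<Sum>s\<le>l. if s = 0 then (real l + \<alpha>) gchoose l else 0)"
    unfolding jacobi_def by (intro sum.cong) auto
  then show ?thesis by (simp add: add.commute)
qed

definition \<kappa> :: "nat \<Rightarrow> nat \<Rightarrow> real" where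
  "\<kappa> d d0 = Gamma (real d / 2 + real d0 / 2) / (Gamma (real d / 2) * Gamma (real d0 / 2))"

definition jacobi_M :: "real \<Rightarrow> real \<Rightarrow> nat \<Rightarrow> real" where
  "jacobi_M \<alpha> \<beta> l = (2 * real l + \<alpha> + \<beta> + 1) *
     (Gamma (real l + 1) * Gamma (real l + \<alpha> + \<beta> + 1)) /
     (Gamma (real l + \<alpha> + 1) * Gamma (real l + \<beta> + 1))"

text \<open>The parameters of the Jacobi polynomial are $\alpha + 1 = d/2$ and $\beta + 1 = d_0/2$.
  Only used for $l \ge 1$.\<close>

definition coeff_a :: "nat \<Rightarrow> nat \<Rightarrow> nat \<Rightarrow> real \<Rightarrow> real" where
  "coeff_a d d0 l r = sin (r / 2) ^ (2 * d) * cos (r / 2) ^ (2 * d0) *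
     (jacobi (real d / 2) (real d0 / 2) (l - 1) (cos r))\<^sup>2"

definition coeff_A :: "nat \<Rightarrow> nat \<Rightarrow> nat \<Rightarrow> (real \<Rightarrow> real) \<Rightarrow> real" where
  "coeff_A d d0 l \<eta> = (LINT u:{0..pi}|lebesgue. \<eta> u * coeff_a d d0 l u)"

end

(* Write t for cos theta. On each of the spaces any pair of points can be moved by an isometry to
   (p, g_0(theta)), where g_u, 1 <= u <= d, are unit speed geodesics from p in orthogonal directions
   and t(g_u(s), y) = A_u(y) + B_u(y) cos s + C_u(y) sin s; the sums of B_u and of C_u^2 are functions
   of t(p, y). Hence the convolution of two zonal polynomials is again a zonal polynomial, and
   differentiating it twice along all g_u at p shows that convolution commutes with the Jacobi operator.
   So P_l is reproduced up to a factor by every convolution, the P_l(t) are orthogonal, and all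
   their integrals with l >= 1 vanish; this determines the moments of t, thus the distribution of
   theta, which has density kappa sin^(d-1)(r/2) cos^(d0-1)(r/2). Expanding the indicator function of a
   ball in L^2 and convolving it with itself gives a pointwise convergent series for lambda_r; the
   coefficients come from the Rodrigues-type antiderivative of the density times P_l. Integration against eta is
   dominated convergence, since |P_l(t)| <= P_l(1) and v_r (1 - v_r) is at most a constant times the
   density of theta.

   The isometries of the projective spaces are generated by real rotations and by conjugation with
   diagonal matrices having entries u, u^* and 1, which for the octonions is compatible with
   the product by the Moufang identities. *)
theory Submission
  imports Defs
begin

section \<open>Jacobi polynomials\<close>

text \<open>Only a distance and an invariant Borel probability measure are given, with no smooth
  structure and no density. The part of the Laplacian is played by the finite sum over
  \<open>u\<close> of the second derivatives at \<open>s = 0\<close> along the curves: for a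
  polynomial f in t it is f''(t) times the sum of the squares of \<open>C u y\<close> minus f'(t)
  times the sum of the \<open>B u y\<close>, and the values of these two sums make it the Jacobi
  operator. A convolution identity may be differentiated on both sides along the same curves, which
  is why operator and convolution commute. All five families enter through one package of
  assumptions, the locale \<open>two_point_frame\<close>.

  The diagonal y1 = y2 carries much of the ending. The symmetric difference is empty there, so the
  coefficients of the expansion sum to v_r (1 - v_r). This yields the form with 1 - P_l(t) / P_l(1),
  the summability behind the average of the metric, and the majorant for the integration against
  \<eta>. The M_l are, up to the factor \<kappa>, the reciprocals of the squared norms of the
  P_l(t).\<close>

definition jacobi_poly :: "real \<Rightarrow> real \<Rightarrow> nat \<Rightarrow> real poly" where
  "jacobi_poly \<alpha> \<beta> l =
     (\<Sum>s\<le>l. smult (((real l + \<alpha>) gchoose (l - s)) * ((real l + \<beta>) gchoose s))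
        ([:- 1 / 2, 1 / 2:] ^ s * [:1 / 2, 1 / 2:] ^ (l - s)))"

lemma poly_jacobi_poly: "poly (jacobi_poly \<alpha> \<beta> l) x = jacobi \<alpha> \<beta> l x"
  unfolding jacobi_poly_def jacobi_def
  by (simp add: poly_sum diff_divide_distrib add_divide_distrib mult.assoc algebra_simps)

lemma gbinomial_Suc_mult: "real (Suc k) * (a gchoose Suc k) = (a - real k) * (a gchoose k)"
  for a :: real
  by (metis gbinomial_absorb_comp gbinomial_absorption)

text \<open>The coefficients are left arbitrary because the formula serves two different Jacobi
  sums. Truncation of the exponents \<open>s - 1\<close> and \<open>l - s - 1\<close> is harmless:
  the factor in front is then 0.\<close>

lemma DERIV_jacobi_sum:
  "((\<lambda>x. \<Sum>s\<le>l. c s * ((x - 1) / 2) ^ s * ((x + 1) / 2) ^ (l - s)) has_real_derivative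
    (\<Sum>s\<le>l. c s * (real s / 2 * ((x - 1) / 2) ^ (s - 1) * ((x + 1) / 2) ^ (l - s)
        + real (l - s) / 2 * ((x - 1) / 2) ^ s * ((x + 1) / 2) ^ (l - s - 1)))) (at x)"
proof -
  have X: "((\<lambda>x. ((x - 1) / 2) ^ s) has_real_derivative real s / 2 * ((x - 1) / 2) ^ (s - 1)) (at x)" for s
    by (rule DERIV_cong[OF DERIV_power[where D = "1 / 2"]]) (auto intro!: derivative_eq_intros)
  have Y: "((\<lambda>x. ((x + 1) / 2) ^ s) has_real_derivative real s / 2 * ((x + 1) / 2) ^ (s - 1)) (at x)" for s
    by (rule DERIV_cong[OF DERIV_power[where D = "1 / 2"]]) (auto intro!: derivative_eq_intros)
  show ?thesis
    by (rule DERIV_sum, rule DERIV_cong[OF DERIV_mult[OF DERIV_cmult[OF X] Y]]) (simp add: algebra_simps)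
qed

text \<open>After an index shift two terms contribute to X^s Y^(k - s). Since (k + 1) + \<alpha> = k
  + (\<alpha> + 1), and likewise for \<beta>, absorption turns both into multiples of the
  coefficient \<open>e s\<close> of the polynomial with raised parameters. Their factors (b - s) / 2
  and (a - (k - s)) / 2 have a sum free of s.\<close>

lemma DERIV_jacobi_Suc:
  "(jacobi \<alpha> \<beta> (Suc k) has_real_derivative
     (real (Suc k) + \<alpha> + \<beta> + 1) / 2 * jacobi (\<alpha> + 1) (\<beta> + 1) k x) (at x)"
proof -
  define a b where "a = real (Suc k) + \<alpha>" and "b = real (Suc k) + \<beta>"
  define X Y where "X = (x - 1) / 2" and "Y = (x + 1) / 2"
  define c where "c s = (a gchoose (Suc k - s)) * (b gchoose s)" for s
  define e where "e s = (a gchoose (k - s)) * (b gchoose s)" for s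
  have j: "jacobi \<alpha> \<beta> (Suc k) = (\<lambda>x. \<Sum>s\<le>Suc k. c s * ((x - 1) / 2) ^ s * ((x + 1) / 2) ^ (Suc k - s))"
    by (simp add: jacobi_def fun_eq_iff c_def a_def b_def)
  have "(\<Sum>s\<le>Suc k. c s * (real s / 2 * X ^ (s - 1) * Y ^ (Suc k - s)
        + real (Suc k - s) / 2 * X ^ s * Y ^ (Suc k - s - 1)))
     = (\<Sum>s\<le>Suc k. c s * (real s / 2 * X ^ (s - 1) * Y ^ (Suc k - s)))
      + (\<Sum>s\<le>Suc k. c s * (real (Suc k - s) / 2 * X ^ s * Y ^ (Suc k - s - 1)))"
    by (simp only: distrib_left sum.distrib)
  also have "(\<Sum>s\<le>Suc k. c s * (real s / 2 * X ^ (s - 1) * Y ^ (Suc k - s)))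
      = (\<Sum>s\<le>k. c (Suc s) * (real (Suc s) / 2 * X ^ s * Y ^ (k - s)))"
    by (subst sum.atMost_Suc_shift) simp
  also have "(\<Sum>s\<le>Suc k. c s * (real (Suc k - s) / 2 * X ^ s * Y ^ (Suc k - s - 1)))
      = (\<Sum>s\<le>k. c s * (real (Suc k - s) / 2 * X ^ s * Y ^ (k - s)))"
    by (subst sum.atMost_Suc) (auto intro!: sum.cong)
  also have "(\<Sum>s\<le>k. c (Suc s) * (real (Suc s) / 2 * X ^ s * Y ^ (k - s))) +
      (\<Sum>s\<le>k. c s * (real (Suc k - s) / 2 * X ^ s * Y ^ (k - s)))
      = (\<Sum>s\<le>k. (real (Suc k) + \<alpha> + \<beta> + 1) / 2 * (e s * X ^ s * Y ^ (k - s)))"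
  proof (subst sum.distrib[symmetric], rule sum.cong[OF refl])
    fix s assume "s \<in> {..k}"
    then have s: "s \<le> k" by simp
    have 1: "c (Suc s) * real (Suc s) = (b - s) * e s"
      using gbinomial_Suc_mult[of s b] by (simp add: c_def e_def mult_ac)
    have "Suc k - s = Suc (k - s)" using s by simp
    then have 2: "c s * real (Suc k - s) = (a - real (k - s)) * e s"
      using gbinomial_Suc_mult[of "k - s" a] by (simp add: c_def e_def mult_ac del: of_nat_Suc)
    have "c (Suc s) * (real (Suc s) / 2 * X ^ s * Y ^ (k - s)) +
      c s * (real (Suc k - s) / 2 * X ^ s * Y ^ (k - s)) =
      (c (Suc s) * real (Suc s) + c s * real (Suc k - s)) / 2 * (X ^ s * Y ^ (k - s))"
      by (simp add: field_simps del: of_nat_Suc)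
    also have "c (Suc s) * real (Suc s) + c s * real (Suc k - s) = (real (Suc k) + \<alpha> + \<beta> + 1) * e s"
      unfolding 1 2 using s by (simp add: a_def b_def of_nat_diff algebra_simps)
    finally show "c (Suc s) * (real (Suc s) / 2 * X ^ s * Y ^ (k - s)) +
      c s * (real (Suc k - s) / 2 * X ^ s * Y ^ (k - s)) =
      (real (Suc k) + \<alpha> + \<beta> + 1) / 2 * (e s * X ^ s * Y ^ (k - s))"
      by simp
  qed
  also have "\<dots> = (real (Suc k) + \<alpha> + \<beta> + 1) / 2 * jacobi (\<alpha> + 1) (\<beta> + 1) k x"
    by (simp add: jacobi_def sum_distrib_left e_def a_def b_def X_def Y_def algebra_simps)
  finally show ?thesis
    using DERIV_jacobi_sum[of c "Suc k" x] unfolding j X_def Y_def by (metis (no_types, lifting) DERIV_cong)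
qed

text \<open>The degree raising relation, which amounts to
  $\frac{d}{dx}\bigl[(1-x)^{\alpha+1}(1+x)^{\beta+1}P^{(\alpha+1,\beta+1)}_{k}\bigr]
   = -2(k+1)(1-x)^\alpha(1+x)^\beta P^{(\alpha,\beta)}_{k+1}$ with the weights cancelled.\<close>

lemma jacobi_raise_degree:
  assumes D: "(jacobi (\<alpha> + 1) (\<beta> + 1) k has_real_derivative D) (at x)"
  shows "(1 - x\<^sup>2) * D - ((\<alpha> + 1) * (1 + x) - (\<beta> + 1) * (1 - x)) * jacobi (\<alpha> + 1) (\<beta> + 1) k x
    = - 2 * real (Suc k) * jacobi \<alpha> \<beta> (Suc k) x"
proof -
  define a b where "a = real (Suc k) + \<alpha>" and "b = real (Suc k) + \<beta>"
  define X Y where "X = (x - 1) / 2" and "Y = (x + 1) / 2"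
  define c where "c s = (a gchoose (Suc k - s)) * (b gchoose s)" for s
  define e where "e s = (a gchoose (k - s)) * (b gchoose s)" for s
  have j: "jacobi (\<alpha> + 1) (\<beta> + 1) k = (\<lambda>x. \<Sum>s\<le>k. e s * ((x - 1) / 2) ^ s * ((x + 1) / 2) ^ (k - s))"
    by (simp add: jacobi_def fun_eq_iff e_def a_def b_def algebra_simps)
  have D': "D = (\<Sum>s\<le>k. e s * (real s / 2 * X ^ (s - 1) * Y ^ (k - s)
        + real (k - s) / 2 * X ^ s * Y ^ (k - s - 1)))"
    using DERIV_unique[OF D[unfolded j] DERIV_jacobi_sum] by (simp add: X_def Y_def)
  \<comment> \<open>Here 1 - x^2 = -4 X Y, 1 + x = 2 Y and 1 - x = -2 X, so every term becomes
    homogeneous in X and Y of degree k + 1.\<close>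
  have "(1 - x\<^sup>2) * D - ((\<alpha> + 1) * (1 + x) - (\<beta> + 1) * (1 - x)) * jacobi (\<alpha> + 1) (\<beta> + 1) k x
     = - 2 * (2 * X * Y * D + (\<alpha> + 1) * Y * (\<Sum>s\<le>k. e s * X ^ s * Y ^ (k - s))
         + (\<beta> + 1) * X * (\<Sum>s\<le>k. e s * X ^ s * Y ^ (k - s)))"
    unfolding j by (simp add: X_def Y_def field_simps power2_eq_square)
  also have "2 * X * Y * D + (\<alpha> + 1) * Y * (\<Sum>s\<le>k. e s * X ^ s * Y ^ (k - s))
         + (\<beta> + 1) * X * (\<Sum>s\<le>k. e s * X ^ s * Y ^ (k - s))
     = (\<Sum>s\<le>k. e s * (real s + \<alpha> + 1) * X ^ s * Y ^ (Suc k - s))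
       + (\<Sum>s\<le>k. e s * (real (k - s) + \<beta> + 1) * X ^ Suc s * Y ^ (k - s))"
    unfolding D' sum_distrib_left sum.distrib[symmetric]
  proof (rule sum.cong[OF refl])
    fix s assume "s \<in> {..k}"
    then have s: "Suc k - s = Suc (k - s)" by auto
    have 1: "real s * (X * X ^ (s - 1)) = real s * X ^ s" by (cases s) auto
    have 2: "real (k - s) * (Y * Y ^ (k - s - 1)) = real (k - s) * Y ^ (k - s)" by (cases "k - s") auto
    have "2 * X * Y * (e s * (real s / 2 * X ^ (s - 1) * Y ^ (k - s) + real (k - s) / 2 * X ^ s * Y ^ (k - s - 1)))
      = e s * (real s * (X * X ^ (s - 1))) * Y * Y ^ (k - s) + e s * X * X ^ s * (real (k - s) * (Y * Y ^ (k - s - 1)))"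
      by (simp add: algebra_simps)
    then show "2 * X * Y * (e s * (real s / 2 * X ^ (s - 1) * Y ^ (k - s) + real (k - s) / 2 * X ^ s * Y ^ (k - s - 1))) +
         (\<alpha> + 1) * Y * (e s * X ^ s * Y ^ (k - s)) +
         (\<beta> + 1) * X * (e s * X ^ s * Y ^ (k - s)) =
         e s * (real s + \<alpha> + 1) * X ^ s * Y ^ (Suc k - s) +
         e s * (real (k - s) + \<beta> + 1) * X ^ Suc s * Y ^ (k - s)"
      unfolding 1 2 s by (simp add: algebra_simps)
  qed
  also have "(\<Sum>s\<le>k. e s * (real s + \<alpha> + 1) * X ^ s * Y ^ (Suc k - s))
     = (\<Sum>s\<le>Suc k. real (Suc k - s) * c s * X ^ s * Y ^ (Suc k - s))"
  proof -
    have "e s * (real s + \<alpha> + 1) = real (Suc k - s) * c s" if "s \<le> k" for s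
    proof -
      have "Suc k - s = Suc (k - s)" using that by simp
      then have "real (Suc k - s) * c s = (a - real (k - s)) * e s"
        using gbinomial_Suc_mult[of "k - s" a] by (simp add: c_def e_def mult.assoc[symmetric] del: of_nat_Suc)
      then show ?thesis using that by (simp add: a_def of_nat_diff algebra_simps)
    qed
    then show ?thesis by simp
  qed
  also have "(\<Sum>s\<le>k. e s * (real (k - s) + \<beta> + 1) * X ^ Suc s * Y ^ (k - s))
     = (\<Sum>s\<le>Suc k. real s * c s * X ^ s * Y ^ (Suc k - s))"
  proof -
    have "e s * (real (k - s) + \<beta> + 1) = real (Suc s) * c (Suc s)" if "s \<le> k" for s
    proof -
      have "real (Suc s) * c (Suc s) = (b - real s) * e s"
        using gbinomial_Suc_mult[of s b] by (simp add: c_def e_def)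
      then show ?thesis using that by (simp add: b_def of_nat_diff algebra_simps)
    qed
    then show ?thesis by (subst sum.atMost_Suc_shift) simp
  qed
  \<comment> \<open>The weights Suc k - s and s add up to Suc k, which leaves a constant multiple of
    the Jacobi sum.\<close>
  also have "(\<Sum>s\<le>Suc k. real (Suc k - s) * c s * X ^ s * Y ^ (Suc k - s)) +
     (\<Sum>s\<le>Suc k. real s * c s * X ^ s * Y ^ (Suc k - s)) = real (Suc k) * jacobi \<alpha> \<beta> (Suc k) x"
    unfolding jacobi_def sum_distrib_left sum.distrib[symmetric]
    by (rule sum.cong) (auto simp: c_def a_def b_def X_def Y_def of_nat_diff algebra_simps)
  finally show ?thesis by (simp add: algebra_simps)
qed

lemma jacobi_at_1_pos: assumes "\<alpha> > -1" shows "jacobi \<alpha> \<beta> l 1 > 0"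
proof -
  have "(\<alpha> + real l) gchoose l > 0"
    unfolding gbinomial_prod_rev
    using assms by (auto intro!: divide_pos_pos prod_pos)
  then show ?thesis by (simp add: jacobi_at_1)
qed

section \<open>The Jacobi differential operator and its eigenspaces\<close>

definition jacobi_op :: "real \<Rightarrow> real \<Rightarrow> real poly \<Rightarrow> real poly" where
  "jacobi_op \<alpha> \<beta> f = [:1, 0, -1:] * pderiv (pderiv f) - [:\<alpha> - \<beta>, \<alpha> + \<beta> + 2:] * pderiv f"

text \<open>The operator is triangular on monomials: at its own degree x^k contributes -k (k - 1)
  from the second order part and -(\<alpha> + \<beta> + 2) k from the first order part, and above it
  nothing.\<close>

lemma coeff_jacobi_op_degree:
  assumes "degree f \<le> k"
  shows "coeff (jacobi_op \<alpha> \<beta> f) k = - (real k * (real k + \<alpha> + \<beta> + 1)) * coeff f k"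
proof -
  have z: "coeff f j = 0" if "j > k" for j using assms that by (simp add: coeff_eq_0)
  show ?thesis
  proof (cases k)
    case 0
    then show ?thesis using z by (simp add: jacobi_op_def coeff_pderiv)
  next
    case (Suc m)
    then show ?thesis using z
      by (cases m) (simp_all add: jacobi_op_def coeff_pderiv coeff_pCons algebra_simps)
  qed
qed

text \<open>Comparing leading coefficients gives (k - l) (k + l + \<alpha> + \<beta> + 1) = 0 for
  the degree k. The second factor can vanish only for k = l = 0, which happens for the circle, where
  \<alpha> + \<beta> + 1 = 0.\<close>

lemma jacobi_op_eigen_degree:
  assumes e: "jacobi_op \<alpha> \<beta> f = smult (- (real l * (real l + \<alpha> + \<beta> + 1))) f"
    and f: "f \<noteq> 0" and \<sigma>: "\<alpha> + \<beta> + 1 \<ge> 0"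
  shows "degree f = l"
proof -
  define k where "k = degree f"
  have "real k * (real k + \<alpha> + \<beta> + 1) = real l * (real l + \<alpha> + \<beta> + 1)"
    using coeff_jacobi_op_degree[of f k \<alpha> \<beta>] f unfolding e by (simp add: k_def)
  then have "(real k - real l) * (real k + real l + (\<alpha> + \<beta> + 1)) = 0" by (simp add: algebra_simps)
  then show ?thesis using \<sigma> by (auto simp: k_def)
qed

lemma jacobi_op_diff: "jacobi_op \<alpha> \<beta> (f - g) = jacobi_op \<alpha> \<beta> f - jacobi_op \<alpha> \<beta> g"
  by (simp only: jacobi_op_def pderiv_diff right_diff_distrib diff_diff_eq2 diff_add_eq diff_diff_eq add_ac)

lemma jacobi_op_smult: "jacobi_op \<alpha> \<beta> (smult c f) = smult c (jacobi_op \<alpha> \<beta> f)"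
  by (simp add: jacobi_op_def pderiv_smult smult_diff_right)

lemma pderiv_jacobi_poly_Suc:
  "pderiv (jacobi_poly \<alpha> \<beta> (Suc k)) =
     smult ((real (Suc k) + \<alpha> + \<beta> + 1) / 2) (jacobi_poly (\<alpha> + 1) (\<beta> + 1) k)"
proof -
  have "poly (pderiv (jacobi_poly \<alpha> \<beta> (Suc k))) x =
     poly (smult ((real (Suc k) + \<alpha> + \<beta> + 1) / 2) (jacobi_poly (\<alpha> + 1) (\<beta> + 1) k)) x" for x
    using DERIV_unique[OF poly_DERIV[of "jacobi_poly \<alpha> \<beta> (Suc k)" x, unfolded poly_jacobi_poly] DERIV_jacobi_Suc]
    by (simp add: poly_jacobi_poly)
  then show ?thesis by (simp add: poly_eq_poly_eq_iff[symmetric] fun_eq_iff)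
qed

text \<open>The derivative lowers the degree and raises both parameters; the raising relation undoes
  this. Their composition is the operator, and the two constants multiply to the eigenvalue.\<close>

lemma jacobi_op_jacobi_poly:
  "jacobi_op \<alpha> \<beta> (jacobi_poly \<alpha> \<beta> l) =
     smult (- (real l * (real l + \<alpha> + \<beta> + 1))) (jacobi_poly \<alpha> \<beta> l)"
proof (cases l)
  case 0
  then show ?thesis by (simp add: jacobi_op_def jacobi_poly_def pderiv_pCons pderiv_smult)
next
  case (Suc k)
  define q where "q = jacobi_poly (\<alpha> + 1) (\<beta> + 1) k"
  define \<sigma> where "\<sigma> = (real l + \<alpha> + \<beta> + 1) / 2"
  have p: "pderiv (jacobi_poly \<alpha> \<beta> l) = smult \<sigma> q"
    unfolding Suc pderiv_jacobi_poly_Suc q_def \<sigma>_def by simp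
  have "(jacobi (\<alpha> + 1) (\<beta> + 1) k has_real_derivative poly (pderiv q) x) (at x)" for x
    using poly_DERIV[of q x] unfolding q_def poly_jacobi_poly .
  then have r: "(1 - x\<^sup>2) * poly (pderiv q) x - ((\<alpha> + 1) * (1 + x) - (\<beta> + 1) * (1 - x)) * poly q x
    = - 2 * real l * poly (jacobi_poly \<alpha> \<beta> l) x" for x
    unfolding Suc q_def poly_jacobi_poly by (rule jacobi_raise_degree)
  have "poly (jacobi_op \<alpha> \<beta> (jacobi_poly \<alpha> \<beta> l)) x =
      \<sigma> * ((1 - x\<^sup>2) * poly (pderiv q) x - ((\<alpha> + 1) * (1 + x) - (\<beta> + 1) * (1 - x)) * poly q x)" for x
    unfolding jacobi_op_def p pderiv_smult by (simp add: algebra_simps power2_eq_square)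
  then have "poly (jacobi_op \<alpha> \<beta> (jacobi_poly \<alpha> \<beta> l)) x =
      poly (smult (- (real l * (real l + \<alpha> + \<beta> + 1))) (jacobi_poly \<alpha> \<beta> l)) x" for x
    unfolding r by (simp add: \<sigma>_def)
  then show ?thesis by (simp add: poly_eq_poly_eq_iff[symmetric] fun_eq_iff)
qed

lemma jacobi_poly_nonzero: assumes "\<alpha> > -1" shows "jacobi_poly \<alpha> \<beta> l \<noteq> 0"
  using jacobi_at_1_pos[OF assms, of \<beta> l] by (metis less_irrefl poly_0 poly_jacobi_poly)

lemma degree_jacobi_poly:
  assumes "\<alpha> > -1" "\<alpha> + \<beta> + 1 \<ge> 0"
  shows "degree (jacobi_poly \<alpha> \<beta> l) = l"
  using jacobi_op_eigen_degree[OF jacobi_op_jacobi_poly jacobi_poly_nonzero] assms by blast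

text \<open>Subtracting the multiple of the Jacobi polynomial that removes the coefficient at l
  leaves an eigenvector whose degree, were it nonzero, would still be l.\<close>

lemma jacobi_op_eigenspace:
  assumes e: "jacobi_op \<alpha> \<beta> f = smult (- (real l * (real l + \<alpha> + \<beta> + 1))) f"
    and \<alpha>: "\<alpha> > -1" and \<sigma>: "\<alpha> + \<beta> + 1 \<ge> 0"
  obtains c where "f = smult c (jacobi_poly \<alpha> \<beta> l)"
proof -
  define P where "P = jacobi_poly \<alpha> \<beta> l"
  have P: "degree P = l" "P \<noteq> 0" "coeff P l \<noteq> 0"
    using degree_jacobi_poly[OF \<alpha> \<sigma>] jacobi_poly_nonzero[OF \<alpha>]
    by (auto simp: P_def) (metis leading_coeff_0_iff jacobi_poly_nonzero[OF \<alpha>])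
  define g where "g = f - smult (coeff f l / coeff P l) P"
  have "jacobi_op \<alpha> \<beta> g = smult (- (real l * (real l + \<alpha> + \<beta> + 1))) g"
    by (simp add: g_def jacobi_op_diff jacobi_op_smult e P_def jacobi_op_jacobi_poly smult_diff_right mult.commute)
  moreover have "coeff g l = 0" using P by (simp add: g_def)
  ultimately have "g = 0"
    using jacobi_op_eigen_degree[of \<alpha> \<beta> g l] \<sigma> by (metis leading_coeff_0_iff)
  then show ?thesis using that[of "coeff f l / coeff P l"] by (simp add: g_def P_def)
qed

text \<open>The l-th polynomial has degree exactly l, so leading terms can be removed one degree at
  a time.\<close>

lemma jacobi_poly_span:
  assumes \<alpha>: "\<alpha> > -1" and \<sigma>: "\<alpha> + \<beta> + 1 \<ge> 0" and "degree f \<le> n"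
  shows "\<exists>b. f = (\<Sum>l\<le>n. smult (b l) (jacobi_poly \<alpha> \<beta> l))"
  using \<open>degree f \<le> n\<close>
proof (induction n arbitrary: f)
  case 0
  have "jacobi_poly \<alpha> \<beta> 0 = 1" by (simp add: jacobi_poly_def)
  moreover obtain a where "f = [:a:]" using 0 by (meson degree_eq_zeroE le_zero_eq)
  ultimately show ?case by (intro exI[of _ "\<lambda>_. a"]) simp
next
  case (Suc n)
  define P where "P = jacobi_poly \<alpha> \<beta> (Suc n)"
  have P: "degree P = Suc n" "coeff P (Suc n) \<noteq> 0"
    using degree_jacobi_poly[OF \<alpha> \<sigma>, of "Suc n"] by (auto simp: P_def) (metis degree_0 leading_coeff_0_iff nat.simps(3))
  define c where "c = coeff f (Suc n) / coeff P (Suc n)"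
  define g where "g = f - smult c P"
  have "degree g \<le> Suc n"
    unfolding g_def using Suc.prems P by (intro degree_diff_le) auto
  moreover have "coeff g (Suc n) = 0" using P by (simp add: g_def c_def)
  ultimately have "degree g \<le> n"
    by (metis degree_0 leading_coeff_0_iff le_SucE zero_le)
  then obtain b where "g = (\<Sum>l\<le>n. smult (b l) (jacobi_poly \<alpha> \<beta> l))" using Suc.IH by blast
  then have "f = (\<Sum>l\<le>Suc n. smult ((b(Suc n := c)) l) (jacobi_poly \<alpha> \<beta> l))"
    by (simp add: g_def P_def algebra_simps)
  then show ?case by blast
qed

section \<open>Jacobi polynomials and the angular weight\<close>

text \<open>The Jacobi weight (1 - x)^\<alpha> (1 + x)^\<beta> dx with \<alpha> = a/2 - 1 and
  \<beta> = b/2 - 1, pulled back by x = cos r, up to a constant. In this form the exponents are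
  natural numbers and the endpoints are not singular.\<close>

definition angular_weight :: "nat \<Rightarrow> nat \<Rightarrow> real \<Rightarrow> real" where
  "angular_weight a b r = sin (r / 2) ^ (a - 1) * cos (r / 2) ^ (b - 1)"

lemma continuous_on_angular_weight [continuous_intros]:
  fixes S :: "'a::t2_space set"
  shows "continuous_on S f \<Longrightarrow> continuous_on S (\<lambda>x. angular_weight a b (f x))"
  unfolding angular_weight_def by (intro continuous_on_mult continuous_on_power continuous_on_sin continuous_on_cos continuous_on_divide continuous_on_const) auto

lemma continuous_on_jacobi [continuous_intros]:
  assumes "continuous_on S f"
  shows "continuous_on S (\<lambda>x. jacobi \<alpha> \<beta> l (f x))"
  unfolding poly_jacobi_poly[symmetric] using assms by (intro continuous_intros)

lemma sin_half_nonneg: "r \<in> {0..pi} \<Longrightarrow> sin (r / 2) \<ge> 0"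
  by (auto intro!: sin_ge_zero)

lemma cos_half_nonneg: "r \<in> {0..pi} \<Longrightarrow> cos (r / 2) \<ge> 0"
  by (auto intro!: cos_ge_zero)

lemma angular_weight_nonneg: "r \<in> {0..pi} \<Longrightarrow> angular_weight a b r \<ge> 0"
  unfolding angular_weight_def using sin_half_nonneg[of r] cos_half_nonneg[of r] by simp

lemma DERIV_sin_cos_half_power:
  assumes "a \<ge> 1" "b \<ge> 1"
  shows "((\<lambda>r. sin (r / 2) ^ a * cos (r / 2) ^ b) has_real_derivative
     angular_weight a b r * (real a / 2 * (cos (r / 2))\<^sup>2 - real b / 2 * (sin (r / 2))\<^sup>2)) (at r)"
proof -
  obtain a' b' where ab: "a = Suc a'" "b = Suc b'" using assms by (metis Suc_le_D One_nat_def)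
  show ?thesis unfolding ab angular_weight_def
    by (auto intro!: derivative_eq_intros simp: algebra_simps power2_eq_square simp del: power_Suc of_nat_Suc)
      (simp add: algebra_simps)
qed

lemma half_angle:
  fixes r :: real
  shows "(cos (r / 2))\<^sup>2 = (1 + cos r) / 2" "(sin (r / 2))\<^sup>2 = (1 - cos r) / 2"
    "sin r = 2 * sin (r / 2) * cos (r / 2)"
  using cos_double_cos[of "r / 2"] cos_double_sin[of "r / 2"] sin_double[of "r / 2"] by auto

text \<open>This is \<open>jacobi_raise_degree\<close> with the weight restored. One explicit
  antiderivative serves twice: taken up to \<open>pi\<close> it makes the weighted mean of each
  polynomial of positive degree vanish, taken up to \<open>r\<close> it gives the Fourier
  coefficients of a ball.\<close>

lemma DERIV_weighted_jacobi:
  assumes "a \<ge> 1" "b \<ge> 1"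
  shows "((\<lambda>r. sin (r / 2) ^ a * cos (r / 2) ^ b * jacobi (real a / 2) (real b / 2) k (cos r)) has_real_derivative
     real (Suc k) * (angular_weight a b r * jacobi (real a / 2 - 1) (real b / 2 - 1) (Suc k) (cos r))) (at r)"
proof -
  define \<alpha> \<beta> where "\<alpha> = real a / 2 - 1" and "\<beta> = real b / 2 - 1"
  define x where "x = cos r"
  obtain D where D: "(jacobi (\<alpha> + 1) (\<beta> + 1) k has_real_derivative D) (at x)"
    using poly_DERIV[of "jacobi_poly (\<alpha> + 1) (\<beta> + 1) k" x] unfolding poly_jacobi_poly by blast
  have D': "(jacobi (real a / 2) (real b / 2) k has_real_derivative D) (at (cos r))"
    using D by (simp add: \<alpha>_def \<beta>_def x_def)
  have ab: "sin (r / 2) ^ a * cos (r / 2) ^ b = angular_weight a b r * (sin (r / 2) * cos (r / 2))"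
    using assms by (cases a; cases b) (auto simp: angular_weight_def)
  have "((\<lambda>r. sin (r / 2) ^ a * cos (r / 2) ^ b * jacobi (real a / 2) (real b / 2) k (cos r)) has_real_derivative
     angular_weight a b r * (real a / 2 * (cos (r / 2))\<^sup>2 - real b / 2 * (sin (r / 2))\<^sup>2) * jacobi (real a / 2) (real b / 2) k (cos r) +
       D * (- sin r) * (sin (r / 2) ^ a * cos (r / 2) ^ b)) (at r)"
    by (rule DERIV_mult[OF DERIV_sin_cos_half_power[OF assms] DERIV_chain'[OF DERIV_cos D', simplified mult.commute[of _ D]]])
  also have "angular_weight a b r * (real a / 2 * (cos (r / 2))\<^sup>2 - real b / 2 * (sin (r / 2))\<^sup>2) * jacobi (real a / 2) (real b / 2) k (cos r) +
       D * (- sin r) * (sin (r / 2) ^ a * cos (r / 2) ^ b)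
     = angular_weight a b r * - ((1 - x\<^sup>2) * D - ((\<alpha> + 1) * (1 + x) - (\<beta> + 1) * (1 - x)) * jacobi (\<alpha> + 1) (\<beta> + 1) k x) / 2"
  proof -
    have s2: "sin r * (sin (r / 2) * cos (r / 2)) = (1 - x\<^sup>2) / 2"
      using half_angle(3)[of r] sin_squared_eq[of r] by (simp add: x_def power2_eq_square)
    have "D * (- sin r) * (sin (r / 2) ^ a * cos (r / 2) ^ b) = - angular_weight a b r * D * (sin r * (sin (r / 2) * cos (r / 2)))"
      unfolding ab by simp
    then show ?thesis unfolding s2 half_angle(1,2) by (simp add: \<alpha>_def \<beta>_def x_def field_simps)
  qed
  also have "\<dots> = real (Suc k) * (angular_weight a b r * jacobi (real a / 2 - 1) (real b / 2 - 1) (Suc k) (cos r))"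
    unfolding jacobi_raise_degree[OF D] by (simp add: \<alpha>_def \<beta>_def x_def algebra_simps)
  finally show ?thesis .
qed

text \<open>The boundary term at 0 vanishes because of the power of the sine, as
  \<open>a \<ge> 1\<close>. The square of the value is \<open>coeff_a\<close> at l = k + 1 divided
  by l^2, which explains the doubled exponents and the degree l - 1 there.\<close>

lemma has_integral_weighted_jacobi:
  assumes "a \<ge> 1" "b \<ge> 1" "0 \<le> r"
  shows "((\<lambda>r. angular_weight a b r * jacobi (real a / 2 - 1) (real b / 2 - 1) (Suc k) (cos r)) has_integral
     sin (r / 2) ^ a * cos (r / 2) ^ b * jacobi (real a / 2) (real b / 2) k (cos r) / real (Suc k)) {0..r}"
proof -
  let ?f = "\<lambda>r. sin (r / 2) ^ a * cos (r / 2) ^ b * jacobi (real a / 2) (real b / 2) k (cos r)"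
  let ?w = "\<lambda>r. angular_weight a b r * jacobi (real a / 2 - 1) (real b / 2 - 1) (Suc k) (cos r)"
  have "((\<lambda>r. real (Suc k) * ?w r) has_integral ?f r - ?f 0) {0..r}"
    using DERIV_weighted_jacobi[OF assms(1,2)] assms(3)
    by (intro fundamental_theorem_of_calculus)
      (auto simp: has_real_derivative_iff_has_vector_derivative intro: has_vector_derivative_at_within)
  from has_integral_mult_right[OF this, of "1 / real (Suc k)"] show ?thesis
    using assms(1) by (cases a) (simp_all add: field_simps del: of_nat_Suc)
qed

section \<open>Beta integrals of the angular weight\<close>

definition sin_cos_integral :: "nat \<Rightarrow> nat \<Rightarrow> real" where
  "sin_cos_integral a b = integral {0..pi} (angular_weight a b)"

lemma angular_weight_integrable: "angular_weight a b integrable_on {0..pi}"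
  by (intro integrable_continuous_real continuous_on_angular_weight continuous_intros)

lemma sin_cos_integral_split:
  assumes "a \<ge> 1" "b \<ge> 1"
  shows "sin_cos_integral (a + 2) b + sin_cos_integral a (b + 2) = sin_cos_integral a b"
proof -
  have "angular_weight (a + 2) b r + angular_weight a (b + 2) r = angular_weight a b r" for r
  proof -
    have "angular_weight (a + 2) b r + angular_weight a (b + 2) r =
      angular_weight a b r * ((sin (r / 2))\<^sup>2 + (cos (r / 2))\<^sup>2)"
      unfolding distrib_left using assms by (cases a; cases b) (simp_all add: angular_weight_def power2_eq_square)
    then show ?thesis by (simp only: sin_cos_squared_add mult_1_right)
  qed
  then show ?thesis unfolding sin_cos_integral_def
    by (subst integral_add[symmetric]) (auto intro: angular_weight_integrable)
qed

text \<open>Integrates the derivative of sin(r/2)^a cos(r/2)^b, a function that vanishes at 0 and at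
  \<open>pi\<close>. Together with \<open>sin_cos_integral_split\<close> this is a linear system for
  the two shifted integrals.\<close>

lemma sin_cos_integral_parts:
  assumes "a \<ge> 1" "b \<ge> 1"
  shows "real a * sin_cos_integral a (b + 2) = real b * sin_cos_integral (a + 2) b"
proof -
  have e: "angular_weight a b r * (real a / 2 * (cos (r / 2))\<^sup>2 - real b / 2 * (sin (r / 2))\<^sup>2)
    = real a / 2 * angular_weight a (b + 2) r - real b / 2 * angular_weight (a + 2) b r" for r
    using assms by (cases a; cases b) (auto simp: angular_weight_def power2_eq_square algebra_simps)
  let ?f = "\<lambda>r. sin (r / 2) ^ a * cos (r / 2) ^ b"
  have "((\<lambda>r. real a / 2 * angular_weight a (b + 2) r - real b / 2 * angular_weight (a + 2) b r)
      has_integral ?f pi - ?f 0) {0..pi}"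
    using DERIV_sin_cos_half_power[OF assms, unfolded e]
    by (intro fundamental_theorem_of_calculus)
      (auto simp: has_real_derivative_iff_has_vector_derivative intro: has_vector_derivative_at_within)
  moreover have "((\<lambda>r. real a / 2 * angular_weight a (b + 2) r - real b / 2 * angular_weight (a + 2) b r)
      has_integral real a / 2 * sin_cos_integral a (b + 2) - real b / 2 * sin_cos_integral (a + 2) b) {0..pi}"
    unfolding sin_cos_integral_def
    by (intro has_integral_diff has_integral_mult_right integrable_integral angular_weight_integrable)
  ultimately have "real a / 2 * sin_cos_integral a (b + 2) - real b / 2 * sin_cos_integral (a + 2) b = ?f pi - ?f 0"
    using has_integral_unique by blast
  also have "?f pi - ?f 0 = 0" using assms by (simp add: zero_power)
  finally show ?thesis by simp
qed

lemma sin_cos_integral_add2_left: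
  assumes "a \<ge> 1" "b \<ge> 1"
  shows "sin_cos_integral (a + 2) b = real a / (real a + real b) * sin_cos_integral a b"
proof -
  have "(real a + real b) * sin_cos_integral (a + 2) b = real a * sin_cos_integral a b"
    unfolding sin_cos_integral_split[OF assms, symmetric] distrib_left sin_cos_integral_parts[OF assms]
    by (simp add: algebra_simps)
  then show ?thesis using assms by (simp add: field_simps)
qed

lemma sin_cos_integral_add2_right:
  assumes "a \<ge> 1" "b \<ge> 1"
  shows "sin_cos_integral a (b + 2) = real b / (real a + real b) * sin_cos_integral a b"
proof -
  have "(real a + real b) * sin_cos_integral a (b + 2) = real b * sin_cos_integral a b"
    unfolding sin_cos_integral_split[OF assms, symmetric] distrib_left sin_cos_integral_parts[OF assms, symmetric]
    by (simp add: algebra_simps)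
  then show ?thesis using assms by (simp add: field_simps)
qed

lemma sin_cos_integral_base:
  "sin_cos_integral 1 1 = pi" "sin_cos_integral 2 1 = 2" "sin_cos_integral 1 2 = 2" "sin_cos_integral 2 2 = 1"
proof -
  show "sin_cos_integral 1 1 = pi" by (simp add: sin_cos_integral_def angular_weight_def[abs_def])
  have "((\<lambda>r. sin (r / 2)) has_integral (- 2 * cos (pi / 2)) - (- 2 * cos (0 / 2))) {0..pi}"
    by (rule fundamental_theorem_of_calculus)
      (auto simp: has_real_derivative_iff_has_vector_derivative[symmetric] intro!: derivative_eq_intros)
  then show "sin_cos_integral 2 1 = 2"
    by (simp add: sin_cos_integral_def angular_weight_def[abs_def] integral_unique)
  have "((\<lambda>r. cos (r / 2)) has_integral (2 * sin (pi / 2)) - (2 * sin (0 / 2))) {0..pi}"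
    by (rule fundamental_theorem_of_calculus)
      (auto simp: has_real_derivative_iff_has_vector_derivative[symmetric] intro!: derivative_eq_intros)
  then show "sin_cos_integral 1 2 = 2"
    by (simp add: sin_cos_integral_def angular_weight_def[abs_def] integral_unique)
  have "((\<lambda>r. sin (r / 2) * cos (r / 2)) has_integral ((sin (pi / 2))\<^sup>2) - ((sin (0 / 2))\<^sup>2)) {0..pi}"
    by (rule fundamental_theorem_of_calculus)
      (auto simp: has_real_derivative_iff_has_vector_derivative[symmetric] intro!: derivative_eq_intros)
  then show "sin_cos_integral 2 2 = 1"
    by (simp add: sin_cos_integral_def angular_weight_def[abs_def] integral_unique)
qed

lemma Gamma_half_add2:
  assumes "a \<ge> 1"
  shows "Gamma (real (a + 2) / 2) = real a / 2 * Gamma (real a / 2)"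
proof -
  have "real a / 2 \<notin> \<int>\<^sub>\<le>\<^sub>0" using assms nonpos_Ints_nonpos by fastforce
  from Gamma_plus1[OF this] show ?thesis by (simp add: add_divide_distrib add.commute)
qed

text \<open>The integral is the Beta function at (a/2, b/2). For natural numbers \<open>a\<close>
  and \<open>b\<close> it follows from the recursion by 2 in either argument and the four base
  cases.\<close>

lemma sin_cos_integral_eq:
  assumes "a \<ge> 1" "b \<ge> 1"
  shows "sin_cos_integral a b = Gamma (real a / 2) * Gamma (real b / 2) / Gamma (real a / 2 + real b / 2)"
  using assms
proof (induction "a + b" arbitrary: a b rule: less_induct)
  case less
  have G: "Gamma (real (a + b) / 2) > 0" if "a + b \<ge> 1" for a b :: nat
    using that by (intro Gamma_real_pos) auto
  consider c where "a = c + 2" "c \<ge> 1" | c where "b = c + 2" "c \<ge> 1" | "a \<in> {1,2}" "b \<in> {1,2}"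
  proof -
    have "a \<in> {1,2} \<or> a = (a - 2) + 2 \<and> a - 2 \<ge> 1" "b \<in> {1,2} \<or> b = (b - 2) + 2 \<and> b - 2 \<ge> 1"
      using less.prems by auto
    then show ?thesis using that by blast
  qed
  then show ?case
  proof cases
    case 1
    have "sin_cos_integral a b = real c / (real c + real b) * sin_cos_integral c b"
      unfolding 1(1) by (rule sin_cos_integral_add2_left[OF 1(2) less.prems(2)])
    also have "sin_cos_integral c b = Gamma (real c / 2) * Gamma (real b / 2) / Gamma (real (c + b) / 2)"
      using less.hyps[of c b] 1 less.prems by (simp add: add_divide_distrib)
    also have "real c / (real c + real b) * \<dots> =
      (real c / 2 * Gamma (real c / 2)) * Gamma (real b / 2) / (real (c + b) / 2 * Gamma (real (c + b) / 2))"
      using 1 G[of c b] by (simp add: field_simps)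
    also have "\<dots> = Gamma (real a / 2) * Gamma (real b / 2) / Gamma (real (c + b + 2) / 2)"
      using 1(2) by (simp only: 1(1) Gamma_half_add2[of c] Gamma_half_add2[of "c + b"] trans_le_add1)
    finally show ?thesis using 1 by (simp add: add_divide_distrib add_ac)
  next
    case 2
    have "sin_cos_integral a b = real c / (real a + real c) * sin_cos_integral a c"
      unfolding 2(1) by (rule sin_cos_integral_add2_right[OF less.prems(1) 2(2)])
    also have "sin_cos_integral a c = Gamma (real a / 2) * Gamma (real c / 2) / Gamma (real (c + a) / 2)"
      using less.hyps[of a c] 2 less.prems by (simp add: add_divide_distrib add.commute)
    also have "real c / (real a + real c) * \<dots> =
      Gamma (real a / 2) * (real c / 2 * Gamma (real c / 2)) / (real (c + a) / 2 * Gamma (real (c + a) / 2))"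
      using 2 G[of c a] by (simp add: field_simps)
    also have "\<dots> = Gamma (real a / 2) * Gamma (real b / 2) / Gamma (real (c + a + 2) / 2)"
      using 2(2) by (simp only: 2(1) Gamma_half_add2[of c] Gamma_half_add2[of "c + a"] trans_le_add1)
    finally show ?thesis using 2 by (simp add: add_divide_distrib add_ac)
  next
    case 3
    have g: "Gamma (3 / 2 :: real) = sqrt pi / 2"
      using Gamma_half_add2[of 1] by (simp add: Gamma_one_half_real)
    have g2: "Gamma (2 :: real) = 1" using Gamma_fact[of 1, where 'a = real] by simp
    show ?thesis using 3 sin_cos_integral_base
      by (auto simp: Gamma_one_half_real g g2)
  qed
qed

section \<open>Squared norms of the Jacobi polynomials\<close>

definition jacobi_norm2 :: "nat \<Rightarrow> nat \<Rightarrow> nat \<Rightarrow> real" where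
  "jacobi_norm2 a b l =
     integral {0..pi} (\<lambda>r. angular_weight a b r * (jacobi (real a / 2 - 1) (real b / 2 - 1) l (cos r))\<^sup>2)"

text \<open>Integration by parts: F is an antiderivative of k + 1 times the weighted P, and
  differentiating P brings in the polynomial of degree k with raised parameters. Together with F,
  the sine from the chain rule forms the weight for (a + 2, b + 2).\<close>

lemma jacobi_norm2_Suc:
  assumes "a \<ge> 1" "b \<ge> 1"
  shows "jacobi_norm2 a b (Suc k) =
    (real k + real a / 2 + real b / 2) / real (Suc k) * jacobi_norm2 (a + 2) (b + 2) k"
proof -
  define P where "P r = jacobi (real a / 2 - 1) (real b / 2 - 1) (Suc k) (cos r)" for r
  define Q where "Q r = jacobi (real a / 2) (real b / 2) k (cos r)" for r
  define F where "F r = sin (r / 2) ^ a * cos (r / 2) ^ b * Q r" for r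
  define \<sigma> where "\<sigma> = real k + real a / 2 + real b / 2"
  have dF: "(F has_real_derivative real (Suc k) * (angular_weight a b r * P r)) (at r)" for r
    unfolding F_def[abs_def] P_def Q_def by (rule DERIV_weighted_jacobi[OF assms])
  have dP: "(P has_real_derivative \<sigma> / 2 * Q r * (- sin r)) (at r)" for r
    unfolding P_def Q_def \<sigma>_def using DERIV_jacobi_Suc[of "real a / 2 - 1" "real b / 2 - 1" k "cos r"]
    by (intro DERIV_chain2[where g = cos, OF _ DERIV_cos]) (simp add: add_ac)
  have F: "F r * (sin (r / 2) * cos (r / 2)) = angular_weight (a + 2) (b + 2) r * Q r" for r
    by (simp add: F_def angular_weight_def)
  have dFP: "((\<lambda>r. F r * P r) has_real_derivative real (Suc k) * (angular_weight a b r * (P r)\<^sup>2)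
      - \<sigma> * (angular_weight (a + 2) (b + 2) r * (Q r)\<^sup>2)) (at r)" for r
  proof -
    have "\<sigma> / 2 * Q r * (- sin r) * F r = - \<sigma> * Q r * (F r * (sin (r / 2) * cos (r / 2)))"
      unfolding half_angle(3)[of r] by simp
    then have "\<sigma> / 2 * Q r * (- sin r) * F r = - \<sigma> * (angular_weight (a + 2) (b + 2) r * (Q r)\<^sup>2)"
      unfolding F by (simp add: power2_eq_square)
    then show ?thesis by (intro DERIV_cong[OF DERIV_mult[OF dF dP]]) (simp only:, simp add: power2_eq_square)
  qed
  have cP: "continuous_on {0..pi} P" "continuous_on {0..pi} Q"
    unfolding P_def Q_def by (intro continuous_intros)+
  have "((\<lambda>r. real (Suc k) * (angular_weight a b r * (P r)\<^sup>2)
      - \<sigma> * (angular_weight (a + 2) (b + 2) r * (Q r)\<^sup>2)) has_integral F pi * P pi - F 0 * P 0) {0..pi}"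
    using dFP by (intro fundamental_theorem_of_calculus)
      (auto simp: has_real_derivative_iff_has_vector_derivative intro: has_vector_derivative_at_within)
  moreover have "((\<lambda>r. real (Suc k) * (angular_weight a b r * (P r)\<^sup>2)
      - \<sigma> * (angular_weight (a + 2) (b + 2) r * (Q r)\<^sup>2)) has_integral
       real (Suc k) * jacobi_norm2 a b (Suc k) - \<sigma> * jacobi_norm2 (a + 2) (b + 2) k) {0..pi}"
    unfolding jacobi_norm2_def P_def[symmetric]
    using cP by (intro has_integral_diff has_integral_mult_right)
      (auto simp: Q_def add_divide_distrib intro!: integrable_integral integrable_continuous_real continuous_intros)
  ultimately have "real (Suc k) * jacobi_norm2 a b (Suc k) - \<sigma> * jacobi_norm2 (a + 2) (b + 2) k = F pi * P pi - F 0 * P 0"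
    using has_integral_unique by blast
  also have "\<dots> = 0" using assms by (simp add: F_def zero_power)
  finally show ?thesis by (simp add: \<sigma>_def field_simps)
qed

text \<open>The induction lowers l while raising (a, b), so only l = 0 is computed directly, from
  the Beta integral. Excluding l = 0 with a = b = 1 is essential: there \<open>jacobi_M\<close>
  contains 0 times Gamma at 0.\<close>

lemma jacobi_norm2_eq:
  assumes "a \<ge> 1" "b \<ge> 1" "l \<ge> 1 \<or> a + b > 2"
  shows "jacobi_norm2 a b l * jacobi_M (real a / 2 - 1) (real b / 2 - 1) l = 1"
  using assms
proof (induction l arbitrary: a b)
  case 0
  define u v where "u = real a / 2" and "v = real b / 2"
  have uv: "u > 0" "v > 0" "u + v > 1" using 0 by (auto simp: u_def v_def)
  have "jacobi_norm2 a b 0 = sin_cos_integral a b"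
    by (simp add: jacobi_norm2_def sin_cos_integral_def jacobi_def)
  also have "\<dots> = Gamma u * Gamma v / Gamma (u + v)"
    using sin_cos_integral_eq[of a b] 0 by (simp add: u_def v_def)
  finally have 1: "jacobi_norm2 a b 0 = Gamma u * Gamma v / Gamma (u + v)" .
  have "Gamma (u + v - 1 + 1) = (u + v - 1) * Gamma (u + v - 1)"
    using uv by (intro Gamma_plus1) auto
  then have "jacobi_M (u - 1) (v - 1) 0 = Gamma (u + v) / (Gamma u * Gamma v)"
    by (simp add: jacobi_M_def algebra_simps)
  moreover have "Gamma u > 0" "Gamma v > 0" "Gamma (u + v) > 0"
    using uv by (auto intro!: Gamma_real_pos)
  ultimately show ?case using 1 by (simp add: u_def v_def)
next
  case (Suc k)
  define u v where "u = real a / 2" and "v = real b / 2"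
  have uv: "u > 0" "v > 0" "u + v \<ge> 1" using Suc by (auto simp: u_def v_def)
  have IH: "jacobi_norm2 (a + 2) (b + 2) k * jacobi_M u v k = 1"
    using Suc.IH[of "a + 2" "b + 2"] by (simp add: u_def v_def add_divide_distrib)
  have G: "Gamma (real k + 1 + 1) = (real k + 1) * Gamma (real k + 1)"
     "Gamma (real k + u + v + 1) = (real k + u + v) * Gamma (real k + u + v)"
    using uv by (intro Gamma_plus1; auto)+
  define g where "g = Gamma (real k + u + v)"
  define M where "M = Gamma (real k + 1) / (Gamma (real k + u + 1) * Gamma (real k + v + 1)) * (2 * real k + u + v + 1)"
  have M1: "jacobi_M u v k = M * ((real k + u + v) * g)"
    using G(2) by (simp add: jacobi_M_def M_def g_def)
  have M2: "jacobi_M (u - 1) (v - 1) (Suc k) = M * ((real k + 1) * g)"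
    using G(1) by (simp add: jacobi_M_def M_def g_def algebra_simps)
  have "jacobi_norm2 a b (Suc k) * jacobi_M (u - 1) (v - 1) (Suc k) =
    (real k + u + v) / real (Suc k) * jacobi_norm2 (a + 2) (b + 2) k * (M * ((real k + 1) * g))"
    unfolding jacobi_norm2_Suc[OF Suc.prems(1,2)] M2 by (simp add: u_def v_def)
  also have "\<dots> = jacobi_norm2 (a + 2) (b + 2) k * (M * ((real k + u + v) * g))"
    by (simp add: field_simps)
  also have "\<dots> = 1" using IH unfolding M1 .
  finally show ?case by (simp add: u_def v_def)
qed

lemma borel_measurable_angular_weight [measurable]: "angular_weight a b \<in> borel_measurable borel"
  by (intro borel_measurable_continuous_onI continuous_on_angular_weight continuous_intros)

section \<open>Bounded measurable functions and polynomial approximation\<close>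

lemma borel_measurable_poly [measurable]: "poly (p :: real poly) \<in> borel_measurable borel"
  by (intro borel_measurable_continuous_onI continuous_intros)

lemma poly_eq_on_Icc:
  fixes f g :: "real poly"
  assumes "\<And>z. z \<in> {-1..1} \<Longrightarrow> poly f z = poly g z"
  shows "f = g"
proof (rule ccontr)
  assume "f \<noteq> g"
  then have "finite {z. poly (f - g) z = 0}" by (intro poly_roots_finite) auto
  moreover have "{-1..1} \<subseteq> {z. poly (f - g) z = 0}" using assms by auto
  moreover have "infinite {-1..1::real}" by (simp add: infinite_Icc)
  ultimately show False using finite_subset by blast
qed

lemma LBINT_continuous_Icc:
  fixes f :: "real \<Rightarrow> real"
  assumes "continuous_on {a..b} f"
  shows "(LBINT s:{a..b}. f s) = integral {a..b} f"
  by (rule set_borel_integral_eq_integral(2)[OF borel_integrable_atLeastAtMost'[OF assms]])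

text \<open>Closed under sums, products and polynomials, and sufficient for integrability under a
  finite measure, so the integrability of the integrands on Q reduces to this one notion. The bound
  is asked on \<open>space M\<close> only, as functions are arbitrary outside.\<close>

definition bounded_measurable :: "'a measure \<Rightarrow> ('a \<Rightarrow> real) \<Rightarrow> bool" where
  "bounded_measurable M f \<longleftrightarrow> f \<in> borel_measurable M \<and> (\<exists>K. \<forall>x\<in>space M. \<bar>f x\<bar> \<le> K)"

lemma bounded_measurableI:
  assumes "f \<in> borel_measurable M" "\<And>x. x \<in> space M \<Longrightarrow> \<bar>f x\<bar> \<le> K"
  shows "bounded_measurable M f"
  using assms by (auto simp: bounded_measurable_def)

lemma bounded_measurableD: "bounded_measurable M f \<Longrightarrow> f \<in> borel_measurable M"
  by (simp add: bounded_measurable_def)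

lemma bounded_measurable_const [simp, intro]: "bounded_measurable M (\<lambda>_. c)"
  by (auto simp: bounded_measurable_def)

lemma bounded_measurable_add [intro]:
  assumes "bounded_measurable M f" "bounded_measurable M g"
  shows "bounded_measurable M (\<lambda>x. f x + g x)"
proof -
  obtain K L where "\<And>x. x \<in> space M \<Longrightarrow> \<bar>f x\<bar> \<le> K" "\<And>x. x \<in> space M \<Longrightarrow> \<bar>g x\<bar> \<le> L"
    using assms by (auto simp: bounded_measurable_def)
  then have "\<And>x. x \<in> space M \<Longrightarrow> \<bar>f x + g x\<bar> \<le> K + L"
    by (meson abs_triangle_ineq add_mono order_trans)
  then show ?thesis using assms by (intro bounded_measurableI) (auto simp: bounded_measurable_def)
qed

lemma bounded_measurable_mult [intro]:
  assumes "bounded_measurable M f" "bounded_measurable M g"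
  shows "bounded_measurable M (\<lambda>x. f x * g x)"
proof -
  obtain K L where KL: "\<And>x. x \<in> space M \<Longrightarrow> \<bar>f x\<bar> \<le> K" "\<And>x. x \<in> space M \<Longrightarrow> \<bar>g x\<bar> \<le> L"
    using assms by (auto simp: bounded_measurable_def)
  have "\<bar>f x * g x\<bar> \<le> K * L" if "x \<in> space M" for x
    using KL[OF that] by (auto simp: abs_mult intro!: mult_mono intro: order_trans[OF abs_ge_zero])
  then show ?thesis using assms by (intro bounded_measurableI) (auto simp: bounded_measurable_def)
qed

lemma bounded_measurable_uminus [intro]: "bounded_measurable M f \<Longrightarrow> bounded_measurable M (\<lambda>x. - f x)"
  using bounded_measurable_mult[OF bounded_measurable_const[of M "-1"], of f] by simp

lemma bounded_measurable_diff [intro]: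
  "bounded_measurable M f \<Longrightarrow> bounded_measurable M g \<Longrightarrow> bounded_measurable M (\<lambda>x. f x - g x)"
  using bounded_measurable_add[OF _ bounded_measurable_uminus, of M f g] by simp

lemma bounded_measurable_divide [intro]: "bounded_measurable M f \<Longrightarrow> bounded_measurable M (\<lambda>x. f x / c)"
  using bounded_measurable_mult[OF bounded_measurable_const[of M "1 / c"], of f] by simp

lemma bounded_measurable_power [intro]: "bounded_measurable M f \<Longrightarrow> bounded_measurable M (\<lambda>x. f x ^ n)"
  by (induction n) auto

lemma bounded_measurable_sum [intro]:
  "(\<And>i. i \<in> I \<Longrightarrow> bounded_measurable M (f i)) \<Longrightarrow> bounded_measurable M (\<lambda>x. \<Sum>i\<in>I. f i x)"
  by (induction I rule: infinite_finite_induct) auto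

lemma bounded_measurable_poly [intro]:
  "bounded_measurable M f \<Longrightarrow> bounded_measurable M (\<lambda>x. poly p (f x))"
  by (induction p) auto

lemma (in finite_measure) bounded_measurable_integrable:
  "bounded_measurable M f \<Longrightarrow> integrable M f"
  unfolding bounded_measurable_def by (metis (mono_tags, lifting) AE_I2 integrable_const_bound real_norm_def)

text \<open>The bound on the derivative is uniform in \<open>s\<close> and \<open>x\<close>, so by
  the mean value inequality it bounds every difference quotient and can serve as dominating
  constant. The derivative is measurable as a limit of such quotients.\<close>

lemma (in finite_measure) DERIV_under_integral:
  assumes g: "\<And>s. bounded_measurable M (g s)"
    and d: "\<And>s x. x \<in> space M \<Longrightarrow> ((\<lambda>s. g s x) has_real_derivative g' s x) (at s)"
    and b: "\<And>s x. x \<in> space M \<Longrightarrow> \<bar>g' s x\<bar> \<le> K"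
  shows "((\<lambda>s. \<integral>x. g s x \<partial>M) has_real_derivative (\<integral>x. g' s x \<partial>M)) (at s)"
  unfolding DERIV_def tendsto_at_iff_sequentially comp_def
proof safe
  fix h :: "nat \<Rightarrow> real"
  assume h: "\<forall>i. h i \<in> UNIV - {0}" "h \<longlonglongrightarrow> 0"
  let ?D = "\<lambda>i x. (g (s + h i) x - g s x) / h i"
  have m: "bounded_measurable M (?D i)" for i by (intro bounded_measurable_divide bounded_measurable_diff g)
  have lim: "(\<lambda>i. ?D i x) \<longlonglongrightarrow> g' s x" if "x \<in> space M" for x
    using d[OF that, of s] h unfolding DERIV_def tendsto_at_iff_sequentially comp_def by blast
  have "(\<lambda>i. \<integral>x. ?D i x \<partial>M) \<longlonglongrightarrow> (\<integral>x. g' s x \<partial>M)"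
  proof (rule integral_dominated_convergence[where w = "\<lambda>_. K"])
    show "?D i \<in> borel_measurable M" for i by (rule bounded_measurableD[OF m])
    show "g' s \<in> borel_measurable M"
      by (rule borel_measurable_LIMSEQ_real[OF lim bounded_measurableD[OF m]])
    show "AE x in M. (\<lambda>i. ?D i x) \<longlonglongrightarrow> g' s x" using lim by auto
    show "AE x in M. norm (?D i x) \<le> K" for i
    proof (rule AE_I2)
      fix x assume x: "x \<in> space M"
      have "norm (g (s + h i) x - g s x) \<le> K * norm (s + h i - s)"
        by (rule field_differentiable_bound[of UNIV "\<lambda>s. g s x" "\<lambda>s. g' s x"])
          (use d[OF x] b[OF x] in auto)
      moreover have "\<bar>h i\<bar> > 0" using h by auto
      ultimately show "norm (?D i x) \<le> K" by (simp add: abs_divide pos_divide_le_eq)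
    qed
  qed auto
  moreover have "(\<integral>x. ?D i x \<partial>M) = ((\<integral>x. g (s + h i) x \<partial>M) - (\<integral>x. g s x \<partial>M)) / h i" for i
    using Bochner_Integration.integral_diff[OF bounded_measurable_integrable[OF g] bounded_measurable_integrable[OF g]]
    by simp
  ultimately show "(\<lambda>i. ((\<integral>x. g (s + h i) x \<partial>M) - (\<integral>x. g s x \<partial>M)) / h i) \<longlonglongrightarrow> (\<integral>x. g' s x \<partial>M)"
    by (simp only:)
qed

lemma (in finite_measure) Cauchy_Schwarz_integral:
  assumes u: "bounded_measurable M u" and v: "bounded_measurable M v"
  shows "(\<integral>x. u x * v x \<partial>M)\<^sup>2 \<le> (\<integral>x. (u x)\<^sup>2 \<partial>M) * (\<integral>x. (v x)\<^sup>2 \<partial>M)"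
proof -
  define a b c where "a = (\<integral>x. (u x)\<^sup>2 \<partial>M)" and "b = (\<integral>x. u x * v x \<partial>M)" and "c = (\<integral>x. (v x)\<^sup>2 \<partial>M)"
  have q: "0 \<le> a - 2 * s * b + s\<^sup>2 * c" for s
  proof -
    have "0 \<le> (\<integral>x. (u x - s * v x)\<^sup>2 \<partial>M)" by simp
    also have "\<dots> = (\<integral>x. (u x)\<^sup>2 - (2 * s) * (u x * v x) + s\<^sup>2 * (v x)\<^sup>2 \<partial>M)"
      by (rule Bochner_Integration.integral_cong) (auto simp: power2_eq_square algebra_simps)
    also have "\<dots> = a - 2 * s * b + s\<^sup>2 * c"
      unfolding a_def b_def c_def using u v
      by (simp add: bounded_measurable_integrable bounded_measurable_power bounded_measurable_mult)
    finally show ?thesis .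
  qed
  have "c \<ge> 0" unfolding c_def by simp
  show ?thesis
  proof (cases "c = 0")
    case True
    have "b = 0"
    proof (rule ccontr)
      assume "b \<noteq> 0"
      \<comment> \<open>At this point the linear function a - 2 s b takes the value -1.\<close>
      then show False using q[of "(a + 1) / (2 * b)"] True by simp
    qed
    then show ?thesis unfolding a_def[symmetric] b_def[symmetric] c_def[symmetric] using True by simp
  next
    case False
    then have "c > 0" using \<open>c \<ge> 0\<close> by simp
    have "(b / c)\<^sup>2 * c = (b / c) * b" using \<open>c > 0\<close> by (simp add: power2_eq_square)
    \<comment> \<open>The quadratic attains its minimum at s = b / c.\<close>
    with q[of "b / c"] have "b * b / c \<le> a" by simp
    then have "b\<^sup>2 \<le> a * c" using \<open>c > 0\<close> by (simp only: pos_divide_le_eq power2_eq_square)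
    then show ?thesis unfolding a_def[symmetric] b_def[symmetric] c_def[symmetric] .
  qed
qed

lemma real_polynomial_function_poly:
  fixes f :: "real \<Rightarrow> real"
  assumes "real_polynomial_function f"
  shows "\<exists>p. f = poly p"
  using assms
proof induction
  case (linear h)
  have "h x = poly [:0, h 1:] x" for x
    using linear_scale[OF bounded_linear.linear[OF linear], of x 1] by simp
  then show ?case by blast
next
  case (const c)
  then show ?case by (intro exI[of _ "[:c:]"]) auto
next
  case (add f g)
  then obtain p q where "f = poly p" "g = poly q" by blast
  then show ?case by (intro exI[of _ "p + q"]) auto
next
  case (mult f g)
  then obtain p q where "f = poly p" "g = poly q" by blast
  then show ?case by (intro exI[of _ "p * q"]) auto
qed

text \<open>The indicator of an open half-line is the pointwise limit of continuous ramps that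
  vanish at c, and Weierstrass approximates the n-th ramp within 1 / (n + 1). The bound 2 is the
  bound 1 of the ramps plus the largest of these errors.\<close>

lemma greaterThan_indicator_poly_approx:
  fixes c :: real
  obtains p :: "nat \<Rightarrow> real poly"
  where "\<And>n z. z \<in> {-1..1} \<Longrightarrow> \<bar>poly (p n) z\<bar> \<le> 2"
    "\<And>z. z \<in> {-1..1} \<Longrightarrow> (\<lambda>n. poly (p n) z) \<longlonglongrightarrow> indicator {c<..} z"
proof -
  define f where "f n z = min 1 (max 0 (real n * (z - c)))" for n and z :: real
  have "\<exists>p. \<forall>z\<in>{-1..1}. \<bar>f n z - poly p z\<bar> < 1 / real (Suc n)" for n
  proof -
    have "continuous_on {-1..1} (f n)" unfolding f_def by (intro continuous_intros)
    then obtain g where "real_polynomial_function g" "\<And>x. x \<in> {-1..1} \<Longrightarrow> \<bar>f n x - g x\<bar> < 1 / real (Suc n)"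
      using Stone_Weierstrass_real_polynomial_function[of "{-1..1}" "f n" "1 / real (Suc n)"]
      by (metis compact_Icc of_nat_0_less_iff zero_less_Suc zero_less_divide_1_iff)
    then show ?thesis using real_polynomial_function_poly by blast
  qed
  then obtain p where p: "\<And>n z. z \<in> {-1..1} \<Longrightarrow> \<bar>f n z - poly (p n) z\<bar> < 1 / real (Suc n)" by metis
  show ?thesis
  proof (rule that[of p])
    fix z :: real assume z: "z \<in> {-1..1}"
    show "\<bar>poly (p n) z\<bar> \<le> 2" for n
    proof -
      have "1 / real (Suc n) \<le> 1" by simp
      moreover have "\<bar>f n z\<bar> \<le> 1" by (auto simp: f_def)
      ultimately show ?thesis using p[OF z, of n] by linarith
    qed
    have "(\<lambda>n. f n z - poly (p n) z) \<longlonglongrightarrow> 0"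
      by (rule Lim_null_comparison[OF _ LIMSEQ_inverse_real_of_nat])
        (use p[OF z] in \<open>auto intro!: always_eventually less_imp_le simp: inverse_eq_divide\<close>)
    moreover have "(\<lambda>n. f n z) \<longlonglongrightarrow> indicator {c<..} z"
    proof (cases "z > c")
      case False
      then have "f n z = 0" for n by (auto simp: f_def mult_nonneg_nonpos max_absorb1)
      then show ?thesis using False by simp
    next
      case True
      obtain N :: nat where N: "1 / (z - c) < real N" using reals_Archimedean2 by blast
      have "f n z = 1" if "n \<ge> N" for n
      proof -
        have "1 / (z - c) \<le> real n" using N that by linarith
        then have "1 \<le> real n * (z - c)" using True by (simp add: field_simps)
        then show ?thesis by (simp add: f_def)
      qed
      then have "eventually (\<lambda>n. f n z = indicator {c<..} z) sequentially"
        using True by (auto simp: eventually_sequentially)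
      then show ?thesis by (rule tendsto_eventually)
    qed
    ultimately show "(\<lambda>n. poly (p n) z) \<longlonglongrightarrow> indicator {c<..} z"
      using tendsto_diff by fastforce
  qed
qed

text \<open>Equality of the integrals of polynomials passes to half-lines by dominated convergence,
  and the half-lines determine a finite measure on the reals. The two functions may live on
  different spaces: here Q and an interval.\<close>

lemma moment_unique:
  fixes f :: "'a \<Rightarrow> real" and g :: "'b \<Rightarrow> real"
  assumes M: "finite_measure M" "f \<in> borel_measurable M" "\<And>x. x \<in> space M \<Longrightarrow> f x \<in> {-1..1}"
    and N: "finite_measure N" "g \<in> borel_measurable N" "\<And>x. x \<in> space N \<Longrightarrow> g x \<in> {-1..1}"
    and e: "\<And>p. (\<integral>x. poly p (f x) \<partial>M) = (\<integral>x. poly p (g x) \<partial>N)"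
  shows "distr M borel f = distr N borel g"
proof (rule measure_eqI_lessThan)
  interpret M: finite_measure M by fact
  interpret N: finite_measure N by fact
  show "emeasure (distr M borel f) {x<..} < \<infinity>" for x
    using M(2) by (subst emeasure_distr) (auto simp: less_top[symmetric])
  show "emeasure (distr M borel f) {c<..} = emeasure (distr N borel g) {c<..}" for c
  proof -
    obtain p where p: "\<And>n z. z \<in> {-1..1} \<Longrightarrow> \<bar>poly (p n) z\<bar> \<le> 2"
      "\<And>z. z \<in> {-1..1} \<Longrightarrow> (\<lambda>n. poly (p n) z) \<longlonglongrightarrow> indicator {c<..} z"
      using greaterThan_indicator_poly_approx by blast
    have 1: "(\<lambda>n. \<integral>x. poly (p n) (f x) \<partial>M) \<longlonglongrightarrow> (\<integral>x. indicator {c<..} (f x) \<partial>M)"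
    proof (rule integral_dominated_convergence[where w = "\<lambda>_. 2"])
      show "(\<lambda>x. poly (p n) (f x)) \<in> borel_measurable M" for n
        using M(2) by (rule borel_measurable_continuous_on[rotated]) (intro continuous_intros)
    qed (use M p in \<open>auto intro!: AE_I2\<close>)
    have 2: "(\<lambda>n. \<integral>x. poly (p n) (g x) \<partial>N) \<longlonglongrightarrow> (\<integral>x. indicator {c<..} (g x) \<partial>N)"
    proof (rule integral_dominated_convergence[where w = "\<lambda>_. 2"])
      show "(\<lambda>x. poly (p n) (g x)) \<in> borel_measurable N" for n
        using N(2) by (rule borel_measurable_continuous_on[rotated]) (intro continuous_intros)
    qed (use N p in \<open>auto intro!: AE_I2\<close>)
    have i1: "(\<integral>x. indicator {c<..} (f x) \<partial>M) = measure (distr M borel f) {c<..}"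
      using M(2) by (subst measure_distr) (auto simp: indicator_vimage[symmetric] Int_commute)
    have i2: "(\<integral>x. indicator {c<..} (g x) \<partial>N) = measure (distr N borel g) {c<..}"
      using N(2) by (subst measure_distr) (auto simp: indicator_vimage[symmetric] Int_commute)
    have "measure (distr M borel f) {c<..} = measure (distr N borel g) {c<..}"
      using LIMSEQ_unique[OF 1 2[folded e]] unfolding i1 i2 .
    then show ?thesis
      using finite_measure.emeasure_eq_measure[OF M.finite_measure_distr[OF M(2)]]
        finite_measure.emeasure_eq_measure[OF N.finite_measure_distr[OF N(2)]] by simp
  qed
qed auto

section \<open>Invariant measures and convolution of zonal polynomials\<close>

text \<open>Because the degree bound is uniform, integrating the coefficients over \<open>M\<close>
  again gives a polynomial; this is how a convolution becomes one.\<close>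

definition measurable_polys :: "'a measure \<Rightarrow> ('a \<Rightarrow> real poly) \<Rightarrow> bool" where
  "measurable_polys M f \<longleftrightarrow>
     (\<forall>k. bounded_measurable M (\<lambda>x. coeff (f x) k)) \<and> (\<exists>n. \<forall>x. degree (f x) \<le> n)"

lemma measurable_polys_pCons:
  assumes "bounded_measurable M a" "measurable_polys M f"
  shows "measurable_polys M (\<lambda>x. pCons (a x) (f x))"
  unfolding measurable_polys_def
proof (intro conjI allI)
  fix k show "bounded_measurable M (\<lambda>x. coeff (pCons (a x) (f x)) k)"
    using assms by (cases k) (auto simp: measurable_polys_def)
  obtain n where "\<forall>x. degree (f x) \<le> n" using assms(2) by (auto simp: measurable_polys_def)
  then show "\<exists>n. \<forall>x. degree (pCons (a x) (f x)) \<le> n"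
    by (intro exI[of _ "Suc n"]) (auto simp: degree_pCons_eq_if)
qed

lemma measurable_polys_0 [simp]: "measurable_polys M (\<lambda>x. 0)"
  by (auto simp: measurable_polys_def)

lemma measurable_polys_add:
  assumes "measurable_polys M f" "measurable_polys M g"
  shows "measurable_polys M (\<lambda>x. f x + g x)"
  unfolding measurable_polys_def
proof (intro conjI allI)
  fix k show "bounded_measurable M (\<lambda>x. coeff (f x + g x) k)"
    using assms by (auto simp: measurable_polys_def)
  obtain m n where "\<forall>x. degree (f x) \<le> m" "\<forall>x. degree (g x) \<le> n"
    using assms by (auto simp: measurable_polys_def)
  then show "\<exists>n. \<forall>x. degree (f x + g x) \<le> n"
    by (intro exI[of _ "max m n"]) (meson degree_add_le max.cobounded1 max.cobounded2 order_trans)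
qed

lemma measurable_polys_mult:
  assumes "measurable_polys M f" "measurable_polys M g"
  shows "measurable_polys M (\<lambda>x. f x * g x)"
  unfolding measurable_polys_def
proof (intro conjI allI)
  fix k show "bounded_measurable M (\<lambda>x. coeff (f x * g x) k)"
    unfolding coeff_mult using assms
    by (intro bounded_measurable_sum bounded_measurable_mult) (auto simp: measurable_polys_def)
  obtain m n where "\<forall>x. degree (f x) \<le> m" "\<forall>x. degree (g x) \<le> n"
    using assms by (auto simp: measurable_polys_def)
  then show "\<exists>n. \<forall>x. degree (f x * g x) \<le> n"
    by (intro exI[of _ "m + n"]) (meson degree_mult_le add_mono order_trans)
qed

text \<open>Powers of the sine are reduced by sin^2 = 1 - cos^2. The splitting separates the part
  even in \<open>s\<close> from the odd part; for convolutions only the even part will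
  survive.\<close>

lemma poly_trig_split:
  assumes "bounded_measurable M a" "bounded_measurable M b" "bounded_measurable M c"
  shows "\<exists>f g. measurable_polys M f \<and> measurable_polys M g \<and>
    (\<forall>s x. poly q (a x + b x * cos s + c x * sin s) = poly (f x) (cos s) + sin s * poly (g x) (cos s))"
proof (induction q)
  case 0
  show ?case by (intro exI[of _ "\<lambda>x. 0"]) simp
next
  case (pCons e q)
  then obtain f g where fg: "measurable_polys M f" "measurable_polys M g"
    "\<And>s x. poly q (a x + b x * cos s + c x * sin s) = poly (f x) (cos s) + sin s * poly (g x) (cos s)"
    by blast
  \<comment> \<open>Multiplication by a + b cos s + c sin s and addition of e send (f, g) to the
    pair made of this family and the next one. The factor \<open>[:c x, 0, - c x:]\<close> is c (1 -
    X^2), which comes from the square of the sine.\<close>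
  have "measurable_polys M (\<lambda>x. [:e:] + ([:a x, b x:] * f x + [:c x, 0, - c x:] * g x))"
    by (intro measurable_polys_add measurable_polys_mult measurable_polys_pCons fg assms bounded_measurable_uminus) auto
  moreover have "measurable_polys M (\<lambda>x. [:c x:] * f x + [:a x, b x:] * g x)"
    by (intro measurable_polys_add measurable_polys_mult measurable_polys_pCons fg assms) auto
  moreover have "poly (pCons e q) (a x + b x * cos s + c x * sin s) =
    poly ([:e:] + ([:a x, b x:] * f x + [:c x, 0, - c x:] * g x)) (cos s) +
    sin s * poly ([:c x:] * f x + [:a x, b x:] * g x) (cos s)" for s x
  proof -
    have s: "sin s * sin s = 1 - cos s * cos s"
      using sin_squared_eq[of s] by (simp add: power2_eq_square)
    have "poly (pCons e q) (a x + b x * cos s + c x * sin s) =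
      e + (a x + b x * cos s) * poly (f x) (cos s) + c x * (sin s * sin s) * poly (g x) (cos s) +
      sin s * (c x * poly (f x) (cos s) + (a x + b x * cos s) * poly (g x) (cos s))"
      by (simp only: poly_pCons fg(3)) (simp add: algebra_simps)
    then show ?thesis unfolding s by (simp add: algebra_simps)
  qed
  ultimately show ?case by blast
qed

lemma DERIV_poly_trig:
  "((\<lambda>s. poly p (a + b * cos s + c * sin s)) has_real_derivative
     poly (pderiv p) (a + b * cos s + c * sin s) * (c * cos s - b * sin s)) (at s)"
  by (rule DERIV_cong[OF DERIV_chain2[OF poly_DERIV]]) (auto intro!: derivative_eq_intros)

text \<open>At \<open>s = 0\<close> this is p'' c^2 - p' b, which is why the frames below control
  the sum of the \<open>B u y\<close> and the sum of the squares of the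
  \<open>C u y\<close>.\<close>

lemma DERIV2_poly_trig:
  "((\<lambda>s. poly (pderiv p) (a + b * cos s + c * sin s) * (c * cos s - b * sin s)) has_real_derivative
     poly (pderiv (pderiv p)) (a + b * cos s + c * sin s) * (c * cos s - b * sin s)\<^sup>2
     - poly (pderiv p) (a + b * cos s + c * sin s) * (b * cos s + c * sin s)) (at s)"
  by (rule DERIV_cong[OF DERIV_mult[OF DERIV_poly_trig]])
    (auto intro!: derivative_eq_intros simp: power2_eq_square algebra_simps)

lemma poly_bounded_Icc:
  fixes p :: "real poly"
  obtains K where "K \<ge> 0" "\<And>z. z \<in> {-1..1} \<Longrightarrow> \<bar>poly p z\<bar> \<le> K"
proof -
  have "compact (poly p ` {-1..1})"
    by (intro compact_continuous_image continuous_intros) auto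
  then have "bounded (poly p ` {-1..1})" by (rule compact_imp_bounded)
  then obtain K where K: "\<And>z. z \<in> {-1..1} \<Longrightarrow> \<bar>poly p z\<bar> \<le> K" unfolding bounded_iff by (metis imageI real_norm_def)
  have "K \<ge> 0" using K[of 0] by (simp add: order_trans[OF abs_ge_zero])
  then show ?thesis using that[of K] K by blast
qed

text \<open>What the five families have in common. The constants in \<open>sum_B\<close> are (d -
  d0) / 2 = \<alpha> - \<beta> and (d + d0) / 2 = \<alpha> + \<beta> + 2, the first order
  coefficients of the Jacobi operator; \<open>sum_C\<close> supplies the second order one.
  \<open>move\<close> brings the second point onto the single curve \<open>\<gamma> 0\<close>, so an
  invariant function of two points becomes a function of one parameter.\<close>

locale two_point_frame =
  fixes Q :: "'a set" and \<theta> :: "'a \<Rightarrow> 'a \<Rightarrow> real" and d d0 :: nat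
    and \<gamma> :: "nat \<Rightarrow> real \<Rightarrow> 'a" and A B C :: "nat \<Rightarrow> 'a \<Rightarrow> real"
  assumes dims: "d \<ge> 1" "d0 \<ge> 1"
    and dist_range: "x \<in> Q \<Longrightarrow> y \<in> Q \<Longrightarrow> \<theta> x y \<in> {0..pi}"
    and dist_sym: "x \<in> Q \<Longrightarrow> y \<in> Q \<Longrightarrow> \<theta> x y = \<theta> y x"
    and geodesic_in: "u < d \<Longrightarrow> \<gamma> u s \<in> Q"
    and geodesic_0: "u < d \<Longrightarrow> \<gamma> u 0 = \<gamma> 0 0"
    and geodesic_cos: "u < d \<Longrightarrow> y \<in> Q \<Longrightarrow> cos (\<theta> (\<gamma> u s) y) = A u y + B u y * cos s + C u y * sin s"
    and geodesic_unit: "cos (\<theta> (\<gamma> 0 0) (\<gamma> 0 s)) = cos s"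
    and sum_B: "y \<in> Q \<Longrightarrow>
      (\<Sum>u<d. B u y) = (real d - real d0) / 2 + (real d + real d0) / 2 * cos (\<theta> (\<gamma> 0 0) y)"
    and sum_C: "y \<in> Q \<Longrightarrow> (\<Sum>u<d. (C u y)\<^sup>2) = 1 - (cos (\<theta> (\<gamma> 0 0) y))\<^sup>2"
    and move: "x \<in> Q \<Longrightarrow> y \<in> Q \<Longrightarrow>
      \<exists>g. isometry_betw g Q \<theta> Q \<theta> \<and> g x = \<gamma> 0 0 \<and> g y = \<gamma> 0 (\<theta> x y)"
begin

abbreviation "t x y \<equiv> cos (\<theta> x y)"
abbreviation "p0 \<equiv> \<gamma> 0 0"

lemma p0_in: "p0 \<in> Q" using geodesic_in[of 0] dims by auto

text \<open>The values of t at the parameters 0, pi/2 and pi determine all three functions: A is a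
  mean and B half a difference of numbers in [-1, 1], and C is such a number minus A.\<close>

lemma abc_bounds:
  assumes "u < d" "y \<in> Q"
  shows "\<bar>A u y\<bar> \<le> 1" "\<bar>B u y\<bar> \<le> 1" "\<bar>C u y\<bar> \<le> 2"
proof -
  note c = geodesic_cos[OF assms]
  have e: "A u y + B u y = t (\<gamma> u 0) y" "A u y - B u y = t (\<gamma> u pi) y" "A u y + C u y = t (\<gamma> u (pi/2)) y"
    using c[of 0] c[of pi] c[of "pi/2"] by auto
  have b: "-1 \<le> t x y" "t x y \<le> 1" for x by simp_all
  show "\<bar>A u y\<bar> \<le> 1" "\<bar>B u y\<bar> \<le> 1" "\<bar>C u y\<bar> \<le> 2"
    using e b[of "\<gamma> u 0"] b[of "\<gamma> u pi"] b[of "\<gamma> u (pi/2)"] by (simp_all only: abs_le_iff) linarith+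
qed

text \<open>Takes the place of a triangle inequality, which the locale does not contain, and makes
  the superlevel sets of t open. After moving, the difference is B (1 - cos s) - C sin s; the
  constant 3 is the bound 1 for B plus the bound 2 for C.\<close>

lemma t_Lipschitz:
  assumes "x \<in> Q" "x' \<in> Q" "y \<in> Q"
  shows "\<bar>t x y - t x' y\<bar> \<le> 3 * \<theta> x x'"
proof -
  define s where "s = \<theta> x x'"
  have s: "s \<ge> 0" using dist_range[OF assms(1,2)] by (simp add: s_def)
  obtain g where g: "isometry_betw g Q \<theta> Q \<theta>" "g x = p0" "g x' = \<gamma> 0 s"
    using move[OF assms(1,2)] by (auto simp: s_def)
  then have gy: "g y \<in> Q" "\<theta> x y = \<theta> p0 (g y)" "\<theta> x' y = \<theta> (\<gamma> 0 s) (g y)"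
    using assms by (auto simp: isometry_betw_def bij_betw_def)
  have d: "0 < d" using dims by simp
  note c = geodesic_cos[OF d gy(1)]
  have "t x y - t x' y = B 0 (g y) * (1 - cos s) - C 0 (g y) * sin s"
    using c[of 0] c[of s] by (simp add: gy algebra_simps)
  then have "\<bar>t x y - t x' y\<bar> \<le> \<bar>B 0 (g y)\<bar> * \<bar>1 - cos s\<bar> + \<bar>C 0 (g y)\<bar> * \<bar>sin s\<bar>"
    using abs_triangle_ineq4[of "B 0 (g y) * (1 - cos s)" "C 0 (g y) * sin s"] by (simp add: abs_mult)
  also have "\<dots> \<le> 1 * \<bar>1 - cos s\<bar> + 2 * \<bar>sin s\<bar>"
    using abc_bounds[OF d gy(1)] by (intro add_mono mult_right_mono) auto
  also have "\<bar>sin s\<bar> \<le> s" using abs_sin_x_le_abs_x[of s] s by simp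
  also have "\<bar>1 - cos s\<bar> \<le> s"
  proof -
    have "1 - cos s = 2 * (sin (s / 2))\<^sup>2" using cos_double_sin[of "s / 2"] by simp
    also have "\<dots> = 2 * \<bar>sin (s / 2)\<bar> * \<bar>sin (s / 2)\<bar>" by (simp add: power2_eq_square)
    also have "\<dots> \<le> 2 * (s / 2) * 1"
      using abs_sin_x_le_abs_x[of "s / 2"] s by (intro mult_mono) auto
    finally show ?thesis by simp
  qed
  finally show ?thesis by (simp add: s_def)
qed

end

locale two_point_measure = two_point_frame +
  fixes \<mu> :: "'a measure"
  assumes invariant: "invariant_measure Q \<theta> \<mu>"
begin

lemma space_mu: "space \<mu> = Q"
  and sets_mu: "sets \<mu> = sigma_sets Q {U. U \<subseteq> Q \<and> (\<forall>x\<in>U. \<exists>r>0. metric_ball Q \<theta> x r \<subseteq> U)}"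
  using invariant by (auto simp: invariant_measure_def)

sublocale finite_measure \<mu>
  using invariant by (intro finite_measureI) (auto simp: invariant_measure_def)

lemma measure_Q: "measure \<mu> (space \<mu>) = 1"
  using invariant by (simp add: invariant_measure_def measure_def)

lemma open_in_sets:
  assumes "U \<subseteq> Q" "\<And>x. x \<in> U \<Longrightarrow> \<exists>r>0. metric_ball Q \<theta> x r \<subseteq> U"
  shows "U \<in> sets \<mu>"
  unfolding sets_mu using assms by (intro sigma_sets.Basic) auto

lemma measurable_isometry:
  assumes g: "isometry_betw g Q \<theta> Q \<theta>"
  shows "g \<in> measurable \<mu> \<mu>"
proof (rule measurable_sigma_sets[OF sets_mu])
  have gQ: "g x \<in> Q" if "x \<in> Q" for x using g that by (auto simp: isometry_betw_def bij_betw_def)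
  then show "g \<in> space \<mu> \<rightarrow> Q" by (auto simp: space_mu)
  fix U assume "U \<in> {U. U \<subseteq> Q \<and> (\<forall>x\<in>U. \<exists>r>0. metric_ball Q \<theta> x r \<subseteq> U)}"
  then have U: "U \<subseteq> Q" "\<And>x. x \<in> U \<Longrightarrow> \<exists>r>0. metric_ball Q \<theta> x r \<subseteq> U" by auto
  show "g -` U \<inter> space \<mu> \<in> sets \<mu>"
  proof (rule open_in_sets)
    fix x assume "x \<in> g -` U \<inter> space \<mu>"
    then have x: "g x \<in> U" "x \<in> Q" by (auto simp: space_mu)
    then obtain r where r: "r > 0" "metric_ball Q \<theta> (g x) r \<subseteq> U" using U(2) by blast
    have "g y \<in> U" if "y \<in> metric_ball Q \<theta> x r" for y
    proof -
      have "g y \<in> metric_ball Q \<theta> (g x) r"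
        using that g gQ x by (auto simp: metric_ball_def isometry_betw_def)
      then show ?thesis using r by blast
    qed
    then have "metric_ball Q \<theta> x r \<subseteq> g -` U \<inter> space \<mu>"
      by (auto simp: metric_ball_def space_mu)
    then show "\<exists>r>0. metric_ball Q \<theta> x r \<subseteq> g -` U \<inter> space \<mu>" using r by blast
  qed (auto simp: space_mu)
qed auto

text \<open>Invariance is assumed for images. As \<open>g\<close> maps Q onto Q, every measurable
  set is the image of its preimage, which gives the form with preimages that a change of variables
  requires.\<close>

lemma distr_isometry:
  assumes g: "isometry_betw g Q \<theta> Q \<theta>"
  shows "distr \<mu> \<mu> g = \<mu>"
proof (rule measure_eqI)
  fix S assume "S \<in> sets (distr \<mu> \<mu> g)"
  then have S: "S \<in> sets \<mu>" by simp
  have T: "g -` S \<inter> space \<mu> \<in> sets \<mu>" using measurable_isometry[OF g] S by (rule measurable_sets)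
  have "g ` (g -` S \<inter> space \<mu>) = S"
  proof (intro equalityI subsetI)
    fix x assume x: "x \<in> S"
    moreover have "S \<subseteq> g ` Q"
      using g sets.sets_into_space[OF S] by (simp add: isometry_betw_def bij_betw_def space_mu)
    ultimately show "x \<in> g ` (g -` S \<inter> space \<mu>)" by (auto simp: space_mu)
  qed auto
  moreover have "\<forall>S\<in>sets \<mu>. emeasure \<mu> (g ` S) = emeasure \<mu> S"
    using invariant g unfolding invariant_measure_def by blast
  ultimately have "emeasure \<mu> S = emeasure \<mu> (g -` S \<inter> space \<mu>)"
    using T by metis
  then show "emeasure (distr \<mu> \<mu> g) S = emeasure \<mu> S"
    using emeasure_distr[OF measurable_isometry[OF g] S] by simp
qed simp

lemma measurable_t:
  assumes "y \<in> Q"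
  shows "(\<lambda>x. t x y) \<in> borel_measurable \<mu>" "(\<lambda>x. t y x) \<in> borel_measurable \<mu>"
proof -
  show 1: "(\<lambda>x. t x y) \<in> borel_measurable \<mu>"
  proof (rule borel_measurableI_greater, unfold space_mu, rule open_in_sets)
    fix c x assume "x \<in> {x \<in> Q. c < t x y}"
    then have x: "x \<in> Q" "c < t x y" by auto
    \<comment> \<open>The radius (t x y - c) / 3 comes from the Lipschitz constant 3.\<close>
    have "c < t x' y" if "x' \<in> Q" "\<theta> x' x < (t x y - c) / 3" for x'
      using t_Lipschitz[OF x(1) that(1) assms] that dist_sym[OF x(1) that(1)] by (auto simp: abs_le_iff)
    then show "\<exists>r>0. metric_ball Q \<theta> x r \<subseteq> {x \<in> Q. c < t x y}"
      using x by (intro exI[of _ "(t x y - c) / 3"]) (auto simp: metric_ball_def)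
  qed auto
  show "(\<lambda>x. t y x) \<in> borel_measurable \<mu>"
    by (rule iffD1[OF measurable_cong 1]) (use assms dist_sym in \<open>auto simp: space_mu\<close>)
qed

lemma bounded_measurable_t:
  assumes "y \<in> Q"
  shows "bounded_measurable \<mu> (\<lambda>x. t x y)" "bounded_measurable \<mu> (\<lambda>x. t y x)"
  using measurable_t[OF assms] by (auto intro!: bounded_measurableI[where K = 1])

text \<open>Homogeneity in the form in which it is used: the integral depends on \<open>x\<close>
  and \<open>b\<close> only through their distance.\<close>

lemma integral_move:
  fixes F :: "real \<Rightarrow> real \<Rightarrow> real"
  assumes "x \<in> Q" "b \<in> Q"
    and F: "\<And>x b. x \<in> Q \<Longrightarrow> b \<in> Q \<Longrightarrow> (\<lambda>y. F (t x y) (t y b)) \<in> borel_measurable \<mu>"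
  shows "(\<integral>y. F (t x y) (t y b) \<partial>\<mu>) = (\<integral>y. F (t p0 y) (t y (\<gamma> 0 (\<theta> x b))) \<partial>\<mu>)"
proof -
  obtain g where g: "isometry_betw g Q \<theta> Q \<theta>" "g x = p0" "g b = \<gamma> 0 (\<theta> x b)"
    using move[OF assms(1,2)] by auto
  let ?f = "\<lambda>y. F (t p0 y) (t y (\<gamma> 0 (\<theta> x b)))"
  have m: "?f \<in> borel_measurable \<mu>" using F p0_in geodesic_in dims by auto
  have "(\<integral>y. ?f y \<partial>\<mu>) = (\<integral>y. ?f y \<partial>distr \<mu> \<mu> g)" by (simp only: distr_isometry[OF g(1)])
  also have "\<dots> = (\<integral>y. ?f (g y) \<partial>\<mu>)" by (rule integral_distr[OF measurable_isometry[OF g(1)] m])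
  also have "\<dots> = (\<integral>y. F (t x y) (t y b) \<partial>\<mu>)"
    using g assms(1,2) unfolding g(2,3)[symmetric]
    by (intro Bochner_Integration.integral_cong) (auto simp: space_mu isometry_betw_def)
  finally show ?thesis by simp
qed

lemma integral_base_point:
  fixes F :: "real \<Rightarrow> real"
  assumes "x \<in> Q" "F \<in> borel_measurable borel"
  shows "(\<integral>y. F (t x y) \<partial>\<mu>) = (\<integral>y. F (t p0 y) \<partial>\<mu>)"
  using integral_move[of x x "\<lambda>a b. F a"] assms measurable_t by auto

lemma integral_sym:
  fixes F :: "real \<Rightarrow> real"
  assumes "x \<in> Q"
  shows "(\<integral>y. F (t y x) \<partial>\<mu>) = (\<integral>y. F (t x y) \<partial>\<mu>)"
  using assms dist_sym by (intro Bochner_Integration.integral_cong) (auto simp: space_mu)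

text \<open>As a function of the parameter on \<open>\<gamma> 0\<close> the convolution is even.
  Averaging over \<open>s\<close> and \<open>- s\<close> removes the sine part of
  \<open>poly_trig_split\<close> and leaves a polynomial in cos s, whose coefficients are integrals
  over Q.\<close>

lemma convolution_poly:
  fixes p q :: "real poly"
  obtains h :: "real poly" where
    "\<And>x b. x \<in> Q \<Longrightarrow> b \<in> Q \<Longrightarrow> (\<integral>y. poly p (t x y) * poly q (t y b) \<partial>\<mu>) = poly h (t x b)"
proof -
  have d: "0 < d" using dims by simp
  define G where "G s = (\<integral>y. poly p (t p0 y) * poly q (t y (\<gamma> 0 s)) \<partial>\<mu>)" for s
  have mv: "(\<integral>y. poly p (t x y) * poly q (t y b) \<partial>\<mu>) = G (\<theta> x b)" if "x \<in> Q" "b \<in> Q" for x b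
    unfolding G_def using that
    by (intro integral_move) (auto intro!: bounded_measurableD bounded_measurable_mult bounded_measurable_poly bounded_measurable_t)
  \<comment> \<open>The distance from \<open>p0\<close> to \<open>\<gamma> 0 s\<close> is arccos
    (cos s) for every real s, hence the same for s and -s.\<close>
  have ev: "G s = G (- s)" for s
  proof -
    have th: "\<theta> p0 (\<gamma> 0 s) = arccos (cos s)" for s
      using geodesic_unit[of s] dist_range[OF p0_in geodesic_in[OF d], of s] arccos_cos
      by (metis atLeastAtMost_iff)
    have "G s = G (arccos (cos s))" for s
      using mv[OF p0_in geodesic_in[OF d, of s]] unfolding th by (simp add: G_def)
    from this[of s] this[of "- s"] show ?thesis by simp
  qed
  have AB: "bounded_measurable \<mu> (A 0)" "bounded_measurable \<mu> (B 0)" "bounded_measurable \<mu> (C 0)"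
  proof -
    have c: "A 0 y = (t (\<gamma> 0 0) y + t (\<gamma> 0 pi) y) / 2" "B 0 y = (t (\<gamma> 0 0) y - t (\<gamma> 0 pi) y) / 2"
      "C 0 y = t (\<gamma> 0 (pi/2)) y - (t (\<gamma> 0 0) y + t (\<gamma> 0 pi) y) / 2" if "y \<in> space \<mu>" for y
      using geodesic_cos[OF d, of y 0] geodesic_cos[OF d, of y pi] geodesic_cos[OF d, of y "pi/2"] that
      by (auto simp: space_mu)
    have m: "(\<lambda>y. t (\<gamma> 0 s) y) \<in> borel_measurable \<mu>" for s by (rule measurable_t[OF geodesic_in[OF d]])
    have "A 0 \<in> borel_measurable \<mu>"
      by (subst measurable_cong[OF c(1)]) (use m in auto)
    moreover have "B 0 \<in> borel_measurable \<mu>"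
      by (subst measurable_cong[OF c(2)]) (use m in auto)
    moreover have "C 0 \<in> borel_measurable \<mu>"
      by (subst measurable_cong[OF c(3)]) (use m in auto)
    ultimately show "bounded_measurable \<mu> (A 0)" "bounded_measurable \<mu> (B 0)" "bounded_measurable \<mu> (C 0)"
      using abc_bounds[OF d] by (auto intro!: bounded_measurableI simp: space_mu)
  qed
  obtain f g where fg: "measurable_polys \<mu> f" "measurable_polys \<mu> g"
    "\<And>s x. poly q (A 0 x + B 0 x * cos s + C 0 x * sin s) = poly (f x) (cos s) + sin s * poly (g x) (cos s)"
    using poly_trig_split[OF AB, of q] by blast
  obtain n where n: "\<And>x. degree (f x) \<le> n" using fg(1) by (auto simp: measurable_polys_def)
  have bf: "bounded_measurable \<mu> (\<lambda>y. coeff (f y) k)" for k using fg(1) by (auto simp: measurable_polys_def)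
  have bp: "bounded_measurable \<mu> (\<lambda>y. poly p (t p0 y))"
    by (intro bounded_measurable_poly bounded_measurable_t p0_in)
  define h where "h = (\<Sum>k\<le>n. monom (\<integral>y. poly p (t p0 y) * coeff (f y) k \<partial>\<mu>) k)"
  have "G s = poly h (cos s)" for s
  proof -
    have q: "poly q (t y (\<gamma> 0 s)) + poly q (t y (\<gamma> 0 (- s))) = 2 * poly (f y) (cos s)" if "y \<in> space \<mu>" for y
    proof -
      have y: "y \<in> Q" using that by (simp add: space_mu)
      have "poly q (t y (\<gamma> 0 s)) = poly (f y) (cos s) + sin s * poly (g y) (cos s)" for s
        using fg(3)[of y s] geodesic_cos[OF d y, of s] dist_sym[OF y geodesic_in[OF d]] by simp
      from this[of s] this[of "- s"] show ?thesis by simp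
    qed
    have bq: "bounded_measurable \<mu> (\<lambda>y. poly p (t p0 y) * poly q (t y (\<gamma> 0 s)))" for s
      by (intro bounded_measurable_mult bounded_measurable_poly bounded_measurable_t p0_in geodesic_in d)
    have "G s = (G s + G (- s)) / 2" using ev[of s] by simp
    also have "\<dots> = (\<integral>y. poly p (t p0 y) * poly q (t y (\<gamma> 0 s)) + poly p (t p0 y) * poly q (t y (\<gamma> 0 (- s))) \<partial>\<mu>) / 2"
      unfolding G_def by (subst Bochner_Integration.integral_add) (auto intro!: bounded_measurable_integrable bq)
    also have "\<dots> = (\<integral>y. 2 * (poly p (t p0 y) * poly (f y) (cos s)) \<partial>\<mu>) / 2"
      using q by (intro arg_cong[where f = "\<lambda>x. x / 2"] Bochner_Integration.integral_cong)
        (auto simp: distrib_left[symmetric])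
    also have "\<dots> = (\<integral>y. (\<Sum>k\<le>n. cos s ^ k * (poly p (t p0 y) * coeff (f y) k)) \<partial>\<mu>)"
    proof -
      have "poly p (t p0 y) * poly (f y) (cos s) = (\<Sum>k\<le>n. cos s ^ k * (poly p (t p0 y) * coeff (f y) k))" for y
      proof -
        have "poly (f y) (cos s) = (\<Sum>k\<le>n. coeff (f y) k * cos s ^ k)"
          unfolding poly_altdef using n[of y] by (intro sum.mono_neutral_left) (auto simp: coeff_eq_0)
        then show ?thesis by (simp add: sum_distrib_left mult_ac)
      qed
      then show ?thesis by simp
    qed
    also have "\<dots> = (\<Sum>k\<le>n. cos s ^ k * (\<integral>y. poly p (t p0 y) * coeff (f y) k \<partial>\<mu>))"
      by (subst Bochner_Integration.integral_sum)
        (auto intro!: bounded_measurable_integrable bounded_measurable_mult bf bp)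
    also have "\<dots> = poly h (cos s)"
      by (simp add: h_def poly_sum poly_monom mult.commute)
    finally show ?thesis .
  qed
  then show ?thesis using that mv by simp
qed

abbreviation "\<alpha> \<equiv> real d / 2 - 1"
abbreviation "\<beta> \<equiv> real d0 / 2 - 1"
abbreviation "P l \<equiv> jacobi_poly \<alpha> \<beta> l"

lemma param_bounds: "\<alpha> > -1" "\<alpha> + \<beta> + 1 \<ge> 0"
  using dims by auto

lemma bounded_measurable_kernel [intro]:
  assumes "x \<in> Q" "b \<in> Q"
  shows "bounded_measurable \<mu> (\<lambda>y. poly f (t x y) * poly q (t y b))"
  by (intro bounded_measurable_mult bounded_measurable_poly bounded_measurable_t assms)

lemma sum_second_derivative:
  assumes "y \<in> Q"
  shows "(\<Sum>u<d. poly (pderiv (pderiv f)) (t p0 y) * (C u y)\<^sup>2 - poly (pderiv f) (t p0 y) * B u y)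
    = poly (jacobi_op \<alpha> \<beta> f) (t p0 y)"
  unfolding sum_subtractf sum_distrib_left[symmetric] sum_B[OF assms] sum_C[OF assms]
  by (simp add: jacobi_op_def algebra_simps power2_eq_square add_divide_distrib diff_divide_distrib)

text \<open>Both sides are the sum over \<open>u\<close> of the second derivative at
  \<open>s = 0\<close> of one function of s, the convolution evaluated at
  \<open>\<gamma> u s\<close> and \<open>b\<close>. The left side differentiates under the integral,
  the right side differentiates the polynomial \<open>h\<close> along the curve.\<close>

lemma convolution_jacobi_op:
  assumes h: "\<And>x b. x \<in> Q \<Longrightarrow> b \<in> Q \<Longrightarrow> (\<integral>y. poly f (t x y) * poly q (t y b) \<partial>\<mu>) = poly h (t x b)"
    and b: "b \<in> Q"
  shows "(\<integral>y. poly (jacobi_op \<alpha> \<beta> f) (t p0 y) * poly q (t y b) \<partial>\<mu>) = poly (jacobi_op \<alpha> \<beta> h) (t p0 b)"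
proof -
  define z where "z u s y = A u y + B u y * cos s + C u y * sin s" for u s y
  define z' where "z' u s y = C u y * cos s - B u y * sin s" for u s y
  define z'' where "z'' u s y = B u y * cos s + C u y * sin s" for u s y
  define w where "w y = poly q (t y b)" for y
  \<comment> \<open>The polynomial is an argument because the same derivatives are taken of
    \<open>f\<close> at the integration variable and of \<open>h\<close> at
    \<open>b\<close>.\<close>
  define D1 where "D1 f u s y = poly (pderiv f) (z u s y) * z' u s y" for f u s y
  define D2 where "D2 f u s y = poly (pderiv (pderiv f)) (z u s y) * (z' u s y)\<^sup>2 - poly (pderiv f) (z u s y) * z'' u s y" for f u s y
  have dD1: "((\<lambda>s. poly f (z u s y)) has_real_derivative D1 f u s y) (at s)" for f u s y
    unfolding z_def D1_def z'_def by (rule DERIV_poly_trig)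
  have dD2: "((\<lambda>s. D1 f u s y) has_real_derivative D2 f u s y) (at s)" for f u s y
    unfolding z_def D1_def z'_def D2_def z''_def by (rule DERIV2_poly_trig)
  have zt: "z u s y = t (\<gamma> u s) y" if "u < d" "y \<in> Q" for u s y
    using geodesic_cos[OF that] by (simp add: z_def)
  obtain K0 where K0: "K0 \<ge> 0" "\<And>z. z \<in> {-1..1} \<Longrightarrow> \<bar>poly q z\<bar> \<le> K0" using poly_bounded_Icc by blast
  obtain K1 where K1: "K1 \<ge> 0" "\<And>z. z \<in> {-1..1} \<Longrightarrow> \<bar>poly (pderiv f) z\<bar> \<le> K1" using poly_bounded_Icc by blast
  obtain K2 where K2: "K2 \<ge> 0" "\<And>z. z \<in> {-1..1} \<Longrightarrow> \<bar>poly (pderiv (pderiv f)) z\<bar> \<le> K2" using poly_bounded_Icc by blast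
  have zb: "\<bar>z' u s y\<bar> \<le> 3" "\<bar>z'' u s y\<bar> \<le> 3" if "u < d" "y \<in> Q" for u s y
  proof -
    have "\<bar>C u y * cos s\<bar> \<le> 2 * 1" "\<bar>B u y * sin s\<bar> \<le> 1 * 1" "\<bar>C u y * sin s\<bar> \<le> 2 * 1" "\<bar>B u y * cos s\<bar> \<le> 1 * 1"
      unfolding abs_mult using abc_bounds[OF that] by (intro mult_mono; simp)+
    then show "\<bar>z' u s y\<bar> \<le> 3" "\<bar>z'' u s y\<bar> \<le> 3" unfolding z'_def z''_def by linarith+
  qed
  have D1b: "\<bar>D1 f u s y * w y\<bar> \<le> K1 * 3 * K0" if "u < d" "y \<in> Q" for u s y
    unfolding D1_def w_def abs_mult using K0 K1 zb[OF that] zt[OF that]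
    by (intro mult_mono mult_nonneg_nonneg) auto
  have D2b: "\<bar>D2 f u s y * w y\<bar> \<le> (K2 * 3\<^sup>2 + K1 * 3) * K0" if "u < d" "y \<in> Q" for u s y
  proof -
    have "\<bar>D2 f u s y\<bar> \<le> \<bar>poly (pderiv (pderiv f)) (z u s y) * (z' u s y)\<^sup>2\<bar> + \<bar>poly (pderiv f) (z u s y) * z'' u s y\<bar>"
      unfolding D2_def by (rule abs_triangle_ineq4)
    also have "\<dots> \<le> K2 * 3\<^sup>2 + K1 * 3"
      unfolding abs_mult power_abs using K1 K2 zb[OF that] zt[OF that]
      by (intro add_mono mult_mono power_mono) auto
    finally show ?thesis unfolding w_def abs_mult using K0 K1 K2 by (intro mult_mono) auto
  qed
  have zm: "bounded_measurable \<mu> (z u s)" if "u < d" for u s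
  proof -
    have "z u s \<in> borel_measurable \<mu>"
      by (rule iffD1[OF measurable_cong measurable_t(2)[OF geodesic_in[OF that, of s]]])
        (simp add: zt[OF that] space_mu)
    then show ?thesis using zt[OF that] by (intro bounded_measurableI[where K = 1]) (auto simp: space_mu)
  qed
  have z'm: "bounded_measurable \<mu> (z' u s)" if "u < d" for u s
  proof -
    \<comment> \<open>A quarter turn in s changes z - A into its derivative, and A is the mean of z
      at 0 and at pi. Thus measurability passes from z to z'.\<close>
    have "z' u s y = z u (s + pi / 2) y - (z u 0 y + z u pi y) / 2" for y
    proof -
      have "cos (s + pi / 2) = - sin s" "sin (s + pi / 2) = cos s" by (simp_all add: cos_add sin_add)
      then show ?thesis unfolding z_def z'_def by (simp only:) (simp add: field_simps)
    qed
    then have "z' u s = (\<lambda>y. z u (s + pi / 2) y - (z u 0 y + z u pi y) / 2)" by blast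
    then show ?thesis
      by (simp only:) (intro bounded_measurable_diff bounded_measurable_divide bounded_measurable_add zm that)
  qed
  have wm: "bounded_measurable \<mu> w"
    unfolding w_def by (intro bounded_measurable_poly bounded_measurable_t b)
  have e0: "(\<integral>y. poly f (z u s y) * w y \<partial>\<mu>) = poly h (z u s b)" if "u < d" for u s
  proof -
    have "(\<integral>y. poly f (z u s y) * w y \<partial>\<mu>) = (\<integral>y. poly f (t (\<gamma> u s) y) * w y \<partial>\<mu>)"
      by (rule Bochner_Integration.integral_cong) (auto simp: zt[OF that] space_mu)
    then show ?thesis using h[OF geodesic_in[OF that, of s] b] zt[OF that b, of s] by (simp add: w_def)
  qed
  have e1: "(\<integral>y. D1 f u s y * w y \<partial>\<mu>) = D1 h u s b" if "u < d" for u s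
  proof -
    have "((\<lambda>s. \<integral>y. poly f (z u s y) * w y \<partial>\<mu>) has_real_derivative (\<integral>y. D1 f u s y * w y \<partial>\<mu>)) (at s)"
      by (rule DERIV_under_integral[where K = "K1 * 3 * K0"])
        (use zm[OF that] wm D1b[OF that] in \<open>auto intro!: DERIV_cmult_right dD1 bounded_measurable_mult bounded_measurable_poly simp: space_mu\<close>)
    then show ?thesis unfolding e0[OF that] using dD1 by (rule DERIV_unique)
  qed
  have e2: "(\<integral>y. D2 f u s y * w y \<partial>\<mu>) = D2 h u s b" if "u < d" for u s
  proof -
    have "((\<lambda>s. \<integral>y. D1 f u s y * w y \<partial>\<mu>) has_real_derivative (\<integral>y. D2 f u s y * w y \<partial>\<mu>)) (at s)"
    proof (rule DERIV_under_integral[where K = "(K2 * 3\<^sup>2 + K1 * 3) * K0"])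
      show "bounded_measurable \<mu> (\<lambda>y. D1 f u s y * w y)" for s
        unfolding D1_def using zm[OF that] z'm[OF that] wm
        by (intro bounded_measurable_mult bounded_measurable_poly)
    qed (use D2b[OF that] in \<open>auto intro!: DERIV_cmult_right dD2 simp: space_mu\<close>)
    then show ?thesis unfolding e1[OF that] using dD2 by (rule DERIV_unique)
  qed
  have D20: "(\<Sum>u<d. D2 g u 0 y) = poly (jacobi_op \<alpha> \<beta> g) (t p0 y)" if "y \<in> Q" for g y
  proof -
    have "D2 g u 0 y = poly (pderiv (pderiv g)) (t p0 y) * (C u y)\<^sup>2 - poly (pderiv g) (t p0 y) * B u y" if "u < d" for u
      using zt[OF that \<open>y \<in> Q\<close>, of 0] geodesic_0[OF that] by (simp add: D2_def z'_def z''_def)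
    then show ?thesis unfolding sum_second_derivative[OF that, symmetric] by (intro sum.cong) auto
  qed
  have D2i: "integrable \<mu> (\<lambda>y. D2 f u 0 y * w y)" if "u < d" for u
  proof -
    have "D2 f u 0 y = poly (pderiv (pderiv f)) (z u 0 y) * (z' u 0 y)\<^sup>2 - poly (pderiv f) (z u 0 y) * (z u 0 y - (z u 0 y + z u pi y) / 2)" for y
      by (simp add: D2_def z_def z''_def)
    then have "(\<lambda>y. D2 f u 0 y * w y) = (\<lambda>y. (poly (pderiv (pderiv f)) (z u 0 y) * (z' u 0 y)\<^sup>2 - poly (pderiv f) (z u 0 y) * (z u 0 y - (z u 0 y + z u pi y) / 2)) * w y)"
      by presburger
    then show ?thesis
      by (simp only:) (intro bounded_measurable_integrable bounded_measurable_diff bounded_measurable_divide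
        bounded_measurable_add bounded_measurable_mult bounded_measurable_power bounded_measurable_poly zm z'm wm that)
  qed
  have "(\<integral>y. poly (jacobi_op \<alpha> \<beta> f) (t p0 y) * poly q (t y b) \<partial>\<mu>) = (\<integral>y. (\<Sum>u<d. D2 f u 0 y * w y) \<partial>\<mu>)"
    by (rule Bochner_Integration.integral_cong) (auto simp: D20 space_mu w_def sum_distrib_right[symmetric])
  also have "\<dots> = (\<Sum>u<d. D2 h u 0 b)"
    using e2 by (subst Bochner_Integration.integral_sum) (auto intro: D2i)
  also have "\<dots> = poly (jacobi_op \<alpha> \<beta> h) (t p0 b)" by (rule D20[OF b])
  finally show ?thesis .
qed

text \<open>Along \<open>\<gamma> 0\<close> the cosine of the distance from \<open>p0\<close> takes
  every value in [-1, 1].\<close>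

lemma poly_eq_on_t:
  assumes "\<And>b. b \<in> Q \<Longrightarrow> poly f (t p0 b) = poly g (t p0 b)"
  shows "f = g"
proof (rule poly_eq_on_Icc)
  fix z :: real assume "z \<in> {-1..1}"
  then have "z = t p0 (\<gamma> 0 (arccos z))" using geodesic_unit[of "arccos z"] by simp
  then show "poly f z = poly g z" using assms[OF geodesic_in[of 0]] dims by (metis zero_less_one less_le_trans le_zero_eq not_gr_zero One_nat_def)
qed

text \<open>A formula of Funk-Hecke type: the convolution lies in the eigenspace of
  \<open>P l\<close>, which is one-dimensional by \<open>jacobi_op_eigenspace\<close>. The factor
  depends on \<open>l\<close> and \<open>q\<close> but not on the points.\<close>

lemma convolution_jacobi:
  obtains c where "\<And>x b. x \<in> Q \<Longrightarrow> b \<in> Q \<Longrightarrow>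
    (\<integral>y. poly (P l) (t x y) * poly q (t y b) \<partial>\<mu>) = c * poly (P l) (t x b)"
proof -
  obtain h where h: "\<And>x b. x \<in> Q \<Longrightarrow> b \<in> Q \<Longrightarrow>
     (\<integral>y. poly (P l) (t x y) * poly q (t y b) \<partial>\<mu>) = poly h (t x b)"
    using convolution_poly by blast
  define e where "e = - (real l * (real l + \<alpha> + \<beta> + 1))"
  have "jacobi_op \<alpha> \<beta> h = smult e h"
  proof (rule poly_eq_on_t)
    fix b assume b: "b \<in> Q"
    have "poly (jacobi_op \<alpha> \<beta> h) (t p0 b) = (\<integral>y. poly (jacobi_op \<alpha> \<beta> (P l)) (t p0 y) * poly q (t y b) \<partial>\<mu>)"
      by (rule convolution_jacobi_op[OF h b, symmetric])
    also have "\<dots> = (\<integral>y. e * (poly (P l) (t p0 y) * poly q (t y b)) \<partial>\<mu>)"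
      unfolding jacobi_op_jacobi_poly e_def[symmetric] by (simp add: mult.assoc)
    also have "\<dots> = poly (smult e h) (t p0 b)" by (simp add: h[OF p0_in b])
    finally show "poly (jacobi_op \<alpha> \<beta> h) (t p0 b) = poly (smult e h) (t p0 b)" .
  qed
  then obtain c where "h = smult c (P l)"
    using jacobi_op_eigenspace[OF _ param_bounds] unfolding e_def by blast
  then show ?thesis by (intro that[of c]) (simp add: h)
qed

definition zonal_norm2 :: "nat \<Rightarrow> real" where "zonal_norm2 l = (\<integral>y. (poly (P l) (t p0 y))\<^sup>2 \<partial>\<mu>)"

lemma zonal_norm2_eq: "x \<in> Q \<Longrightarrow> (\<integral>y. (poly (P l) (t x y))\<^sup>2 \<partial>\<mu>) = zonal_norm2 l"
  unfolding zonal_norm2_def by (rule integral_base_point) measurable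

lemma t_self: "x \<in> Q \<Longrightarrow> t x x = 1"
proof -
  assume x: "x \<in> Q"
  obtain g where "isometry_betw g Q \<theta> Q \<theta>" "g x = p0" using move[OF x x] by auto
  then have "\<theta> x x = \<theta> p0 p0" using x by (metis isometry_betw_def)
  then show ?thesis using geodesic_unit[of 0] by simp
qed

lemma P_at_1_pos: "poly (P l) 1 > 0"
  unfolding poly_jacobi_poly by (rule jacobi_at_1_pos) (rule param_bounds)

text \<open>The factor left open by \<open>convolution_jacobi\<close> is read off where both points
  are \<open>p0\<close>.\<close>

lemma jacobi_reproducing:
  assumes "x \<in> Q" "b \<in> Q"
  shows "(\<integral>y. poly (P l) (t x y) * poly (P l) (t y b) \<partial>\<mu>) = zonal_norm2 l * poly (P l) (t x b) / poly (P l) 1"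
proof -
  obtain c where c: "\<And>x b. x \<in> Q \<Longrightarrow> b \<in> Q \<Longrightarrow>
    (\<integral>y. poly (P l) (t x y) * poly (P l) (t y b) \<partial>\<mu>) = c * poly (P l) (t x b)"
    using convolution_jacobi by blast
  have "c * poly (P l) 1 = (\<integral>y. poly (P l) (t p0 y) * poly (P l) (t y p0) \<partial>\<mu>)"
    using c[OF p0_in p0_in] t_self[OF p0_in] by simp
  also have "\<dots> = zonal_norm2 l"
    unfolding zonal_norm2_def power2_eq_square
    by (intro Bochner_Integration.integral_cong) (simp_all add: space_mu dist_sym[OF _ p0_in])
  finally have "c = zonal_norm2 l / poly (P l) 1" using P_at_1_pos[of l] by (simp add: field_simps)
  then show ?thesis using c[OF assms] by simp
qed

text \<open>Exchanging the two points shows that the convolution of \<open>P l\<close> with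
  \<open>P k\<close> is a multiple of both polynomials. Their degrees differ, so it is 0.\<close>

lemma jacobi_orthogonal:
  assumes "x \<in> Q" "b \<in> Q" "l \<noteq> k"
  shows "(\<integral>y. poly (P l) (t x y) * poly (P k) (t y b) \<partial>\<mu>) = 0"
proof -
  obtain c where c: "\<And>x b. x \<in> Q \<Longrightarrow> b \<in> Q \<Longrightarrow>
    (\<integral>y. poly (P l) (t x y) * poly (P k) (t y b) \<partial>\<mu>) = c * poly (P l) (t x b)"
    using convolution_jacobi by blast
  obtain c' where c': "\<And>x b. x \<in> Q \<Longrightarrow> b \<in> Q \<Longrightarrow>
    (\<integral>y. poly (P k) (t x y) * poly (P l) (t y b) \<partial>\<mu>) = c' * poly (P k) (t x b)"
    using convolution_jacobi by blast
  have "(\<integral>y. poly (P k) (t x y) * poly (P l) (t y b) \<partial>\<mu>) =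
    (\<integral>y. poly (P l) (t b y) * poly (P k) (t y x) \<partial>\<mu>)" if "x \<in> Q" "b \<in> Q" for x b
  proof (rule Bochner_Integration.integral_cong[OF refl])
    fix y assume "y \<in> space \<mu>"
    then show "poly (P k) (t x y) * poly (P l) (t y b) = poly (P l) (t b y) * poly (P k) (t y x)"
      using dist_sym[OF that(1), of y] dist_sym[OF that(2), of y] by (simp add: space_mu)
  qed
  then have "c' * poly (P k) (t x b) = c * poly (P l) (t x b)" if "x \<in> Q" "b \<in> Q" for x b
    using c[OF that(2,1)] c'[OF that] that by (simp only: dist_sym[OF that])
  then have "smult c' (P k) = smult c (P l)"
    using p0_in by (intro poly_eq_on_t) simp
  note e = this
  have "c = 0"
  proof (rule ccontr)
    assume "c \<noteq> 0"
    then have "c' \<noteq> 0" using e jacobi_poly_nonzero[OF param_bounds(1)] by auto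
    then show False
      using arg_cong[OF e, of degree] \<open>c \<noteq> 0\<close> \<open>l \<noteq> k\<close> degree_jacobi_poly[OF param_bounds] by simp
  qed
  then show ?thesis using c[OF assms(1,2)] by simp
qed

lemma P_0 [simp]: "P 0 = 1" by (simp add: jacobi_poly_def)

lemma integral_P: assumes "x \<in> Q" "l \<ge> 1" shows "(\<integral>y. poly (P l) (t x y) \<partial>\<mu>) = 0"
  using jacobi_orthogonal[OF assms(1,1), of l 0] assms(2) by simp

lemma zonal_norm2_0: "zonal_norm2 0 = 1" by (simp add: zonal_norm2_def measure_Q)

section \<open>The distribution of the distance\<close>

abbreviation "W \<equiv> angular_weight d d0"
abbreviation "K \<equiv> \<kappa> d d0"

lemma K_pos: "K > 0"
  unfolding \<kappa>_def using dims by (intro divide_pos_pos mult_pos_pos Gamma_real_pos) auto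

lemma K_normalizes: "K * sin_cos_integral d d0 = 1"
proof -
  have "Gamma (real d / 2 + real d0 / 2) > 0" "Gamma (real d / 2) > 0" "Gamma (real d0 / 2) > 0"
    using dims by (auto intro!: Gamma_real_pos)
  then show ?thesis unfolding \<kappa>_def sin_cos_integral_eq[OF dims] by simp
qed

text \<open>The candidate for the law of the distance from a fixed point; the constant
  \<open>K\<close> makes its mass 1 by \<open>K_normalizes\<close>.\<close>

definition angle_distr :: "real measure" where
  "angle_distr = density lborel (\<lambda>s. ennreal (K * W s * indicator {0..pi} s))"

lemma integral_angle_distr:
  fixes F :: "real \<Rightarrow> real"
  assumes [measurable]: "F \<in> borel_measurable borel"
  shows "(\<integral>s. F s \<partial>angle_distr) = (LBINT s:{0..pi}. K * W s * F s)"
proof -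
  have "(\<integral>s. F s \<partial>angle_distr) = (\<integral>s. (K * W s * indicator {0..pi} s) *\<^sub>R F s \<partial>lborel)"
    unfolding angle_distr_def
    by (rule integral_density)
      (use K_pos angular_weight_nonneg in \<open>auto split: split_indicator simp: less_imp_le\<close>)
  also have "\<dots> = (LBINT s:{0..pi}. K * W s * F s)"
    unfolding set_lebesgue_integral_def by (rule Bochner_Integration.integral_cong) auto
  finally show ?thesis .
qed

lemma finite_measure_angle_distr: "finite_measure angle_distr"
proof (rule finite_measureI)
  have "set_integrable lborel {0..pi} (\<lambda>s. K * W s)"
    by (intro borel_integrable_atLeastAtMost' continuous_intros)
  then have i: "integrable lborel (\<lambda>s. K * W s * indicator {0..pi} s)"
    unfolding set_integrable_def by (simp add: mult_ac)
  have "emeasure angle_distr (space angle_distr) = (\<integral>\<^sup>+s. ennreal (K * W s * indicator {0..pi} s) \<partial>lborel)"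
    unfolding angle_distr_def by (subst emeasure_density) auto
  also have "\<dots> < \<infinity>"
    using integrableD(2)[OF i] by (subst nn_integral_eq_integral[OF i])
      (use K_pos angular_weight_nonneg in \<open>auto split: split_indicator simp: less_imp_le\<close>)
  finally show "emeasure angle_distr (space angle_distr) \<noteq> \<infinity>" by simp
qed

lemma integral_poly_angle_distr:
  "(\<integral>s. poly p (cos s) \<partial>angle_distr) = K * integral {0..pi} (\<lambda>s. W s * poly p (cos s))"
proof -
  have "(\<integral>s. poly p (cos s) \<partial>angle_distr) = (LBINT s:{0..pi}. K * W s * poly p (cos s))"
    by (rule integral_angle_distr) measurable
  also have "\<dots> = integral {0..pi} (\<lambda>s. K * (W s * poly p (cos s)))"
    by (subst LBINT_continuous_Icc) (auto intro!: continuous_intros simp: mult.assoc)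
  finally show ?thesis by simp
qed

lemma integral_P_angle_distr:
  assumes "l \<ge> 1"
  shows "(\<integral>s. poly (P l) (cos s) \<partial>angle_distr) = 0"
proof -
  obtain k where l: "l = Suc k" using assms by (cases l) auto
  have "integral {0..pi} (\<lambda>s. W s * poly (P l) (cos s)) = 0"
    using integral_unique[OF has_integral_weighted_jacobi[OF dims, of pi k]] dims
    by (simp add: poly_jacobi_poly l zero_power)
  then show ?thesis by (simp add: integral_poly_angle_distr)
qed

lemma integrable_poly_t:
  "x \<in> Q \<Longrightarrow> integrable \<mu> (\<lambda>y. poly p (t x y))"
  by (intro bounded_measurable_integrable bounded_measurable_poly bounded_measurable_t)

text \<open>Both sides are 1 for l = 0 and 0 for the other Jacobi polynomials: on Q by orthogonality
  to the constants, for the explicit density because the antiderivative vanishes at both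
  ends.\<close>

lemma moments_t: "(\<integral>y. poly p (t p0 y) \<partial>\<mu>) = (\<integral>s. poly p (cos s) \<partial>angle_distr)"
proof -
  interpret a: finite_measure angle_distr by (rule finite_measure_angle_distr)
  obtain b where p: "p = (\<Sum>l\<le>degree p. smult (b l) (P l))"
    using jacobi_poly_span[OF param_bounds order_refl] by blast
  have ia: "integrable angle_distr (\<lambda>s. poly q (cos s))" for q
  proof (rule a.bounded_measurable_integrable[OF bounded_measurable_poly[OF bounded_measurableI[where K = 1]]])
    have "sets angle_distr = sets borel" by (simp add: angle_distr_def)
    then show "cos \<in> borel_measurable angle_distr" using borel_measurable_cos measurable_cong_sets by blast
  qed auto
  have "(\<integral>y. poly p (t p0 y) \<partial>\<mu>) = (\<Sum>l\<le>degree p. b l * (\<integral>y. poly (P l) (t p0 y) \<partial>\<mu>))"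
    by (subst p) (simp add: poly_sum integrable_poly_t p0_in)
  also have "\<dots> = (\<Sum>l\<le>degree p. b l * (\<integral>s. poly (P l) (cos s) \<partial>angle_distr))"
  proof (rule sum.cong[OF refl])
    fix l
    show "b l * (\<integral>y. poly (P l) (t p0 y) \<partial>\<mu>) = b l * (\<integral>s. poly (P l) (cos s) \<partial>angle_distr)"
    proof (cases "l = 0")
      case True
      have "(\<integral>s. poly (P 0) (cos s) \<partial>angle_distr) = 1"
        using K_normalizes unfolding integral_poly_angle_distr by (simp add: sin_cos_integral_def)
      then show ?thesis using True measure_Q by (simp add: integral_const)
    next
      case False
      then show ?thesis using integral_P_angle_distr[of l] integral_P[OF p0_in, of l] by simp
    qed
  qed
  also have "\<dots> = (\<integral>s. poly p (cos s) \<partial>angle_distr)"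
    by (subst (2) p) (simp add: poly_sum ia)
  finally show ?thesis .
qed

lemma distr_t: "distr \<mu> borel (t p0) = distr angle_distr borel cos"
proof (rule moment_unique)
  show "cos \<in> borel_measurable angle_distr"
    unfolding angle_distr_def by measurable
qed (auto intro: finite_measure_axioms finite_measure_angle_distr measurable_t p0_in moments_t)

lemma integral_t:
  fixes F :: "real \<Rightarrow> real"
  assumes x: "x \<in> Q" and F [measurable]: "F \<in> borel_measurable borel"
  shows "(\<integral>y. F (t x y) \<partial>\<mu>) = (LBINT s:{0..pi}. K * W s * F (cos s))"
proof -
  have c: "cos \<in> borel_measurable angle_distr"
    unfolding angle_distr_def by measurable
  have "(\<integral>y. F (t x y) \<partial>\<mu>) = (\<integral>y. F (t p0 y) \<partial>\<mu>)" by (rule integral_base_point[OF x F])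
  also have "\<dots> = (\<integral>z. F z \<partial>distr \<mu> borel (t p0))"
    by (rule integral_distr[symmetric]) (auto intro: measurable_t p0_in)
  also have "\<dots> = (\<integral>s. F (cos s) \<partial>angle_distr)"
    unfolding distr_t by (rule integral_distr[OF c F])
  also have "\<dots> = (LBINT s:{0..pi}. K * W s * F (cos s))" by (rule integral_angle_distr) measurable
  finally show ?thesis .
qed

text \<open>The origin of M_l in the expansions: the law of the distance turns the norm on Q into
  the weighted norm on the interval.\<close>

lemma zonal_norm2_jacobi_M:
  assumes "l \<ge> 1"
  shows "zonal_norm2 l * jacobi_M \<alpha> \<beta> l = K"
proof -
  have "zonal_norm2 l = (LBINT s:{0..pi}. K * W s * (poly (P l) (cos s))\<^sup>2)"
    unfolding zonal_norm2_def by (rule integral_t[OF p0_in]) measurable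
  also have "\<dots> = integral {0..pi} (\<lambda>s. K * (W s * (poly (P l) (cos s))\<^sup>2))"
    by (subst LBINT_continuous_Icc) (auto intro!: continuous_intros simp: mult.assoc)
  also have "\<dots> = K * jacobi_norm2 d d0 l"
    by (simp add: jacobi_norm2_def poly_jacobi_poly)
  finally show ?thesis using jacobi_norm2_eq[OF dims, of l] assms by simp
qed

lemma zonal_norm2_pos: "zonal_norm2 l > 0"
proof (cases "l = 0")
  case False
  then have "zonal_norm2 l \<noteq> 0" using zonal_norm2_jacobi_M[of l] K_pos by auto
  moreover have "zonal_norm2 l \<ge> 0" by (simp add: zonal_norm2_def)
  ultimately show ?thesis by simp
qed (simp add: zonal_norm2_0)

lemma bounded_measurable_ball:
  assumes "x \<in> Q"
  shows "bounded_measurable \<mu> (\<lambda>y. indicator {c<..} (t x y))" "bounded_measurable \<mu> (\<lambda>y. indicator {c<..} (t y x))"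
  using measurable_t[OF assms, THEN measurable_compose, of "indicator {c<..}" borel]
  by (auto intro!: bounded_measurableI[where K = 1])

text \<open>The Fourier coefficient of a ball before division by the squared norm. At l = 0 it is
  the measure v_r.\<close>

definition ball_coeff :: "real \<Rightarrow> nat \<Rightarrow> real" where
  "ball_coeff r l = (\<integral>y. indicator {cos r<..} (t p0 y) * poly (P l) (t p0 y) \<partial>\<mu>)"

lemma ball_coeff_eq:
  "x \<in> Q \<Longrightarrow> (\<integral>y. indicator {cos r<..} (t x y) * poly (P l) (t x y) \<partial>\<mu>) = ball_coeff r l"
  unfolding ball_coeff_def by (rule integral_base_point) measurable

lemma ball_coeff_integral:
  assumes r: "r \<in> {0..pi}"
  shows "ball_coeff r l = K * integral {0..r} (\<lambda>s. W s * poly (P l) (cos s))"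
proof -
  have "ball_coeff r l = (LBINT s:{0..pi}. K * W s * (indicator {cos r<..} (cos s) * poly (P l) (cos s)))"
    unfolding ball_coeff_def by (rule integral_t[OF p0_in]) measurable
  also have "\<dots> = (LBINT s:{0..r}. K * (W s * poly (P l) (cos s)))"
    unfolding set_lebesgue_integral_def
  proof (rule integral_cong_AE)
    show "AE s in lborel. indicator {0..pi} s *\<^sub>R (K * W s * (indicator {cos r<..} (cos s) * poly (P l) (cos s))) =
       indicator {0..r} s *\<^sub>R (K * (W s * poly (P l) (cos s)))"
      \<comment> \<open>The ball is open, so the two integrands can disagree only at s = r.\<close>
      using AE_lborel_singleton[of r]
    proof eventually_elim
      fix s assume "s \<noteq> r"
      then have "(s \<in> {0..pi} \<and> cos r < cos s) = (s \<in> {0..r})"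
        using r cos_mono_less_eq[of r s] by (auto simp: less_le)
      then show "indicator {0..pi} s *\<^sub>R (K * W s * (indicator {cos r<..} (cos s) * poly (P l) (cos s))) =
       indicator {0..r} s *\<^sub>R (K * (W s * poly (P l) (cos s)))"
        by (auto simp: indicator_def)
    qed
  qed measurable
  also have "\<dots> = integral {0..r} (\<lambda>s. K * (W s * poly (P l) (cos s)))"
    by (rule LBINT_continuous_Icc) (intro continuous_intros)
  finally show ?thesis by simp
qed

lemma ball_coeff_0: "r \<in> {0..pi} \<Longrightarrow> ball_coeff r 0 = K * integral {0..r} W"
  by (simp add: ball_coeff_integral)

text \<open>By the explicit antiderivative the square is K^2 \<open>coeff_a\<close> / l^2 with l = k
  + 1. Division by the squared norm K / M_l leaves a term of the expansion.\<close>

lemma ball_coeff_Suc: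
  assumes "r \<in> {0..pi}"
  shows "(ball_coeff r (Suc k))\<^sup>2 / zonal_norm2 (Suc k) =
    K * (1 / (real (Suc k))\<^sup>2 * jacobi_M \<alpha> \<beta> (Suc k) * coeff_a d d0 (Suc k) r)"
proof -
  define M where "M = jacobi_M \<alpha> \<beta> (Suc k)"
  have NM: "zonal_norm2 (Suc k) = K / M" "M \<noteq> 0"
  proof -
    have "zonal_norm2 (Suc k) * M = K" using zonal_norm2_jacobi_M[of "Suc k"] by (simp only: M_def)
    moreover from this show "M \<noteq> 0" using K_pos by auto
    ultimately show "zonal_norm2 (Suc k) = K / M" by (simp add: nonzero_eq_divide_eq)
  qed
  have "integral {0..r} (\<lambda>s. W s * poly (P (Suc k)) (cos s)) =
    sin (r / 2) ^ d * cos (r / 2) ^ d0 * jacobi (real d / 2) (real d0 / 2) k (cos r) / real (Suc k)"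
    using integral_unique[OF has_integral_weighted_jacobi[OF dims, of r k]] assms by (simp add: poly_jacobi_poly)
  then have "(ball_coeff r (Suc k))\<^sup>2 = K\<^sup>2 * coeff_a d d0 (Suc k) r / (real (Suc k))\<^sup>2"
    unfolding ball_coeff_integral[OF assms]
    by (simp add: coeff_a_def power_mult_distrib power_divide power_even_eq power_mult[symmetric] mult.commute[of 2])
  then show ?thesis unfolding NM(1) M_def[symmetric] using K_pos NM(2)
    by (simp add: power2_eq_square del: of_nat_Suc)
qed

lemma ball_coeff_0_range: "0 \<le> ball_coeff r 0" "ball_coeff r 0 \<le> 1"
proof -
  have "ball_coeff r 0 \<le> (\<integral>y. 1 \<partial>\<mu>)"
    unfolding ball_coeff_def P_0 poly_1 mult_1_right
    by (intro integral_mono bounded_measurable_integrable bounded_measurable_ball p0_in) (auto split: split_indicator)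
  then show "ball_coeff r 0 \<le> 1" using measure_Q by simp
  show "0 \<le> ball_coeff r 0" unfolding ball_coeff_def by (intro Bochner_Integration.integral_nonneg) simp
qed

section \<open>Zonal expansion of balls\<close>

text \<open>The zonal spherical function of degree l: P_l normalized to be 1 at distance 0.\<close>

definition zonal :: "nat \<Rightarrow> real \<Rightarrow> real" where
  "zonal l z = poly (P l) z / poly (P l) 1"

lemma zonal_1 [simp]: "zonal l 1 = 1" using P_at_1_pos[of l] by (simp add: zonal_def)

lemma zonal_0 [simp]: "zonal 0 z = 1" by (simp add: zonal_def)

lemma integral_jacobi_product:
  assumes "x \<in> Q" "b \<in> Q"
  shows "(\<integral>y. poly (P l) (t x y) * poly (P k) (t y b) \<partial>\<mu>) = (if k = l then zonal_norm2 l * zonal l (t x b) else 0)"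
  using jacobi_reproducing[OF assms] jacobi_orthogonal[OF assms] by (simp add: zonal_def)

lemma integral_jacobi_sum_product:
  assumes "x \<in> Q" "b \<in> Q"
  shows "(\<integral>y. (\<Sum>l\<le>n. c l * poly (P l) (t x y)) * (\<Sum>k\<le>n. c k * poly (P k) (t y b)) \<partial>\<mu>) =
    (\<Sum>l\<le>n. (c l)\<^sup>2 * zonal_norm2 l * zonal l (t x b))"
proof -
  have "(\<integral>y. (\<Sum>l\<le>n. c l * poly (P l) (t x y)) * (\<Sum>k\<le>n. c k * poly (P k) (t y b)) \<partial>\<mu>) =
    (\<integral>y. (\<Sum>l\<le>n. \<Sum>k\<le>n. (c l * c k) * (poly (P l) (t x y) * poly (P k) (t y b))) \<partial>\<mu>)"
    unfolding sum_product by (intro Bochner_Integration.integral_cong sum.cong refl) (simp only: mult_ac)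
  also have "\<dots> = (\<Sum>l\<le>n. \<Sum>k\<le>n. (c l * c k) * (\<integral>y. poly (P l) (t x y) * poly (P k) (t y b) \<partial>\<mu>))"
    by (simp add: bounded_measurable_integrable bounded_measurable_kernel assms)
  also have "\<dots> = (\<Sum>l\<le>n. (c l)\<^sup>2 * zonal_norm2 l * zonal l (t x b))"
    unfolding integral_jacobi_product[OF assms]
    by (simp add: if_distrib[of "\<lambda>x. _ * x"] sum.delta power2_eq_square mult.assoc cong: if_cong)
  finally show ?thesis .
qed

text \<open>Cauchy-Schwarz in the reproducing formula, where both factors have squared norm
  \<open>zonal_norm2 l\<close>.\<close>

lemma abs_zonal_le_1:
  assumes "x \<in> Q" "b \<in> Q"
  shows "\<bar>zonal l (t x b)\<bar> \<le> 1"
proof -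
  define u v where "u y = poly (P l) (t x y)" and "v y = poly (P l) (t y b)" for y
  have uv: "bounded_measurable \<mu> u" "bounded_measurable \<mu> v"
    unfolding u_def v_def by (intro bounded_measurable_poly bounded_measurable_t assms)+
  have v2: "(\<integral>y. (v y)\<^sup>2 \<partial>\<mu>) = zonal_norm2 l"
    using integral_sym[OF assms(2), of "\<lambda>z. (poly (P l) z)\<^sup>2"] zonal_norm2_eq[OF assms(2)] by (simp add: v_def)
  have u2: "(\<integral>y. (u y)\<^sup>2 \<partial>\<mu>) = zonal_norm2 l" using zonal_norm2_eq[OF assms(1)] by (simp add: u_def)
  have "(\<integral>y. u y * v y \<partial>\<mu>)\<^sup>2 \<le> zonal_norm2 l * zonal_norm2 l"
    using Cauchy_Schwarz_integral[OF uv] unfolding u2 v2 .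
  moreover have "(\<integral>y. u y * v y \<partial>\<mu>) = zonal_norm2 l * zonal l (t x b)"
    unfolding u_def v_def by (simp add: integral_jacobi_product assms)
  ultimately have "(zonal_norm2 l)\<^sup>2 * (zonal l (t x b))\<^sup>2 \<le> (zonal_norm2 l)\<^sup>2 * 1"
    by (simp add: power2_eq_square mult_ac)
  then have "(zonal l (t x b))\<^sup>2 \<le> 1" using zonal_norm2_pos[of l] by (simp only: mult_le_cancel_left_pos zero_less_power)
  then show ?thesis by (simp add: abs_square_le_1)
qed

definition ball_sum :: "real \<Rightarrow> nat \<Rightarrow> real \<Rightarrow> real" where
  "ball_sum r n z = (\<Sum>l\<le>n. ball_coeff r l / zonal_norm2 l * poly (P l) z)"

text \<open>Orthogonality leaves only diagonal terms, and completing the square in each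
  \<open>c l\<close> shows the Fourier coefficient as the optimal choice. The first term is
  \<open>ball_coeff r 0\<close> because an indicator equals its square.\<close>

lemma ball_L2_distance:
  "(\<integral>y. (indicator {cos r<..} (t p0 y) - (\<Sum>l\<le>n. c l * poly (P l) (t p0 y)))\<^sup>2 \<partial>\<mu>) =
    ball_coeff r 0 - (\<Sum>l\<le>n. (ball_coeff r l)\<^sup>2 / zonal_norm2 l)
      + (\<Sum>l\<le>n. zonal_norm2 l * (c l - ball_coeff r l / zonal_norm2 l)\<^sup>2)"
proof -
  define f where "f y = (indicator {cos r<..} (t p0 y) :: real)" for y
  define s where "s y = (\<Sum>l\<le>n. c l * poly (P l) (t p0 y))" for y
  have fm: "bounded_measurable \<mu> f" unfolding f_def by (rule bounded_measurable_ball[OF p0_in])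
  have Pm: "bounded_measurable \<mu> (\<lambda>y. poly (P l) (t p0 y))" for l
    by (intro bounded_measurable_poly bounded_measurable_t p0_in)
  have sm: "bounded_measurable \<mu> s"
    unfolding s_def by (intro bounded_measurable_sum bounded_measurable_mult Pm) simp
  have "(f y - s y)\<^sup>2 = f y - 2 * (f y * s y) + s y * s y" for y
    by (simp add: power2_eq_square algebra_simps f_def indicator_def)
  then have "(\<integral>y. (f y - s y)\<^sup>2 \<partial>\<mu>) = (\<integral>y. f y \<partial>\<mu>) - 2 * (\<integral>y. f y * s y \<partial>\<mu>) + (\<integral>y. s y * s y \<partial>\<mu>)"
    by (simp add: bounded_measurable_integrable fm sm bounded_measurable_mult)
  also have "(\<integral>y. f y * s y \<partial>\<mu>) = (\<Sum>l\<le>n. c l * ball_coeff r l)"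
  proof -
    have "f y * s y = (\<Sum>l\<le>n. c l * (f y * poly (P l) (t p0 y)))" for y
      by (simp add: s_def sum_distrib_left mult_ac)
    then have "(\<integral>y. f y * s y \<partial>\<mu>) = (\<Sum>l\<le>n. c l * (\<integral>y. f y * poly (P l) (t p0 y) \<partial>\<mu>))"
      by (simp add: bounded_measurable_integrable fm Pm bounded_measurable_mult)
    then show ?thesis by (simp only: ball_coeff_def f_def)
  qed
  also have "(\<integral>y. s y * s y \<partial>\<mu>) = (\<Sum>l\<le>n. (c l)\<^sup>2 * zonal_norm2 l)"
  proof -
    have "(\<integral>y. s y * s y \<partial>\<mu>) =
      (\<integral>y. (\<Sum>l\<le>n. c l * poly (P l) (t p0 y)) * (\<Sum>k\<le>n. c k * poly (P k) (t y p0)) \<partial>\<mu>)"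
      unfolding s_def by (rule Bochner_Integration.integral_cong) (simp_all add: space_mu dist_sym[OF _ p0_in])
    then show ?thesis unfolding integral_jacobi_sum_product[OF p0_in p0_in] by (simp add: t_self p0_in)
  qed
  also have "(\<integral>y. f y \<partial>\<mu>) = ball_coeff r 0" by (simp add: ball_coeff_def f_def)
  finally have *: "(\<integral>y. (f y - s y)\<^sup>2 \<partial>\<mu>) =
     ball_coeff r 0 - 2 * (\<Sum>l\<le>n. c l * ball_coeff r l) + (\<Sum>l\<le>n. (c l)\<^sup>2 * zonal_norm2 l)" .
  have "(\<Sum>l\<le>n. zonal_norm2 l * (c l - ball_coeff r l / zonal_norm2 l)\<^sup>2) =
     (\<Sum>l\<le>n. (c l)\<^sup>2 * zonal_norm2 l - 2 * (c l * ball_coeff r l) + (ball_coeff r l)\<^sup>2 / zonal_norm2 l)"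
  proof (rule sum.cong[OF refl])
    fix l
    have "zonal_norm2 l \<noteq> 0" using zonal_norm2_pos[of l] by simp
    then show "zonal_norm2 l * (c l - ball_coeff r l / zonal_norm2 l)\<^sup>2 =
      (c l)\<^sup>2 * zonal_norm2 l - 2 * (c l * ball_coeff r l) + (ball_coeff r l)\<^sup>2 / zonal_norm2 l"
      by (simp add: power2_diff power_divide field_simps power2_eq_square)
  qed
  then have "(\<Sum>l\<le>n. zonal_norm2 l * (c l - ball_coeff r l / zonal_norm2 l)\<^sup>2) =
    (\<Sum>l\<le>n. (c l)\<^sup>2 * zonal_norm2 l) - 2 * (\<Sum>l\<le>n. c l * ball_coeff r l) + (\<Sum>l\<le>n. (ball_coeff r l)\<^sup>2 / zonal_norm2 l)"
    by (simp add: sum.distrib sum_subtractf sum_distrib_left)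
  then show ?thesis using * by (simp add: f_def s_def)
qed

text \<open>The defect in Bessel's inequality, equal to the squared L2 error of the partial sum
  \<open>ball_sum r n\<close>.\<close>

definition ball_err :: "real \<Rightarrow> nat \<Rightarrow> real" where
  "ball_err r n = ball_coeff r 0 - (\<Sum>l\<le>n. (ball_coeff r l)\<^sup>2 / zonal_norm2 l)"

lemma ball_err_eq:
  assumes "x \<in> Q"
  shows "(\<integral>y. (indicator {cos r<..} (t x y) - ball_sum r n (t x y))\<^sup>2 \<partial>\<mu>) = ball_err r n"
    "(\<integral>y. (indicator {cos r<..} (t y x) - ball_sum r n (t y x))\<^sup>2 \<partial>\<mu>) = ball_err r n"
proof -
  have "(\<integral>y. (indicator {cos r<..} (t x y) - ball_sum r n (t x y))\<^sup>2 \<partial>\<mu>) =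
     (\<integral>y. (indicator {cos r<..} (t p0 y) - ball_sum r n (t p0 y))\<^sup>2 \<partial>\<mu>)"
    unfolding ball_sum_def by (rule integral_base_point[OF assms]) measurable
  also have "\<dots> = ball_err r n"
    unfolding ball_sum_def ball_L2_distance ball_err_def by simp
  finally show 1: "(\<integral>y. (indicator {cos r<..} (t x y) - ball_sum r n (t x y))\<^sup>2 \<partial>\<mu>) = ball_err r n" .
  then show "(\<integral>y. (indicator {cos r<..} (t y x) - ball_sum r n (t y x))\<^sup>2 \<partial>\<mu>) = ball_err r n"
    using integral_sym[OF assms, of "\<lambda>z. (indicator {cos r<..} z - ball_sum r n z)\<^sup>2"] by simp
qed

lemma ball_err_nonneg: "ball_err r n \<ge> 0"
  unfolding ball_err_eq(1)[OF p0_in, symmetric] by simp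

lemma ball_err_antimono: "m \<le> n \<Longrightarrow> ball_err r n \<le> ball_err r m"
  unfolding ball_err_def using zonal_norm2_pos
  by (intro diff_left_mono sum_mono2) (auto intro!: divide_nonneg_nonneg simp: less_imp_le)

lemma ball_err_le:
  "ball_err r (degree p) \<le> (\<integral>y. (indicator {cos r<..} (t p0 y) - poly p (t p0 y))\<^sup>2 \<partial>\<mu>)"
proof -
  obtain c where p: "p = (\<Sum>l\<le>degree p. smult (c l) (P l))"
    using jacobi_poly_span[OF param_bounds order_refl] by blast
  have pz: "poly p z = (\<Sum>l\<le>degree p. c l * poly (P l) z)" for z
    by (subst p) (simp add: poly_sum)
  show ?thesis unfolding pz ball_L2_distance ball_err_def using zonal_norm2_pos
    by (auto intro!: sum_nonneg mult_nonneg_nonneg simp: less_imp_le)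
qed

text \<open>The error at the degree of a polynomial is at most the error of that polynomial, and
  bounded pointwise approximants make the latter small; the majorant 9 is (1 + 2)^2. Monotonicity of
  the error then covers all later indices.\<close>

lemma ball_err_tendsto_0: "ball_err r \<longlonglongrightarrow> 0"
proof -
  obtain p where p: "\<And>n z. z \<in> {-1..1} \<Longrightarrow> \<bar>poly (p n) z\<bar> \<le> 2"
    "\<And>z. z \<in> {-1..1} \<Longrightarrow> (\<lambda>n. poly (p n) z) \<longlonglongrightarrow> indicator {cos r<..} z"
    using greaterThan_indicator_poly_approx by blast
  have L: "(\<lambda>n. \<integral>y. (indicator {cos r<..} (t p0 y) - poly (p n) (t p0 y))\<^sup>2 \<partial>\<mu>) \<longlonglongrightarrow> (\<integral>y. 0 \<partial>\<mu>)"
  proof (rule integral_dominated_convergence[where w = "\<lambda>_. 9"])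
    show "(\<lambda>y. (indicator {cos r<..} (t p0 y) - poly (p n) (t p0 y))\<^sup>2) \<in> borel_measurable \<mu>" for n
      by (intro bounded_measurableD bounded_measurable_power bounded_measurable_diff bounded_measurable_ball
        bounded_measurable_poly bounded_measurable_t p0_in)
    show "AE y in \<mu>. (\<lambda>n. (indicator {cos r<..} (t p0 y) - poly (p n) (t p0 y))\<^sup>2) \<longlonglongrightarrow> 0"
    proof (rule AE_I2)
      fix y
      have "(\<lambda>n. (indicator {cos r<..} (t p0 y) - poly (p n) (t p0 y))\<^sup>2) \<longlonglongrightarrow>
        (indicator {cos r<..} (t p0 y) - indicator {cos r<..} (t p0 y))\<^sup>2"
        by (intro tendsto_intros p) simp
      then show "(\<lambda>n. (indicator {cos r<..} (t p0 y) - poly (p n) (t p0 y))\<^sup>2) \<longlonglongrightarrow> 0" by simp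
    qed
    show "AE y in \<mu>. norm ((indicator {cos r<..} (t p0 y) - poly (p n) (t p0 y))\<^sup>2) \<le> 9" for n
    proof (rule AE_I2)
      fix y
      have "\<bar>indicator {cos r<..} (t p0 y) - poly (p n) (t p0 y)\<bar> \<le> 3"
        using p(1)[of "t p0 y" n] by (auto split: split_indicator simp: abs_le_iff)
      then have "\<bar>indicator {cos r<..} (t p0 y) - poly (p n) (t p0 y)\<bar>\<^sup>2 \<le> 3\<^sup>2" by (rule power_mono) simp
      then show "norm ((indicator {cos r<..} (t p0 y) - poly (p n) (t p0 y))\<^sup>2) \<le> 9" by simp
    qed
  qed auto
  show ?thesis
  proof (rule LIMSEQ_I)
    fix e :: real assume "e > 0"
    then obtain n where "(\<integral>y. (indicator {cos r<..} (t p0 y) - poly (p n) (t p0 y))\<^sup>2 \<partial>\<mu>) < e"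
      using order_tendstoD(2)[OF L, of e] by (auto simp: eventually_sequentially)
    then have "ball_err r (degree (p n)) < e" using ball_err_le[of r "p n"] by linarith
    then show "\<exists>N. \<forall>m\<ge>N. norm (ball_err r m - 0) < e"
      using ball_err_antimono ball_err_nonneg
      by (intro exI[of _ "degree (p n)"]) (auto intro: le_less_trans)
  qed
qed

text \<open>L2 convergence of the two factors gives convergence of the convolution at every single
  pair of points: f g - u v = (f - u) g + (g - v) u, and by Cauchy-Schwarz each piece contributes at
  most the square root of the L2 error, since g and u have norm at most 1.\<close>

lemma ball_convolution_sums:
  assumes x: "x \<in> Q" and b: "b \<in> Q"
  shows "(\<lambda>l. (ball_coeff r l)\<^sup>2 / zonal_norm2 l * zonal l (t x b)) sums
    (\<integral>y. indicator {cos r<..} (t x y) * indicator {cos r<..} (t y b) \<partial>\<mu>)"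
proof -
  define J where "J = (\<integral>y. indicator {cos r<..} (t x y) * indicator {cos r<..} (t y b) \<partial>\<mu> :: real)"
  define f where "f y = (indicator {cos r<..} (t x y) :: real)" for y
  define g where "g y = (indicator {cos r<..} (t y b) :: real)" for y
  have fg: "bounded_measurable \<mu> f" "bounded_measurable \<mu> g"
    unfolding f_def g_def by (intro bounded_measurable_ball x b)+
  have bound: "\<bar>(\<Sum>l\<le>n. (ball_coeff r l)\<^sup>2 / zonal_norm2 l * zonal l (t x b)) - J\<bar> \<le> 2 * sqrt (ball_err r n)" for n
  proof -
    define u where "u y = ball_sum r n (t x y)" for y
    define v where "v y = ball_sum r n (t y b)" for y
    have uv: "bounded_measurable \<mu> u" "bounded_measurable \<mu> v"
      unfolding u_def v_def ball_sum_def
      by (intro bounded_measurable_sum bounded_measurable_mult bounded_measurable_const bounded_measurable_poly bounded_measurable_t x b)+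
    have uvI: "(\<integral>y. u y * v y \<partial>\<mu>) = (\<Sum>l\<le>n. (ball_coeff r l)\<^sup>2 / zonal_norm2 l * zonal l (t x b))"
      unfolding u_def v_def ball_sum_def integral_jacobi_sum_product[OF x b]
      using zonal_norm2_pos by (intro sum.cong) (auto simp: power_divide power2_eq_square less_imp_neq[symmetric])
    have u2: "(\<integral>y. (u y)\<^sup>2 \<partial>\<mu>) \<le> 1"
    proof -
      have "(\<integral>y. (u y)\<^sup>2 \<partial>\<mu>) = (\<integral>y. (ball_sum r n (t p0 y))\<^sup>2 \<partial>\<mu>)"
        unfolding u_def ball_sum_def by (rule integral_base_point[OF x]) measurable
      also have "\<dots> = (\<integral>y. (\<Sum>l\<le>n. ball_coeff r l / zonal_norm2 l * poly (P l) (t p0 y)) * (\<Sum>l\<le>n. ball_coeff r l / zonal_norm2 l * poly (P l) (t y p0)) \<partial>\<mu>)"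
        unfolding ball_sum_def power2_eq_square
        by (rule Bochner_Integration.integral_cong) (simp_all add: space_mu dist_sym[OF _ p0_in])
      also have "\<dots> = (\<Sum>l\<le>n. (ball_coeff r l)\<^sup>2 / zonal_norm2 l)"
        unfolding integral_jacobi_sum_product[OF p0_in p0_in]
        using zonal_norm2_pos by (intro sum.cong) (auto simp: power_divide power2_eq_square less_imp_neq[symmetric] t_self p0_in)
      also have "\<dots> \<le> 1" using ball_err_nonneg[of r n] ball_coeff_0_range(2)[of r] by (simp add: ball_err_def)
      finally show ?thesis .
    qed
    have g2: "(\<integral>y. (g y)\<^sup>2 \<partial>\<mu>) \<le> 1"
    proof -
      have "(\<integral>y. (g y)\<^sup>2 \<partial>\<mu>) \<le> (\<integral>y. 1 \<partial>\<mu>)"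
        by (intro integral_mono bounded_measurable_integrable bounded_measurable_power fg) (auto simp: g_def split: split_indicator)
      then show ?thesis using measure_Q by simp
    qed
    have e1: "(\<integral>y. (f y - u y)\<^sup>2 \<partial>\<mu>) = ball_err r n" unfolding f_def u_def by (rule ball_err_eq[OF x])
    have e2: "(\<integral>y. (g y - v y)\<^sup>2 \<partial>\<mu>) = ball_err r n" unfolding g_def v_def by (rule ball_err_eq[OF b])
    have cs: "\<bar>\<integral>y. p y * q y \<partial>\<mu>\<bar> \<le> sqrt (ball_err r n)"
      if "bounded_measurable \<mu> p" "bounded_measurable \<mu> q" "(\<integral>y. (p y)\<^sup>2 \<partial>\<mu>) = ball_err r n" "(\<integral>y. (q y)\<^sup>2 \<partial>\<mu>) \<le> 1" for p q
    proof -
      have "(\<integral>y. p y * q y \<partial>\<mu>)\<^sup>2 \<le> ball_err r n * (\<integral>y. (q y)\<^sup>2 \<partial>\<mu>)"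
        using Cauchy_Schwarz_integral[OF that(1,2)] that(3) by simp
      also have "\<dots> \<le> ball_err r n * 1" using that(4) ball_err_nonneg by (intro mult_left_mono) auto
      finally have "sqrt ((\<integral>y. p y * q y \<partial>\<mu>)\<^sup>2) \<le> sqrt (ball_err r n)" by (intro real_sqrt_le_mono) simp
      then show ?thesis by simp
    qed
    have "J = (\<integral>y. f y * g y \<partial>\<mu>)" by (simp add: J_def f_def g_def)
    also have "\<dots> = (\<integral>y. u y * v y + ((f y - u y) * g y + (g y - v y) * u y) \<partial>\<mu>)"
      by (rule Bochner_Integration.integral_cong) (auto simp: algebra_simps)
    also have "\<dots> = (\<integral>y. u y * v y \<partial>\<mu>) + ((\<integral>y. (f y - u y) * g y \<partial>\<mu>) + (\<integral>y. (g y - v y) * u y \<partial>\<mu>))"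
    proof -
      have "integrable \<mu> (\<lambda>y. u y * v y)" "integrable \<mu> (\<lambda>y. (f y - u y) * g y)" "integrable \<mu> (\<lambda>y. (g y - v y) * u y)"
        by (intro bounded_measurable_integrable bounded_measurable_mult bounded_measurable_diff fg uv)+
      then show ?thesis by simp
    qed
    finally have "(\<integral>y. u y * v y \<partial>\<mu>) - J = - ((\<integral>y. (f y - u y) * g y \<partial>\<mu>) + (\<integral>y. (g y - v y) * u y \<partial>\<mu>))" by simp
    moreover have "\<bar>\<integral>y. (f y - u y) * g y \<partial>\<mu>\<bar> \<le> sqrt (ball_err r n)"
      by (rule cs[OF bounded_measurable_diff[OF fg(1) uv(1)] fg(2) e1 g2])
    moreover have "\<bar>\<integral>y. (g y - v y) * u y \<partial>\<mu>\<bar> \<le> sqrt (ball_err r n)"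
      by (rule cs[OF bounded_measurable_diff[OF fg(2) uv(2)] uv(1) e2 u2])
    ultimately show ?thesis unfolding uvI by linarith
  qed
  have lim: "(\<lambda>n. 2 * sqrt (ball_err r n)) \<longlonglongrightarrow> 0"
  proof -
    have "(\<lambda>n. 2 * sqrt (ball_err r n)) \<longlonglongrightarrow> 2 * sqrt 0"
      by (intro tendsto_intros ball_err_tendsto_0)
    then show ?thesis by (simp only: real_sqrt_zero mult_zero_right)
  qed
  have "(\<lambda>n. (\<Sum>l\<le>n. (ball_coeff r l)\<^sup>2 / zonal_norm2 l * zonal l (t x b)) - J) \<longlonglongrightarrow> 0"
    by (rule Lim_null_comparison[OF _ lim]) (use bound in simp)
  then have "(\<lambda>n. \<Sum>l\<le>n. (ball_coeff r l)\<^sup>2 / zonal_norm2 l * zonal l (t x b)) \<longlonglongrightarrow> J" by (rule LIM_zero_cancel)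
  then show ?thesis unfolding sums_def_le J_def[symmetric] .
qed

text \<open>The sum of \<open>e\<close> dominates the partial sums, since the normalized polynomials
  are at most 1 in absolute value on Q, and each term has mean 0.\<close>

lemma integral_zonal_series:
  assumes e: "\<And>k. e k \<ge> 0" "summable e" and x: "x \<in> Q"
  shows "bounded_measurable \<mu> (\<lambda>y. \<Sum>k. e k * zonal (Suc k) (t x y))"
    "(\<integral>y. (\<Sum>k. e k * zonal (Suc k) (t x y)) \<partial>\<mu>) = 0"
proof -
  have le: "\<bar>e k * zonal (Suc k) (t x y)\<bar> \<le> e k" if "y \<in> Q" for k y
    using mult_left_mono[OF abs_zonal_le_1[OF x that, of "Suc k"] e(1)[of k]] e(1)[of k] by (simp add: abs_mult)
  have sm: "summable (\<lambda>k. \<bar>e k * zonal (Suc k) (t x y)\<bar>)" if "y \<in> Q" for y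
    by (rule summable_comparison_test[OF _ e(2)]) (use le[OF that] in auto)
  have lim: "(\<lambda>n. \<Sum>k<n. e k * zonal (Suc k) (t x y)) \<longlonglongrightarrow> (\<Sum>k. e k * zonal (Suc k) (t x y))" if "y \<in> Q" for y
    by (rule summable_LIMSEQ[OF summable_rabs_cancel[OF sm[OF that]]])
  have pm: "bounded_measurable \<mu> (\<lambda>y. zonal k (t x y))" for k
    unfolding zonal_def by (intro bounded_measurable_divide bounded_measurable_poly bounded_measurable_t x)
  have bm: "bounded_measurable \<mu> (\<lambda>y. \<Sum>k<n. e k * zonal (Suc k) (t x y))" for n
    by (intro bounded_measurable_sum bounded_measurable_mult bounded_measurable_const pm)
  have meas: "(\<lambda>y. \<Sum>k. e k * zonal (Suc k) (t x y)) \<in> borel_measurable \<mu>"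
    by (rule borel_measurable_LIMSEQ_real[OF lim bounded_measurableD[OF bm]]) (simp add: space_mu)
  show "bounded_measurable \<mu> (\<lambda>y. \<Sum>k. e k * zonal (Suc k) (t x y))"
  proof (rule bounded_measurableI[OF meas])
    fix y assume "y \<in> space \<mu>"
    then have y: "y \<in> Q" by (simp add: space_mu)
    have "\<bar>\<Sum>k. e k * zonal (Suc k) (t x y)\<bar> \<le> (\<Sum>k. \<bar>e k * zonal (Suc k) (t x y)\<bar>)" by (rule summable_rabs[OF sm[OF y]])
    also have "\<dots> \<le> suminf e" by (rule suminf_le[OF le[OF y] sm[OF y] e(2)])
    finally show "\<bar>\<Sum>k. e k * zonal (Suc k) (t x y)\<bar> \<le> suminf e" .
  qed
  have "(\<lambda>n. \<integral>y. (\<Sum>k<n. e k * zonal (Suc k) (t x y)) \<partial>\<mu>) \<longlonglongrightarrow> (\<integral>y. (\<Sum>k. e k * zonal (Suc k) (t x y)) \<partial>\<mu>)"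
  proof (rule integral_dominated_convergence[where w = "\<lambda>_. suminf e"])
    show "AE y in \<mu>. norm (\<Sum>k<n. e k * zonal (Suc k) (t x y)) \<le> suminf e" for n
    proof (rule AE_I2)
      fix y assume "y \<in> space \<mu>"
      then have y: "y \<in> Q" by (simp add: space_mu)
      have "norm (\<Sum>k<n. e k * zonal (Suc k) (t x y)) \<le> (\<Sum>k<n. e k)"
        using le[OF y] by (intro sum_norm_le) simp
      also have "\<dots> \<le> suminf e" using e by (intro sum_le_suminf) auto
      finally show "norm (\<Sum>k<n. e k * zonal (Suc k) (t x y)) \<le> suminf e" .
    qed
  qed (use lim meas bounded_measurableD[OF bm] in \<open>auto simp: space_mu\<close>)
  moreover have "(\<integral>y. (\<Sum>k<n. e k * zonal (Suc k) (t x y)) \<partial>\<mu>) = 0" for n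
  proof -
    have "(\<integral>y. zonal (Suc k) (t x y) \<partial>\<mu>) = 0" for k
      using integral_P[OF x, of "Suc k"] by (simp add: zonal_def)
    then show ?thesis by (simp add: bounded_measurable_integrable[OF pm])
  qed
  ultimately show "(\<integral>y. (\<Sum>k. e k * zonal (Suc k) (t x y)) \<partial>\<mu>) = 0"
    using LIMSEQ_unique[OF _ tendsto_const] by auto
qed

text \<open>Stated for an arbitrary kernel \<rho> so as to serve both the metric of a fixed radius
  and the weighted one.\<close>

lemma average_zonal:
  assumes e: "\<And>k. e k \<ge> 0" "summable e"
    and \<rho>: "\<And>x y. x \<in> Q \<Longrightarrow> y \<in> Q \<Longrightarrow> \<rho> x y = v - (\<Sum>k. e k * zonal (Suc k) (t x y))"
  shows "average \<mu> \<rho> = v"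
proof -
  have "(\<integral>y. \<rho> x y \<partial>\<mu>) = v" if "x \<in> space \<mu>" for x
  proof -
    have x: "x \<in> Q" using that by (simp add: space_mu)
    have "(\<integral>y. \<rho> x y \<partial>\<mu>) = (\<integral>y. v - (\<Sum>k. e k * zonal (Suc k) (t x y)) \<partial>\<mu>)"
      by (rule Bochner_Integration.integral_cong) (auto simp: \<rho> x space_mu)
    also have "\<dots> = v"
      by (subst Bochner_Integration.integral_diff)
        (auto simp: integral_zonal_series[OF e x] measure_Q intro: bounded_measurable_integrable)
    finally show ?thesis .
  qed
  then have "average \<mu> \<rho> = (\<integral>x. v \<partial>\<mu>)"
    unfolding average_def by (rule Bochner_Integration.integral_cong[OF refl])
  then show ?thesis by (simp add: measure_Q)
qed

section \<open>Kernels and metrics of balls of a fixed radius\<close>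

definition ball_measure :: "real \<Rightarrow> real" where "ball_measure r = ball_coeff r 0"

lemma mem_metric_ball:
  assumes "x \<in> Q" "y \<in> Q" "r \<in> {0..pi}"
  shows "x \<in> metric_ball Q \<theta> y r \<longleftrightarrow> t x y \<in> {cos r<..}"
  using assms dist_range[OF assms(1,2)] cos_mono_less_eq[of r "\<theta> x y"] by (auto simp: metric_ball_def)

lemma indicator_metric_ball:
  assumes "x \<in> Q" "y \<in> Q" "r \<in> {0..pi}"
  shows "indicator (metric_ball Q \<theta> y r) x = indicator {cos r<..} (t x y)"
  using mem_metric_ball[OF assms] by (simp add: indicator_def)

lemma metric_ball_sets [measurable]:
  assumes "y \<in> Q" "r \<in> {0..pi}"
  shows "metric_ball Q \<theta> y r \<in> sets \<mu>"
proof -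
  have "metric_ball Q \<theta> y r = (\<lambda>x. t x y) -` {cos r<..} \<inter> space \<mu>"
    using mem_metric_ball[OF _ assms] by (auto simp: space_mu metric_ball_def)
  then show ?thesis using measurable_sets[OF measurable_t(1)[OF assms(1)], of "{cos r<..}"] by simp
qed

lemma measure_metric_ball:
  assumes "y \<in> Q" "r \<in> {0..pi}"
  shows "measure \<mu> (metric_ball Q \<theta> y r) = ball_measure r"
proof -
  have "measure \<mu> (metric_ball Q \<theta> y r) = (\<integral>x. indicator (metric_ball Q \<theta> y r) x \<partial>\<mu>)"
    by (simp add: metric_ball_sets[OF assms])
  also have "\<dots> = (\<integral>x. indicator {cos r<..} (t x y) \<partial>\<mu>)"
    by (rule Bochner_Integration.integral_cong[OF refl], rule indicator_metric_ball) (use assms in \<open>auto simp: space_mu\<close>)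
  also have "\<dots> = (\<integral>x. indicator {cos r<..} (t y x) \<partial>\<mu>)"
    by (rule integral_sym[OF assms(1)])
  also have "\<dots> = ball_measure r"
    using ball_coeff_eq[OF assms(1), of r 0] by (simp add: ball_measure_def)
  finally show ?thesis .
qed

lemma integral_ball_indicator:
  assumes "x \<in> Q"
  shows "(\<integral>y. indicator {cos r<..} (t x y) \<partial>\<mu>) = ball_measure r"
    "(\<integral>y. indicator {cos r<..} (t y x) \<partial>\<mu>) = ball_measure r"
  using ball_coeff_eq[OF assms, of r 0] integral_sym[OF assms, of "indicator {cos r<..}"] by (simp_all add: ball_measure_def)

definition ball_kernel :: "real \<Rightarrow> 'a \<Rightarrow> 'a \<Rightarrow> real" where
  "ball_kernel r x b = (\<integral>y. indicator {cos r<..} (t x y) * indicator {cos r<..} (t y b) \<partial>\<mu>)"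

lemma lam_eq:
  assumes "x \<in> Q" "b \<in> Q" "r \<in> {0..pi}"
  shows "lam Q \<theta> \<mu> r x b = ball_kernel r x b - (ball_measure r)\<^sup>2"
proof -
  let ?v = "ball_measure r"
  let ?f = "\<lambda>y. indicator {cos r<..} (t x y) :: real" and ?g = "\<lambda>y. indicator {cos r<..} (t y b) :: real"
  have i: "integrable \<mu> ?f" "integrable \<mu> ?g" "integrable \<mu> (\<lambda>y. ?f y * ?g y)"
    by (intro bounded_measurable_integrable bounded_measurable_mult bounded_measurable_ball assms)+
  have "lam Q \<theta> \<mu> r x b = (\<integral>y. (?f y * ?g y - ?v * ?f y) - (?v * ?g y - ?v\<^sup>2) \<partial>\<mu>)"
    unfolding lam_def
  proof (rule Bochner_Integration.integral_cong[OF refl])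
    fix y assume "y \<in> space \<mu>"
    then have y: "y \<in> Q" by (simp add: space_mu)
    show "\<Lambda> \<mu> (metric_ball Q \<theta> y r) x * \<Lambda> \<mu> (metric_ball Q \<theta> y r) b =
      (?f y * ?g y - ?v * ?f y) - (?v * ?g y - ?v\<^sup>2)"
      unfolding \<Lambda>_def measure_metric_ball[OF y assms(3)] indicator_metric_ball[OF assms(1) y assms(3)]
        indicator_metric_ball[OF assms(2) y assms(3)] dist_sym[OF assms(2) y]
      by (simp add: algebra_simps power2_eq_square)
  qed
  also have "\<dots> = ball_kernel r x b - ?v\<^sup>2"
    using i by (simp add: integral_ball_indicator assms measure_Q ball_kernel_def power2_eq_square)
  finally show ?thesis .
qed

text \<open>The indicator of a symmetric difference is f + g - 2 f g. By symmetry of the distance,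
  integrating over the centre as in \<open>lam\<close> and over the points of the balls as here
  produces the same integrals.\<close>

lemma symdiff_metric_eq:
  assumes "x \<in> Q" "b \<in> Q" "r \<in> {0..pi}"
  shows "symdiff_metric Q \<theta> \<mu> r x b = ball_measure r * (1 - ball_measure r) - lam Q \<theta> \<mu> r x b"
proof -
  let ?v = "ball_measure r"
  let ?f = "\<lambda>y. indicator {cos r<..} (t x y) :: real" and ?g = "\<lambda>y. indicator {cos r<..} (t y b) :: real"
  let ?S = "sym_diff (metric_ball Q \<theta> x r) (metric_ball Q \<theta> b r)"
  have i: "integrable \<mu> ?f" "integrable \<mu> ?g" "integrable \<mu> (\<lambda>y. ?f y * ?g y)"
    by (intro bounded_measurable_integrable bounded_measurable_mult bounded_measurable_ball assms)+
  have "?S \<in> sets \<mu>" by (intro sets.Un sets.Diff metric_ball_sets assms)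
  then have "measure \<mu> ?S = (\<integral>y. indicator ?S y \<partial>\<mu>)" by simp
  also have "\<dots> = (\<integral>y. ?f y + ?g y - 2 * (?f y * ?g y) \<partial>\<mu>)"
  proof (rule Bochner_Integration.integral_cong[OF refl])
    fix y assume "y \<in> space \<mu>"
    then have y: "y \<in> Q" by (simp add: space_mu)
    show "indicator ?S y = ?f y + ?g y - 2 * (?f y * ?g y)"
      using indicator_metric_ball[OF y assms(1,3), where 'b = real] indicator_metric_ball[OF y assms(2,3), where 'b = real]
      unfolding dist_sym[OF assms(1) y] by (auto simp: indicator_def split: if_splits)
  qed
  also have "\<dots> = 2 * ?v - 2 * ball_kernel r x b"
    using i by (simp add: integral_ball_indicator assms ball_kernel_def)
  finally show ?thesis unfolding lam_eq[OF assms] symdiff_metric_def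
    by (simp add: algebra_simps power2_eq_square)
qed

definition series_coeff :: "real \<Rightarrow> nat \<Rightarrow> real" where
  "series_coeff r k = 1 / (real (Suc k))\<^sup>2 * jacobi_M \<alpha> \<beta> (Suc k) * coeff_a d d0 (Suc k) r"

lemma series_coeff_nonneg: "series_coeff r k \<ge> 0"
proof -
  have "jacobi_M \<alpha> \<beta> (Suc k) \<ge> 0"
    using zonal_norm2_jacobi_M[of "Suc k"] zonal_norm2_pos[of "Suc k"] K_pos by (smt (verit) mult_pos_neg le_add1 plus_1_eq_Suc)
  moreover have "coeff_a d d0 (Suc k) r \<ge> 0"
    by (simp add: coeff_a_def power_mult)
  ultimately show ?thesis by (simp add: series_coeff_def)
qed

lemma lam_sums:
  assumes "x \<in> Q" "b \<in> Q" "r \<in> {0..pi}"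
  shows "(\<lambda>k. K * series_coeff r k * zonal (Suc k) (t x b)) sums lam Q \<theta> \<mu> r x b"
proof -
  have "(\<lambda>l. (ball_coeff r l)\<^sup>2 / zonal_norm2 l * zonal l (t x b)) sums ball_kernel r x b"
    using ball_convolution_sums[OF assms(1,2)] by (simp add: ball_kernel_def)
  \<comment> \<open>The term of index 0 is v_r^2 and cancels the square subtracted in
    \<open>lam_eq\<close>.\<close>
  then have "(\<lambda>k. (ball_coeff r (Suc k))\<^sup>2 / zonal_norm2 (Suc k) * zonal (Suc k) (t x b)) sums (ball_kernel r x b - (ball_measure r)\<^sup>2)"
    using sums_Suc_iff[of "\<lambda>l. (ball_coeff r l)\<^sup>2 / zonal_norm2 l * zonal l (t x b)" "ball_kernel r x b - (ball_measure r)\<^sup>2"]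
    by (simp add: zonal_norm2_0 ball_measure_def)
  then show ?thesis
    unfolding ball_coeff_Suc[OF assms(3)] lam_eq[OF assms] series_coeff_def by (simp only: mult.assoc)
qed

lemma symdiff_metric_self: "symdiff_metric Q \<theta> \<mu> r x x = 0"
  by (simp add: symdiff_metric_def)

text \<open>The diagonal case of \<open>lam_sums\<close>: the normalized polynomials are 1 there and
  the symmetric difference is empty.\<close>

lemma series_coeff_sums:
  assumes "r \<in> {0..pi}"
  shows "(\<lambda>k. K * series_coeff r k) sums (ball_measure r * (1 - ball_measure r))"
  using lam_sums[OF p0_in p0_in assms] symdiff_metric_eq[OF p0_in p0_in assms] symdiff_metric_self[of r p0]
  by (simp add: t_self p0_in)

lemma average_symdiff_metric:
  assumes "r \<in> {0..pi}"
  shows "average \<mu> (symdiff_metric Q \<theta> \<mu> r) = ball_measure r * (1 - ball_measure r)"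
proof (rule average_zonal)
  show "K * series_coeff r k \<ge> 0" for k using K_pos series_coeff_nonneg[of r k] by simp
  show "summable (\<lambda>k. K * series_coeff r k)" using series_coeff_sums[OF assms] by (rule sums_summable)
  fix x y assume "x \<in> Q" "y \<in> Q"
  then show "symdiff_metric Q \<theta> \<mu> r x y = ball_measure r * (1 - ball_measure r) - (\<Sum>k. K * series_coeff r k * zonal (Suc k) (t x y))"
    using lam_sums[OF _ _ assms] symdiff_metric_eq[OF _ _ assms] by (simp add: sums_iff)
qed

lemma ball_measure_bounds: "0 \<le> ball_measure r" "ball_measure r \<le> 1"
  using ball_coeff_0_range by (auto simp: ball_measure_def)

lemma ball_measure_integral: "r \<in> {0..pi} \<Longrightarrow> ball_measure r = K * integral {0..r} W"
  by (simp add: ball_measure_def ball_coeff_0)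

text \<open>On [0, r] the sine of s/2 is at most that of r/2, on [r, pi] the cosine of s/2 is at
  most that of r/2, and the respective other factor is at most 1. So v_r is controlled by the power
  of the sine and 1 - v_r by that of the cosine, and their product reproduces the weight that
  defines W(d, d0).\<close>

lemma ball_measure_prod_le:
  assumes r: "r \<in> {0..pi}"
  shows "ball_measure r * (1 - ball_measure r) \<le> (K * pi)\<^sup>2 * W r"
proof -
  have Wi: "W integrable_on {a..b}" for a b
    by (intro integrable_continuous_real continuous_on_angular_weight continuous_intros)
  have 1: "ball_measure r \<le> K * (pi * sin (r / 2) ^ (d - 1))"
  proof -
    have "integral {0..r} W \<le> integral {0..r} (\<lambda>s. sin (r / 2) ^ (d - 1))"
    proof (rule integral_le[OF Wi])
      fix s assume s: "s \<in> {0..r}"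
      then have "sin (s / 2) \<le> sin (r / 2)" using r by (intro sin_monotone_2pi_le) auto
      moreover have "sin (s / 2) \<ge> 0" using s r by (intro sin_ge_zero) auto
      moreover have "cos (s / 2) \<ge> 0" using s r by (intro cos_ge_zero) auto
      ultimately have "sin (s / 2) ^ (d - 1) * cos (s / 2) ^ (d0 - 1) \<le> sin (r / 2) ^ (d - 1) * 1"
        by (intro mult_mono power_mono power_le_one zero_le_power) auto
      then show "W s \<le> sin (r / 2) ^ (d - 1)" by (simp add: angular_weight_def)
    qed auto
    also have "\<dots> = r * sin (r / 2) ^ (d - 1)" using r by simp
    also have "\<dots> \<le> pi * sin (r / 2) ^ (d - 1)"
      using r sin_half_nonneg[OF r] by (intro mult_right_mono) auto
    finally show ?thesis unfolding ball_measure_integral[OF r] using K_pos by (intro mult_left_mono) auto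
  qed
  have 2: "1 - ball_measure r \<le> K * (pi * cos (r / 2) ^ (d0 - 1))"
  proof -
    have "integral {0..r} W + integral {r..pi} W = sin_cos_integral d d0"
      unfolding sin_cos_integral_def using r Wi by (intro Henstock_Kurzweil_Integration.integral_combine) auto
    then have "1 - ball_measure r = K * integral {r..pi} W"
      using K_normalizes unfolding ball_measure_integral[OF r] by (metis add_diff_cancel_left' distrib_left)
    moreover have "integral {r..pi} W \<le> integral {r..pi} (\<lambda>s. cos (r / 2) ^ (d0 - 1))"
    proof (rule integral_le[OF Wi])
      fix s assume s: "s \<in> {r..pi}"
      then have "cos (s / 2) \<le> cos (r / 2)" using r by (intro cos_monotone_0_pi_le) auto
      moreover have "sin (s / 2) \<ge> 0" using s r by (intro sin_ge_zero) auto
      moreover have "cos (s / 2) \<ge> 0" using s r by (intro cos_ge_zero) auto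
      ultimately have "sin (s / 2) ^ (d - 1) * cos (s / 2) ^ (d0 - 1) \<le> 1 * cos (r / 2) ^ (d0 - 1)"
        by (intro mult_mono power_mono power_le_one zero_le_power) auto
      then show "W s \<le> cos (r / 2) ^ (d0 - 1)" by (simp add: angular_weight_def)
    qed auto
    moreover have "integral {r..pi} (\<lambda>s. cos (r / 2) ^ (d0 - 1)) \<le> pi * cos (r / 2) ^ (d0 - 1)"
      using r cos_half_nonneg[OF r] by (simp add: mult_right_mono)
    ultimately show ?thesis using K_pos by (simp add: mult_left_mono)
  qed
  have "ball_measure r * (1 - ball_measure r) \<le> (K * (pi * sin (r / 2) ^ (d - 1))) * (K * (pi * cos (r / 2) ^ (d0 - 1)))"
    using 1 2 ball_measure_bounds[of r] by (intro mult_mono) (auto intro: order_trans)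
  then show ?thesis by (simp add: angular_weight_def power2_eq_square mult_ac)
qed

section \<open>Weighted radii\<close>

lemma ball_measure_continuous: "continuous_on {0..pi} (\<lambda>r. ball_measure r * (1 - ball_measure r))"
proof -
  have "continuous_on {0..pi} (\<lambda>r. K * integral {0..r} W)"
    by (intro continuous_on_mult continuous_on_const indefinite_integral_continuous_1
      integrable_continuous_real continuous_on_angular_weight continuous_on_id)
  then have "continuous_on {0..pi} ball_measure"
    by (rule continuous_on_cong[THEN iffD1, rotated -1]) (auto simp: ball_measure_integral)
  then show ?thesis by (intro continuous_intros)
qed

lemma continuous_series_coeff: "continuous_on S (\<lambda>r. series_coeff r k)"
  unfolding series_coeff_def coeff_a_def by (intro continuous_intros) auto

definition weighted_coeff :: "(real \<Rightarrow> real) \<Rightarrow> nat \<Rightarrow> real" where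
  "weighted_coeff \<eta> k = 1 / (real (Suc k))\<^sup>2 * jacobi_M \<alpha> \<beta> (Suc k) * coeff_A d d0 (Suc k) \<eta>"

context
  fixes \<eta> :: "real \<Rightarrow> real"
  assumes \<eta>: "\<eta> \<in> weight_class d d0"
begin

lemma eta_nonneg: "r \<in> {0..pi} \<Longrightarrow> \<eta> r \<ge> 0"
  using \<eta> by (auto simp: weight_class_def)

text \<open>\<eta> is known to be measurable only in the sense of Lebesgue and only on the interval,
  so both factors are cut off to the interval before being multiplied.\<close>

lemma measurable_mult_eta:
  assumes "continuous_on {0..pi} h"
  shows "set_borel_measurable lebesgue {0..pi} (\<lambda>r. h r * \<eta> r)"
proof -
  have 1: "(\<lambda>r. indicator {0..pi} r *\<^sub>R h r) \<in> borel_measurable lebesgue"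
  proof -
    have "(\<lambda>r. indicator {0..pi} r *\<^sub>R h r) \<in> borel_measurable lborel"
      using borel_measurable_continuous_on_indicator[OF _ assms] by simp
    then show ?thesis by (rule measurable_completion)
  qed
  have 2: "(\<lambda>r. indicator {0..pi} r *\<^sub>R \<eta> r) \<in> borel_measurable lebesgue"
    using \<eta> by (auto simp: weight_class_def set_borel_measurable_def)
  have "(\<lambda>r. (indicator {0..pi} r *\<^sub>R h r) * (indicator {0..pi} r *\<^sub>R \<eta> r)) \<in> borel_measurable lebesgue"
    using 1 2 by (rule borel_measurable_times)
  moreover have "(\<lambda>r. (indicator {0..pi} r *\<^sub>R h r) * (indicator {0..pi} r *\<^sub>R \<eta> r)) = (\<lambda>r. indicator {0..pi} r *\<^sub>R (h r * \<eta> r))"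
    by (auto simp: indicator_def)
  ultimately show ?thesis by (simp add: set_borel_measurable_def)
qed

lemma W_eta_integrable: "set_integrable lebesgue {0..pi} (\<lambda>r. W r * \<eta> r)"
  unfolding set_integrable_def
proof (rule integrableI_bounded)
  show "(\<lambda>r. indicat_real {0..pi} r *\<^sub>R (W r * \<eta> r)) \<in> borel_measurable lebesgue"
    using measurable_mult_eta[of W] by (simp add: set_borel_measurable_def continuous_on_angular_weight)
  have "(\<integral>\<^sup>+ r. ennreal (norm (indicat_real {0..pi} r *\<^sub>R (W r * \<eta> r))) \<partial>lebesgue) =
    (\<integral>\<^sup>+r\<in>{0..pi}. ennreal (sin (r / 2) ^ (d - 1) * cos (r / 2) ^ (d0 - 1) * \<eta> r) \<partial>lebesgue)"
    by (rule nn_integral_cong)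
      (use angular_weight_nonneg eta_nonneg in \<open>auto simp: indicator_def angular_weight_def\<close>)
  also have "\<dots> < \<infinity>" using \<eta> by (simp add: weight_class_def)
  finally show "(\<integral>\<^sup>+ r. ennreal (norm (indicat_real {0..pi} r *\<^sub>R (W r * \<eta> r))) \<partial>lebesgue) < \<infinity>" .
qed

text \<open>This is where membership of \<eta> in the weight class is converted into an integrable
  majorant for all later limits.\<close>

lemma variance_eta_integrable: "set_integrable lebesgue {0..pi} (\<lambda>r. (ball_measure r * (1 - ball_measure r)) * \<eta> r)"
  unfolding set_integrable_def
proof (rule Bochner_Integration.integrable_bound)
  show "integrable lebesgue (\<lambda>r. (K * pi)\<^sup>2 * (indicator {0..pi} r *\<^sub>R (W r * \<eta> r)))"
    using W_eta_integrable by (simp add: set_integrable_def)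
  show "(\<lambda>r. indicat_real {0..pi} r *\<^sub>R (ball_measure r * (1 - ball_measure r) * \<eta> r)) \<in> borel_measurable lebesgue"
    using measurable_mult_eta[OF ball_measure_continuous] by (simp add: set_borel_measurable_def)
  show "AE r in lebesgue. norm (indicat_real {0..pi} r *\<^sub>R (ball_measure r * (1 - ball_measure r) * \<eta> r))
      \<le> norm ((K * pi)\<^sup>2 * (indicator {0..pi} r *\<^sub>R (W r * \<eta> r)))"
  proof (rule AE_I2)
    fix r
    show "norm (indicat_real {0..pi} r *\<^sub>R (ball_measure r * (1 - ball_measure r) * \<eta> r))
      \<le> norm ((K * pi)\<^sup>2 * (indicator {0..pi} r *\<^sub>R (W r * \<eta> r)))"
    proof (cases "r \<in> {0..pi}")
      case True
      have "0 \<le> ball_measure r * (1 - ball_measure r) * \<eta> r"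
        using ball_measure_bounds[of r] eta_nonneg[OF True] by (intro mult_nonneg_nonneg) auto
      moreover have "ball_measure r * (1 - ball_measure r) * \<eta> r \<le> (K * pi)\<^sup>2 * W r * \<eta> r"
        using ball_measure_prod_le[OF True] eta_nonneg[OF True] by (intro mult_right_mono)
      ultimately show ?thesis using True by (simp add: abs_of_nonneg mult.assoc)
    qed simp
  qed
qed

lemma series_coeff_le:
  assumes "r \<in> {0..pi}"
  shows "(\<Sum>k<n. K * series_coeff r k) \<le> ball_measure r * (1 - ball_measure r)"
  using series_coeff_sums[OF assms] K_pos series_coeff_nonneg
  by (metis (no_types, lifting) sum_le_suminf finite_lessThan less_imp_le mult_nonneg_nonneg sums_iff)

lemma series_coeff_eta_integrable: "set_integrable lebesgue {0..pi} (\<lambda>r. K * series_coeff r k * \<eta> r)"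
  unfolding set_integrable_def
proof (rule Bochner_Integration.integrable_bound[OF variance_eta_integrable[unfolded set_integrable_def]])
  show "(\<lambda>r. indicat_real {0..pi} r *\<^sub>R (K * series_coeff r k * \<eta> r)) \<in> borel_measurable lebesgue"
    using measurable_mult_eta[OF continuous_on_mult[OF continuous_on_const continuous_series_coeff], of K k]
    by (simp add: set_borel_measurable_def)
  show "AE r in lebesgue. norm (indicat_real {0..pi} r *\<^sub>R (K * series_coeff r k * \<eta> r))
      \<le> norm (indicat_real {0..pi} r *\<^sub>R (ball_measure r * (1 - ball_measure r) * \<eta> r))"
  proof (rule AE_I2)
    fix r
    show "norm (indicat_real {0..pi} r *\<^sub>R (K * series_coeff r k * \<eta> r))
      \<le> norm (indicat_real {0..pi} r *\<^sub>R (ball_measure r * (1 - ball_measure r) * \<eta> r))"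
    proof (cases "r \<in> {0..pi}")
      case True
      have n: "0 \<le> K * series_coeff r k" for k using K_pos series_coeff_nonneg by simp
      have "K * series_coeff r k \<le> (\<Sum>k<Suc k. K * series_coeff r k)"
        using n by (simp add: sum_nonneg)
      also have "\<dots> \<le> ball_measure r * (1 - ball_measure r)" by (rule series_coeff_le[OF True])
      finally have "K * series_coeff r k * \<eta> r \<le> ball_measure r * (1 - ball_measure r) * \<eta> r"
        using eta_nonneg[OF True] by (rule mult_right_mono)
      moreover have "0 \<le> K * series_coeff r k * \<eta> r"
        by (rule mult_nonneg_nonneg[OF n eta_nonneg[OF True]])
      ultimately show ?thesis using True by (simp add: abs_of_nonneg)
    qed simp
  qed
qed

lemma integral_series_coeff_eta:
  "(LINT r:{0..pi}|lebesgue. K * series_coeff r k * \<eta> r) = K * weighted_coeff \<eta> k"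
proof -
  have "(LINT r:{0..pi}|lebesgue. K * series_coeff r k * \<eta> r) =
    (LINT r:{0..pi}|lebesgue. (K * (1 / (real (Suc k))\<^sup>2 * jacobi_M \<alpha> \<beta> (Suc k))) * (\<eta> r * coeff_a d d0 (Suc k) r))"
    by (simp only: series_coeff_def mult_ac)
  then show ?thesis
    unfolding set_integral_mult_right by (simp only: weighted_coeff_def coeff_A_def mult.assoc)
qed

lemma weighted_coeff_nonneg: "K * weighted_coeff \<eta> k \<ge> 0"
  unfolding integral_series_coeff_eta[symmetric] set_lebesgue_integral_def
  using K_pos series_coeff_nonneg eta_nonneg
  by (intro Bochner_Integration.integral_nonneg) (auto simp: indicator_def)

text \<open>The partial sums are dominated by v_r (1 - v_r) \<eta>(r): the coefficients are
  nonnegative with sum v_r (1 - v_r), and the normalized polynomials are at most 1 in absolute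
  value. That the kernel times \<eta> is measurable in the radius is obtained on the way, as a limit
  of partial sums.\<close>

lemma lam_weighted_sums:
  assumes x: "x \<in> Q" and b: "b \<in> Q"
  shows "(\<lambda>k. K * weighted_coeff \<eta> k * zonal (Suc k) (t x b)) sums lam_weighted Q \<theta> \<mu> \<eta> x b"
    "set_integrable lebesgue {0..pi} (\<lambda>r. lam Q \<theta> \<mu> r x b * \<eta> r)"
proof -
  let ?s = "\<lambda>n r. \<Sum>k<n. zonal (Suc k) (t x b) * (indicator {0..pi} r *\<^sub>R (K * series_coeff r k * \<eta> r))"
  let ?D = "\<lambda>r. indicator {0..pi} r *\<^sub>R (ball_measure r * (1 - ball_measure r) * \<eta> r)"
  let ?l = "\<lambda>r. indicator {0..pi} r *\<^sub>R (lam Q \<theta> \<mu> r x b * \<eta> r)"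
  have si: "integrable lebesgue (\<lambda>r. indicator {0..pi} r *\<^sub>R (K * series_coeff r k * \<eta> r))" for k
    using series_coeff_eta_integrable[of k] by (simp add: set_integrable_def)
  have seq: "?s n r = indicator {0..pi} r * ((\<Sum>k<n. K * series_coeff r k * zonal (Suc k) (t x b)) * \<eta> r)" for n r
    by (simp add: sum_distrib_left sum_distrib_right mult_ac)
  have lim: "(\<lambda>n. ?s n r) \<longlonglongrightarrow> ?l r" for r
  proof (cases "r \<in> {0..pi}")
    case True
    have "(\<lambda>n. (\<Sum>k<n. K * series_coeff r k * zonal (Suc k) (t x b)) * \<eta> r) \<longlonglongrightarrow> lam Q \<theta> \<mu> r x b * \<eta> r"
      using lam_sums[OF x b True] unfolding sums_def by (rule tendsto_mult_right)
    then show ?thesis using True unfolding seq by simp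
  qed simp
  have meas: "?s n \<in> borel_measurable lebesgue" for n
    using si by (intro borel_measurable_sum borel_measurable_times borel_measurable_const) (auto dest: borel_measurable_integrable)
  have lmeas: "?l \<in> borel_measurable lebesgue"
    by (rule borel_measurable_LIMSEQ_real[OF lim meas])
  have bound: "norm (?s n r) \<le> ?D r" for n r
  proof (cases "r \<in> {0..pi}")
    case True
    have "norm (?s n r) = \<bar>\<Sum>k<n. K * series_coeff r k * zonal (Suc k) (t x b)\<bar> * \<eta> r"
      unfolding seq using True eta_nonneg[OF True] by (simp add: abs_mult)
    also have "\<bar>\<Sum>k<n. K * series_coeff r k * zonal (Suc k) (t x b)\<bar> \<le> (\<Sum>k<n. K * series_coeff r k)"
    proof (rule order_trans[OF sum_abs sum_mono])
      fix k
      have "0 \<le> K * series_coeff r k" using K_pos series_coeff_nonneg by simp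
      then show "\<bar>K * series_coeff r k * zonal (Suc k) (t x b)\<bar> \<le> K * series_coeff r k"
        using mult_left_mono[OF abs_zonal_le_1[OF x b, of "Suc k"], of "K * series_coeff r k"]
        by (simp only: abs_mult[of "K * series_coeff r k"] abs_of_nonneg mult_1_right)
    qed
    also have "\<dots> \<le> ball_measure r * (1 - ball_measure r)" by (rule series_coeff_le[OF True])
    finally show ?thesis using True eta_nonneg[OF True] by (simp add: mult_right_mono)
  qed simp
  have D: "integrable lebesgue ?D" using variance_eta_integrable by (simp add: set_integrable_def)
  have "(\<lambda>n. integral\<^sup>L lebesgue (?s n)) \<longlonglongrightarrow> integral\<^sup>L lebesgue ?l"
    by (rule integral_dominated_convergence[OF lmeas meas D]; rule AE_I2, rule lim bound)
  moreover have "integral\<^sup>L lebesgue (?s n) = (\<Sum>k<n. K * weighted_coeff \<eta> k * zonal (Suc k) (t x b))" for n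
  proof -
    have "integral\<^sup>L lebesgue (?s n) = (\<Sum>k<n. zonal (Suc k) (t x b) * (LINT r:{0..pi}|lebesgue. K * series_coeff r k * \<eta> r))"
      unfolding set_lebesgue_integral_def
      by (subst Bochner_Integration.integral_sum, rule integrable_mult_right, rule si)
        (simp only: integral_mult_right_zero)
    then show ?thesis unfolding integral_series_coeff_eta by (simp only: mult_ac)
  qed
  ultimately show "(\<lambda>k. K * weighted_coeff \<eta> k * zonal (Suc k) (t x b)) sums lam_weighted Q \<theta> \<mu> \<eta> x b"
    unfolding sums_def lam_weighted_def set_lebesgue_integral_def by simp
  show "set_integrable lebesgue {0..pi} (\<lambda>r. lam Q \<theta> \<mu> r x b * \<eta> r)"
    unfolding set_integrable_def
    by (rule integrable_dominated_convergence[OF lmeas meas D]; rule AE_I2, rule lim bound)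
qed

definition eta_variance :: real where
  "eta_variance = (LINT r:{0..pi}|lebesgue. (ball_measure r * (1 - ball_measure r)) * \<eta> r)"

lemma symdiff_metric_weighted_eq:
  assumes x: "x \<in> Q" and b: "b \<in> Q"
  shows "symdiff_metric_weighted Q \<theta> \<mu> \<eta> x b = eta_variance - lam_weighted Q \<theta> \<mu> \<eta> x b"
proof -
  have "symdiff_metric_weighted Q \<theta> \<mu> \<eta> x b =
    (LINT r:{0..pi}|lebesgue. (ball_measure r * (1 - ball_measure r)) * \<eta> r - lam Q \<theta> \<mu> r x b * \<eta> r)"
    unfolding symdiff_metric_weighted_def set_lebesgue_integral_def
    by (rule Bochner_Integration.integral_cong) (auto simp: indicator_def symdiff_metric_eq[OF x b] left_diff_distrib)
  also have "\<dots> = eta_variance - lam_weighted Q \<theta> \<mu> \<eta> x b"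
    unfolding eta_variance_def lam_weighted_def
    by (rule set_integral_diff(2)[OF variance_eta_integrable lam_weighted_sums(2)[OF x b]])
  finally show ?thesis .
qed

lemma weighted_coeff_sums: "(\<lambda>k. K * weighted_coeff \<eta> k) sums eta_variance"
proof -
  have "symdiff_metric_weighted Q \<theta> \<mu> \<eta> p0 p0 = 0"
    by (simp add: symdiff_metric_weighted_def symdiff_metric_self)
  then show ?thesis
    using lam_weighted_sums(1)[OF p0_in p0_in] symdiff_metric_weighted_eq[OF p0_in p0_in]
    by (simp add: t_self p0_in)
qed

lemma average_symdiff_metric_weighted: "average \<mu> (symdiff_metric_weighted Q \<theta> \<mu> \<eta>) = eta_variance"
proof (rule average_zonal)
  show "K * weighted_coeff \<eta> k \<ge> 0" for k by (rule weighted_coeff_nonneg)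
  show "summable (\<lambda>k. K * weighted_coeff \<eta> k)" using weighted_coeff_sums by (rule sums_summable)
  fix x y assume "x \<in> Q" "y \<in> Q"
  then show "symdiff_metric_weighted Q \<theta> \<mu> \<eta> x y = eta_variance - (\<Sum>k. K * weighted_coeff \<eta> k * zonal (Suc k) (t x y))"
    using lam_weighted_sums(1) symdiff_metric_weighted_eq by (simp add: sums_iff)
qed

end

text \<open>Shared by the fixed and the weighted radius: \<open>v\<close> is the sum of the
  coefficients, found on the diagonal, and \<open>L\<close> is the kernel.\<close>

lemma series_expansions:
  fixes c p :: "nat \<Rightarrow> real"
  assumes "(\<lambda>k. K * c k) sums v" "(\<lambda>k. K * c k * p k) sums L"
  shows "summable (\<lambda>k. c k * p k)" "summable (\<lambda>k. c k * (1 - p k))"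
    "L = K * (\<Sum>k. c k * p k)" "v - L = K * (\<Sum>k. c k * (1 - p k))"
proof -
  have 1: "(\<lambda>k. c k * p k) sums (L / K)"
    using sums_mult[OF assms(2), of "1 / K"] K_pos by (simp add: mult.assoc)
  have "(\<lambda>k. K * c k - K * c k * p k) sums (v - L)" by (rule sums_diff[OF assms])
  from sums_mult[OF this, of "1 / K"] have 2: "(\<lambda>k. c k * (1 - p k)) sums ((v - L) / K)"
    using K_pos by (simp add: right_diff_distrib diff_divide_distrib)
  show "summable (\<lambda>k. c k * p k)" "summable (\<lambda>k. c k * (1 - p k))"
    using 1 2 by (auto intro: sums_summable)
  show "L = K * (\<Sum>k. c k * p k)" "v - L = K * (\<Sum>k. c k * (1 - p k))"
    using 1 2 K_pos by (auto simp: sums_iff)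
qed

end

section \<open>Composition algebras\<close>

instantiation cayley_dickson :: ("{hypercomplex, euclidean_space}") euclidean_space
begin

definition inner_cayley_dickson :: "'a cayley_dickson \<Rightarrow> 'a cayley_dickson \<Rightarrow> real" where
  "inner x y = inner (cd_fst x) (cd_fst y) + inner (cd_snd x) (cd_snd y)"

definition Basis_cayley_dickson :: "'a cayley_dickson set" where
  "Basis = (\<lambda>b. CD b 0) ` Basis \<union> (\<lambda>b. CD 0 b) ` Basis"

instance
proof
  fix x y z :: "'a cayley_dickson" and c :: real
  show "inner x y = inner y x" by (simp add: inner_cayley_dickson_def inner_commute)
  show "inner (x + y) z = inner x z + inner y z"
    by (simp add: inner_cayley_dickson_def plus_cayley_dickson_def inner_add_left)
  show "inner (c *\<^sub>R x) y = c * inner x y"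
    by (simp add: inner_cayley_dickson_def scaleR_cayley_dickson_def distrib_left)
  show "0 \<le> inner x x" by (simp add: inner_cayley_dickson_def)
  show "inner x x = 0 \<longleftrightarrow> x = 0"
    by (cases x) (simp add: inner_cayley_dickson_def zero_cayley_dickson_def add_nonneg_eq_0_iff)
  show "norm x = sqrt (inner x x)"
    by (simp add: norm_cayley_dickson_def inner_cayley_dickson_def power2_norm_eq_inner)
  show "(Basis :: 'a cayley_dickson set) \<noteq> {}" by (simp add: Basis_cayley_dickson_def)
  show "finite (Basis :: 'a cayley_dickson set)" by (simp add: Basis_cayley_dickson_def)
  fix u v :: "'a cayley_dickson"
  assume "u \<in> Basis" "v \<in> Basis"
  then show "inner u v = (if u = v then 1 else 0)"
    by (auto simp: Basis_cayley_dickson_def inner_cayley_dickson_def inner_Basis split: if_splits)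
next
  fix x :: "'a cayley_dickson"
  show "(\<forall>u\<in>Basis. inner x u = 0) \<longleftrightarrow> x = 0"
    by (cases x) (auto simp: Basis_cayley_dickson_def inner_cayley_dickson_def zero_cayley_dickson_def
        ball_Un euclidean_all_zero_iff)
qed

end

lemma DIM_cayley_dickson [simp]:
  "DIM('a::{hypercomplex, euclidean_space} cayley_dickson) = 2 * DIM('a)"
proof -
  have "card ((\<lambda>b. CD b 0) ` (Basis :: 'a set) \<union> (\<lambda>b. CD 0 b) ` Basis) =
      card ((\<lambda>b. CD b (0::'a)) ` (Basis :: 'a set)) + card ((\<lambda>b. CD (0::'a) b) ` Basis)"
    by (intro card_Un_disjoint) auto
  also have "\<dots> = 2 * DIM('a)" by (simp add: card_image inj_on_def)
  finally show ?thesis by (simp add: Basis_cayley_dickson_def)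
qed

text \<open>The laws that survive for the octonions. The cancellation laws and the adjointness of
  multiplication by an element and by its conjugate stand in for associativity; multiplicativity of
  the norm, the alternative laws and the Moufang identities follow from them.\<close>

class composition_algebra = hypercomplex + euclidean_space +
  assumes hmult_add_right: "x * (y + z) = x * y + x * z"
    and hmult_add_left: "(x + y) * z = x * z + y * z"
    and hmult_scaleR_left: "(c *\<^sub>R x) * y = c *\<^sub>R (x * y)"
    and hmult_scaleR_right: "x * (c *\<^sub>R y) = c *\<^sub>R (x * y)"
    and hone_left [simp]: "1 * x = x"
    and hone_right [simp]: "x * 1 = x"
    and norm_hone [simp]: "norm 1 = 1"
    and hconj_add: "hconj (x + y) = hconj x + hconj y"
    and hconj_scaleR: "hconj (c *\<^sub>R x) = c *\<^sub>R hconj x"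
    and hconj_hconj [simp]: "hconj (hconj x) = x"
    and hconj_mult: "hconj (x * y) = hconj y * hconj x"
    and inner_hconj [simp]: "inner (hconj x) (hconj y) = inner x y"
    and hconj_cancel_left: "hconj x * (x * y) = (norm x)\<^sup>2 *\<^sub>R y"
    and hconj_cancel_right: "(y * x) * hconj x = (norm x)\<^sup>2 *\<^sub>R y"
    and inner_hmult_left: "inner (x * y) z = inner y (hconj x * z)"
    and inner_hmult_right: "inner (x * y) z = inner x (z * hconj y)"

class assoc_composition_algebra = composition_algebra +
  assumes hmult_assoc: "(x * y) * z = x * (y * z)"

class comm_composition_algebra = assoc_composition_algebra +
  assumes hmult_comm: "x * y = y * x"

instance real :: comm_composition_algebra
  by standard (auto simp: hconj_real_def algebra_simps power2_eq_square)

instance complex :: comm_composition_algebra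
proof
  fix x y z :: complex
  show "hconj x * (x * y) = (norm x)\<^sup>2 *\<^sub>R y"
    unfolding hconj_complex_def scaleR_conv_of_real complex_norm_square by (simp only: mult_ac)
  show "(y * x) * hconj x = (norm x)\<^sup>2 *\<^sub>R y"
    unfolding hconj_complex_def scaleR_conv_of_real complex_norm_square by (simp only: mult_ac)
  show "(x * y) * z = x * (y * z)" "x * y = y * x" by (simp_all only: mult_ac)
qed (simp_all add: hconj_complex_def inner_complex_def complex_eq_iff, simp_all add: algebra_simps)

lemma hmult_zero_left [simp]:
  fixes x :: "'a::composition_algebra"
  shows "0 * x = 0"
  using hmult_scaleR_left[of 0 0 x] by simp

lemma hmult_zero_right [simp]:
  fixes x :: "'a::composition_algebra"
  shows "x * 0 = 0"
  using hmult_scaleR_right[of x 0 0] by simp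

lemma hmult_minus_left [simp]:
  fixes x y :: "'a::composition_algebra"
  shows "(- x) * y = - (x * y)"
  using hmult_scaleR_left[of "-1" x y] by simp

lemma hmult_minus_right [simp]:
  fixes x y :: "'a::composition_algebra"
  shows "x * (- y) = - (x * y)"
  using hmult_scaleR_right[of x "-1" y] by simp

lemma hmult_diff_left:
  fixes x y z :: "'a::composition_algebra"
  shows "(x - y) * z = x * z - y * z"
  using hmult_add_left[of x "- y" z] by simp

lemma hmult_diff_right:
  fixes x y z :: "'a::composition_algebra"
  shows "x * (y - z) = x * y - x * z"
  using hmult_add_right[of x y "- z"] by simp

lemma hconj_zero [simp]: "hconj (0 :: 'a::composition_algebra) = 0"
  using hconj_scaleR[of 0 "0::'a"] by simp

lemma hconj_minus [simp]:
  fixes x :: "'a::composition_algebra"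
  shows "hconj (- x) = - hconj x"
  using hconj_scaleR[of "-1" x] by simp

lemma hconj_diff:
  fixes x y :: "'a::composition_algebra"
  shows "hconj (x - y) = hconj x - hconj y"
  using hconj_add[of x "- y"] by simp

lemma norm_hconj [simp]:
  fixes x :: "'a::composition_algebra"
  shows "norm (hconj x) = norm x"
  by (simp add: norm_eq_sqrt_inner)

lemma hconj_one [simp]: "hconj (1 :: 'a::composition_algebra) = 1"
  using hconj_cancel_left[of "1::'a" 1] by simp

text \<open>Adjointness moves x to the other side, where it cancels against its conjugate.\<close>

lemma norm_hmult:
  fixes x y :: "'a::composition_algebra"
  shows "norm (x * y) = norm x * norm y"
proof -
  have "inner (x * y) (x * y) = (norm x)\<^sup>2 * inner y y"
    by (simp add: inner_hmult_left hconj_cancel_left)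
  then have "(norm (x * y))\<^sup>2 = (norm x * norm y)\<^sup>2"
    by (simp add: power2_norm_eq_inner[symmetric] power_mult_distrib)
  then show ?thesis by simp
qed

lemma hmult_sum_left:
  fixes f :: "'b \<Rightarrow> 'a::composition_algebra"
  shows "(\<Sum>i\<in>I. f i) * y = (\<Sum>i\<in>I. f i * y)"
  by (induction I rule: infinite_finite_induct) (simp_all add: hmult_add_left)

lemma hmult_sum_right:
  fixes f :: "'b \<Rightarrow> 'a::composition_algebra"
  shows "y * (\<Sum>i\<in>I. f i) = (\<Sum>i\<in>I. y * f i)"
  by (induction I rule: infinite_finite_induct) (simp_all add: hmult_add_right)

lemma hconj_sum:
  fixes f :: "'b \<Rightarrow> 'a::composition_algebra"
  shows "hconj (\<Sum>i\<in>I. f i) = (\<Sum>i\<in>I. hconj (f i))"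
  by (induction I rule: infinite_finite_induct) (simp_all add: hconj_add)

lemma hconj_mult_self:
  fixes x :: "'a::composition_algebra"
  shows "hconj x * x = (norm x)\<^sup>2 *\<^sub>R 1"
  using hconj_cancel_left[of x 1] by simp

lemma mult_hconj_self:
  fixes x :: "'a::composition_algebra"
  shows "x * hconj x = (norm x)\<^sup>2 *\<^sub>R 1"
  using hconj_cancel_right[of 1 x] by simp

lemma hconj_cancel_left':
  fixes x y :: "'a::composition_algebra"
  shows "x * (hconj x * y) = (norm x)\<^sup>2 *\<^sub>R y"
  using hconj_cancel_left[of "hconj x" y] by simp

lemma hconj_cancel_right':
  fixes x y :: "'a::composition_algebra"
  shows "(y * hconj x) * x = (norm x)\<^sup>2 *\<^sub>R y"
  using hconj_cancel_right[of y "hconj x"] by simp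

text \<open>Compares conj(x) x = |x|^2 at x + 1 and at x. Since the conjugate is a real multiple of
  1 minus x, each cancellation law becomes an alternative law.\<close>

lemma hconj_eq:
  fixes x :: "'a::composition_algebra"
  shows "hconj x = (2 * inner x 1) *\<^sub>R 1 - x"
proof -
  have "hconj (x + 1) * (x + 1) = (norm (x + 1))\<^sup>2 *\<^sub>R 1" by (rule hconj_mult_self)
  moreover have "(norm (x + 1))\<^sup>2 = (norm x)\<^sup>2 + 2 * inner x 1 + 1"
    using power2_norm_eq_inner[of "1::'a"] by (simp add: power2_norm_eq_inner inner_add_left inner_add_right inner_commute)
  ultimately show ?thesis
    using hconj_mult_self[of x]
    by (simp add: hconj_add hmult_add_left hmult_add_right scaleR_add_left algebra_simps)
qed

lemma hmult_left_alternative: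
  fixes x y :: "'a::composition_algebra"
  shows "x * (x * y) = (x * x) * y"
proof -
  have "hconj x * (x * y) = (hconj x * x) * y"
    by (simp add: hconj_cancel_left hconj_mult_self hmult_scaleR_left)
  then show ?thesis
    by (simp add: hconj_eq hmult_diff_left hmult_scaleR_left)
qed

lemma hmult_right_alternative:
  fixes x y :: "'a::composition_algebra"
  shows "(y * x) * x = y * (x * x)"
proof -
  have "(y * x) * hconj x = y * (x * hconj x)"
    by (simp add: hconj_cancel_right mult_hconj_self hmult_scaleR_right)
  then show ?thesis
    by (simp add: hconj_eq hmult_diff_right hmult_scaleR_right)
qed

lemma left_alternative_linear:
  fixes x y z :: "'a::composition_algebra"
  shows "x * (y * z) + y * (x * z) = (x * y) * z + (y * x) * z"
  using hmult_left_alternative[of "x + y" z] hmult_left_alternative[of x z] hmult_left_alternative[of y z]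
  by (simp add: hmult_add_left hmult_add_right algebra_simps)

lemma right_alternative_linear:
  fixes x y z :: "'a::composition_algebra"
  shows "(z * x) * y + (z * y) * x = z * (x * y) + z * (y * x)"
  using hmult_right_alternative[of z "x + y"] hmult_right_alternative[of z x] hmult_right_alternative[of z y]
  by (simp add: hmult_add_left hmult_add_right algebra_simps)

lemma hmult_flexible:
  fixes x y :: "'a::composition_algebra"
  shows "(x * y) * x = x * (y * x)"
  using left_alternative_linear[of x y x] hmult_right_alternative[of y x] by simp

text \<open>Pure cancellation in an additive group; it eliminates the mixed terms from the three
  linearized laws in \<open>Moufang_left\<close>.\<close>

lemma add_cancel_three:
  fixes a :: "'a::ab_group_add"
  shows "a + b = c + d \<Longrightarrow> a + e = f + g \<Longrightarrow> b + g = d + e \<Longrightarrow> c = f"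
proof -
  assume 1: "a + b = c + d" and 2: "a + e = f + g" and 3: "b + g = d + e"
  have "c + (d + e) = (a + b) + e" by (simp only: 1 add.assoc)
  also have "\<dots> = (a + e) + b" by (simp only: add_ac)
  also have "\<dots> = f + (b + g)" unfolding 2 by (simp only: add_ac)
  finally show "c = f" unfolding 3 by simp
qed

text \<open>Three linearized alternative laws are combined so that everything but the two sides of
  the identity cancels. The third one is first multiplied by x from the left and then regrouped with
  the alternative law.\<close>

lemma Moufang_left:
  fixes a x y :: "'a::composition_algebra"
  shows "((x * a) * x) * y = x * (a * (x * y))"
proof -
  have 1: "(x * a) * (x * y) + x * ((x * a) * y) = ((x * a) * x) * y + (x * (x * a)) * y"
    by (rule left_alternative_linear)
  have 2: "(x * a) * (x * y) + (x * (x * y)) * a = x * (a * (x * y)) + x * ((x * y) * a)"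
    by (rule right_alternative_linear)
  have "x * ((x * a) * y) + x * ((x * y) * a) = x * (x * (a * y) + x * (y * a))"
    by (simp add: hmult_add_right[symmetric] right_alternative_linear)
  also have "\<dots> = (x * x) * (a * y) + (x * x) * (y * a)"
    by (simp add: hmult_add_right hmult_left_alternative)
  also have "\<dots> = ((x * x) * a) * y + ((x * x) * y) * a"
    by (rule right_alternative_linear[symmetric])
  finally have 3: "x * ((x * a) * y) + x * ((x * y) * a) = (x * (x * a)) * y + (x * (x * y)) * a"
    by (simp only: hmult_left_alternative)
  show ?thesis by (rule add_cancel_three[OF 1 2 3])
qed

text \<open>A linearized law and \<open>Moufang_left\<close> allow x to be pulled out in front; the
  bracket that remains is (y a) x by linearized alternativity.\<close>

lemma Moufang_middle:
  fixes a x y :: "'a::composition_algebra"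
  shows "(x * y) * (a * x) = (x * (y * a)) * x"
proof -
  have "(x * y) * (a * x) + (x * (a * x)) * y = x * (y * (a * x)) + x * ((a * x) * y)"
    by (rule right_alternative_linear)
  moreover have "(x * (a * x)) * y = x * (a * (x * y))"
    using Moufang_left[of x a y] by (simp add: hmult_flexible)
  ultimately have "(x * y) * (a * x) = x * (y * (a * x) + (a * x) * y - a * (x * y))"
    by (simp add: hmult_add_right hmult_diff_right algebra_simps)
  also have "y * (a * x) + (a * x) * y - a * (x * y) = (y * a) * x"
  proof -
    have "(y * (a * x) + (a * x) * y) + (a * (y * x) + (a * y) * x) =
        (y * (a * x) + a * (y * x)) + ((a * x) * y + (a * y) * x)"
      by (simp only: add_ac)
    also have "\<dots> = ((y * a) * x + a * (x * y)) + (a * (y * x) + (a * y) * x)"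
      unfolding left_alternative_linear right_alternative_linear by (simp only: add_ac)
    finally show ?thesis by simp
  qed
  finally show ?thesis by (simp add: hmult_flexible)
qed

text \<open>The conjugate of the left identity, as conjugation reverses products.\<close>

lemma Moufang_right:
  fixes a x y :: "'a::composition_algebra"
  shows "((y * x) * a) * x = y * (x * (a * x))"
  using arg_cong[OF Moufang_left[of "hconj x" "hconj a" "hconj y"], of hconj]
  by (simp add: hconj_mult)

lemma CD_simps:
  "CD a b * CD c d = CD (a * c - hconj d * b) (d * a + b * hconj c)"
  "CD a b + CD c d = CD (a + c) (b + d)" "CD a b - CD c d = CD (a - c) (b - d)"
  "hconj (CD a b) = CD (hconj a) (- b)" "r *\<^sub>R CD a b = CD (r *\<^sub>R a) (r *\<^sub>R b)"
  by (simp_all add: times_cayley_dickson_def plus_cayley_dickson_def minus_cayley_dickson_def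
      hconj_cayley_dickson_def scaleR_cayley_dickson_def)

lemma norm_CD: "(norm (CD a b))\<^sup>2 = (norm a)\<^sup>2 + (norm b)\<^sup>2"
  by (simp add: norm_cayley_dickson_def)

lemma inner_CD: "inner (CD a b) (CD c d) = inner a c + inner b d"
  by (simp add: inner_cayley_dickson_def)

text \<open>Each doubling costs one law: over a commutative base the double is still associative,
  over an associative base it is still a composition algebra. Hence the quaternions are associative
  and the octonions form a composition algebra.\<close>

instance cayley_dickson :: (assoc_composition_algebra) composition_algebra
proof
  fix x y z :: "'a cayley_dickson" and r :: real
  obtain a b c d e f where xyz: "x = CD a b" "y = CD c d" "z = CD e f" by (metis cayley_dickson.exhaust)
  note dist = hmult_add_left hmult_add_right hmult_diff_left hmult_diff_right hconj_add hconj_diff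
    hmult_scaleR_left hmult_scaleR_right hconj_scaleR
  show "x * (y + z) = x * y + x * z" "(x + y) * z = x * z + y * z"
    unfolding xyz CD_simps dist by (simp_all add: algebra_simps)
  show "(r *\<^sub>R x) * y = r *\<^sub>R (x * y)" "x * (r *\<^sub>R y) = r *\<^sub>R (x * y)"
    unfolding xyz CD_simps dist by (simp_all add: scaleR_add_right scaleR_diff_right)
  show "1 * x = x" "x * 1 = x"
    by (simp_all add: xyz one_cayley_dickson_def CD_simps)
  show "norm (1 :: 'a cayley_dickson) = 1"
    by (simp add: norm_cayley_dickson_def one_cayley_dickson_def)
  show "hconj (x + y) = hconj x + hconj y" "hconj (r *\<^sub>R x) = r *\<^sub>R hconj x" "hconj (hconj x) = x"
    by (simp_all add: xyz CD_simps dist)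
  show "hconj (x * y) = hconj y * hconj x"
    by (simp add: xyz CD_simps dist hconj_mult)
  show "inner (hconj x) (hconj y) = inner x y"
    by (simp add: xyz CD_simps inner_CD)
  show "hconj x * (x * y) = (norm x)\<^sup>2 *\<^sub>R y"
    unfolding xyz CD_simps norm_CD
    by (simp add: dist hconj_mult hmult_assoc hconj_cancel_left hconj_cancel_left' hconj_mult_self mult_hconj_self
        scaleR_add_left)
  show "(y * x) * hconj x = (norm x)\<^sup>2 *\<^sub>R y"
    unfolding xyz CD_simps norm_CD
    by (simp add: dist hconj_mult hmult_assoc hconj_cancel_left hconj_cancel_left' hconj_mult_self mult_hconj_self
        scaleR_add_left)
  have 1: "inner (b * hconj c) f = inner c (hconj f * b)" for b c f :: 'a
    using inner_hconj[of c "hconj f * b"] by (simp add: inner_hmult_left hconj_mult)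
  have 2: "inner (hconj d * b) e = inner d (b * hconj e)" for b d e :: 'a
    using inner_hconj[of d "b * hconj e"] by (simp add: inner_hmult_right hconj_mult)
  show "inner (x * y) z = inner y (hconj x * z)"
    unfolding xyz CD_simps inner_CD inner_diff_left inner_add_left 1[of b c f] 2[of d b e]
    by (simp add: inner_hmult_left[of a c e] inner_hmult_right[of d a f] inner_diff_right inner_add_right)
  have 3: "inner (d * a) f = inner a (hconj d * f)" "inner (hconj d * b) e = inner b (d * e)"
    using inner_hmult_left[of "hconj d" b e] by (simp_all add: inner_hmult_left)
  have 4: "inner (b * hconj c) f = inner b (f * c)"
    using inner_hmult_right[of b "hconj c" f] by simp
  show "inner (x * y) z = inner x (z * hconj y)"
    unfolding xyz CD_simps inner_CD inner_diff_left inner_add_left 3 4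
    by (simp add: inner_hmult_right[of a c e] inner_diff_right inner_add_right)
qed

instance cayley_dickson :: (comm_composition_algebra) assoc_composition_algebra
proof
  fix x y z :: "'a cayley_dickson"
  obtain a b c d e f where xyz: "x = CD a b" "y = CD c d" "z = CD e f" by (metis cayley_dickson.exhaust)
  have lc: "u * (v * w) = v * (u * w)" for u v w :: 'a
    by (metis hmult_assoc hmult_comm)
  show "(x * y) * z = x * (y * z)"
    unfolding xyz CD_simps
    by (simp add: hmult_add_left hmult_add_right hmult_diff_left hmult_diff_right hconj_add hconj_diff
        hconj_mult hmult_assoc hmult_comm lc)
qed

section \<open>Projective spaces over composition algebras\<close>

definition hreal :: "'f::composition_algebra \<Rightarrow> real" where "hreal x = inner x 1"

lemma inner_one_one [simp]: "inner (1 :: 'f::composition_algebra) 1 = 1"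
  using power2_norm_eq_inner[of "1 :: 'f"] by simp

lemma hreal_scaleR_one [simp]: "hreal (r *\<^sub>R (1 :: 'f::composition_algebra)) = r"
  by (simp add: hreal_def)

lemma hreal_one [simp]: "hreal (1 :: 'f::composition_algebra) = 1"
  by (simp add: hreal_def)

lemma hreal_zero [simp]: "hreal (0 :: 'f::composition_algebra) = 0"
  by (simp add: hreal_def)

lemma hreal_sum: "hreal (\<Sum>i\<in>I. f i :: 'f::composition_algebra) = (\<Sum>i\<in>I. hreal (f i))"
  by (simp add: hreal_def inner_sum_left)

lemma hconj_fixed:
  fixes x :: "'f::composition_algebra"
  assumes "hconj x = x"
  shows "x = hreal x *\<^sub>R 1"
proof -
  have "2 *\<^sub>R x = 2 *\<^sub>R (hreal x *\<^sub>R 1)"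
    using hconj_eq[of x] assms by (simp add: hreal_def scaleR_2 algebra_simps)
  then show ?thesis by (simp only: scaleR_cancel_left) simp
qed

text \<open>The square is kept because the cosine of \<open>proj_dist\<close> is 1 minus this
  number, a polynomial in the real coordinates of the entries.\<close>

definition frob :: "nat \<Rightarrow> 'f::composition_algebra sqmat \<Rightarrow> 'f sqmat \<Rightarrow> real" where
  "frob n A B = (\<Sum>i\<le>n. \<Sum>j\<le>n. (norm (A i j - B i j))\<^sup>2)"

lemma proj_spaceD:
  fixes X :: "'f::composition_algebra sqmat"
  assumes "X \<in> proj_space n"
  shows "i > n \<or> j > n \<Longrightarrow> X i j = 0"
    and "i \<le> n \<Longrightarrow> j \<le> n \<Longrightarrow> X j i = hconj (X i j)"
    and "i \<le> n \<Longrightarrow> j \<le> n \<Longrightarrow> (\<Sum>k\<le>n. X i k * X k j) = X i j"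
    and "(\<Sum>i\<le>n. X i i) = 1"
  using assms unfolding proj_space_def mem_Collect_eq by blast+

lemma proj_spaceI:
  fixes X :: "'f::composition_algebra sqmat"
  assumes "\<And>i j. i > n \<or> j > n \<Longrightarrow> X i j = 0"
    "\<And>i j. i \<le> n \<Longrightarrow> j \<le> n \<Longrightarrow> X j i = hconj (X i j)"
    "\<And>i j. i \<le> n \<Longrightarrow> j \<le> n \<Longrightarrow> (\<Sum>k\<le>n. X i k * X k j) = X i j"
    "(\<Sum>i\<le>n. X i i) = 1"
  shows "X \<in> proj_space n"
  using assms unfolding proj_space_def mem_Collect_eq by blast

lemma proj_space_eqI:
  assumes "X \<in> proj_space n" "Y \<in> proj_space n" "\<And>i j. i \<le> n \<Longrightarrow> j \<le> n \<Longrightarrow> X i j = Y i j"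
  shows "X = (Y :: 'f::composition_algebra sqmat)"
proof (intro ext)
  fix i j
  show "X i j = Y i j"
  proof (cases "i \<le> n \<and> j \<le> n")
    case False
    then have "i > n \<or> j > n" by auto
    then show ?thesis using proj_spaceD(1)[OF assms(1)] proj_spaceD(1)[OF assms(2)] by simp
  qed (simp add: assms(3))
qed

context
  fixes n :: nat and X :: "'f::composition_algebra sqmat"
  assumes X: "X \<in> proj_space n"
begin

lemma proj_diag: "i \<le> n \<Longrightarrow> X i i = hreal (X i i) *\<^sub>R 1"
  using hconj_fixed[of "X i i"] proj_spaceD(2)[OF X, of i i] by simp

lemma proj_norm_sym: "i \<le> n \<Longrightarrow> j \<le> n \<Longrightarrow> norm (X j i) = norm (X i j)"
  using proj_spaceD(2)[OF X, of i j] by simp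

text \<open>The diagonal entry of X X = X, in which Hermitian symmetry turns each product into a
  squared norm.\<close>

lemma proj_row_norm: assumes "i \<le> n" shows "(\<Sum>k\<le>n. (norm (X i k))\<^sup>2) = hreal (X i i)"
proof -
  have "hreal (X i i) = hreal (\<Sum>k\<le>n. X i k * X k i)" using proj_spaceD(3)[OF X assms assms] by simp
  also have "(\<Sum>k\<le>n. X i k * X k i) = (\<Sum>k\<le>n. (norm (X i k))\<^sup>2 *\<^sub>R 1)"
    using proj_spaceD(2)[OF X assms] by (intro sum.cong) (auto simp: mult_hconj_self)
  finally show ?thesis by (simp add: hreal_sum)
qed

lemma proj_diag_nonneg: "i \<le> n \<Longrightarrow> hreal (X i i) \<ge> 0"
  using proj_row_norm[of i] by (metis sum_nonneg zero_le_power2)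

lemma proj_trace: "(\<Sum>i\<le>n. hreal (X i i)) = 1"
  using arg_cong[OF proj_spaceD(4)[OF X], of hreal] by (simp add: hreal_sum)

lemma proj_norm2: "(\<Sum>i\<le>n. \<Sum>j\<le>n. (norm (X i j))\<^sup>2) = 1"
  using proj_trace by (simp add: proj_row_norm)

text \<open>Cauchy--Schwarz gives one inequality; both sides have the same sum over all $i, j$.\<close>

lemma proj_rank_one:
  assumes "i \<le> n" "j \<le> n"
  shows "(norm (X i j))\<^sup>2 = hreal (X i i) * hreal (X j j)"
proof -
  have le: "(norm (X i j))\<^sup>2 \<le> hreal (X i i) * hreal (X j j)" if "i \<le> n" "j \<le> n" for i j
  proof -
    have "norm (X i j) \<le> (\<Sum>k\<le>n. norm (X i k) * norm (X j k))"
    proof -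
      have "norm (X i j) \<le> (\<Sum>k\<le>n. norm (X i k * X k j))"
        unfolding proj_spaceD(3)[OF X that, symmetric] by (rule norm_sum)
      also have "\<dots> = (\<Sum>k\<le>n. norm (X i k) * norm (X j k))"
        using that proj_norm_sym[of _ j] by (intro sum.cong) (auto simp: norm_hmult)
      finally show ?thesis .
    qed
    then have "(norm (X i j))\<^sup>2 \<le> (\<Sum>k\<le>n. norm (X i k) * norm (X j k))\<^sup>2" by (rule power_mono) simp
    also have "\<dots> \<le> (\<Sum>k\<le>n. (norm (X i k))\<^sup>2) * (\<Sum>k\<le>n. (norm (X j k))\<^sup>2)"
      by (rule Cauchy_Schwarz_ineq_sum)
    finally show ?thesis using that by (simp add: proj_row_norm)
  qed
  let ?f = "\<lambda>i j. hreal (X i i) * hreal (X j j) - (norm (X i j))\<^sup>2"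
  have "(\<Sum>i\<le>n. \<Sum>j\<le>n. ?f i j) = (\<Sum>i\<le>n. hreal (X i i)) * (\<Sum>j\<le>n. hreal (X j j)) - (\<Sum>i\<le>n. \<Sum>j\<le>n. (norm (X i j))\<^sup>2)"
    by (simp add: sum_subtractf sum_product)
  then have s: "(\<Sum>i\<le>n. \<Sum>j\<le>n. ?f i j) = 0" by (simp add: proj_trace proj_norm2)
  have "\<forall>i\<in>{..n}. (\<Sum>j\<le>n. ?f i j) = 0"
    by (rule sum_nonneg_eq_0_iff[THEN iffD1, OF _ _ s]) (auto intro!: sum_nonneg le)
  then have "(\<Sum>j\<le>n. ?f i j) = 0" using assms by simp
  then have "\<forall>j\<in>{..n}. ?f i j = 0"
    by (rule sum_nonneg_eq_0_iff[THEN iffD1, rotated 2]) (use assms le in auto)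
  then show ?thesis using assms by simp
qed

lemma proj_zero_row:
  assumes "hreal (X i i) = 0" "i \<le> n" "j \<le> n"
  shows "X i j = 0" "X j i = 0"
  using proj_rank_one[of i j] proj_rank_one[of j i] assms by auto

end

section \<open>Isometries of the projective spaces\<close>

definition proj_isometry :: "nat \<Rightarrow> ('f::composition_algebra sqmat \<Rightarrow> 'f sqmat) \<Rightarrow> bool" where
  "proj_isometry n g \<longleftrightarrow> bij_betw g (proj_space n) (proj_space n) \<and>
     (\<forall>A\<in>proj_space n. \<forall>B\<in>proj_space n. frob n (g A) (g B) = frob n A B)"

lemma proj_isometryI:
  assumes "\<And>A. A \<in> proj_space n \<Longrightarrow> g A \<in> proj_space n" "\<And>A. A \<in> proj_space n \<Longrightarrow> h A \<in> proj_space n"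
    "\<And>A. A \<in> proj_space n \<Longrightarrow> h (g A) = A" "\<And>A. A \<in> proj_space n \<Longrightarrow> g (h A) = A"
    "\<And>A B. A \<in> proj_space n \<Longrightarrow> B \<in> proj_space n \<Longrightarrow> frob n (g A) (g B) = frob n A B"
  shows "proj_isometry n g"
  unfolding proj_isometry_def
  by (intro conjI bij_betw_byWitness[where f' = h]) (use assms in auto)

lemma proj_isometry_in: "proj_isometry n g \<Longrightarrow> A \<in> proj_space n \<Longrightarrow> g A \<in> proj_space n"
  by (auto simp: proj_isometry_def bij_betw_def)

lemma proj_isometry_comp:
  fixes g h :: "'f::composition_algebra sqmat \<Rightarrow> 'f sqmat"
  assumes "proj_isometry n g" "proj_isometry n h"
  shows "proj_isometry n (g \<circ> h)"
  unfolding proj_isometry_def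
proof (intro conjI ballI)
  show "bij_betw (g \<circ> h) (proj_space n) (proj_space n)"
    using assms by (auto simp: proj_isometry_def intro: bij_betw_trans)
  fix A B :: "'f sqmat" assume "A \<in> proj_space n" "B \<in> proj_space n"
  then show "frob n ((g \<circ> h) A) ((g \<circ> h) B) = frob n A B"
    using assms proj_isometry_in[OF assms(2)] by (simp add: proj_isometry_def)
qed

lemma proj_isometry_id: "proj_isometry n (\<lambda>x. x)"
  by (rule proj_isometryI[where h = "\<lambda>x. x"]) auto

lemma isometry_betw_proj:
  assumes "proj_isometry n g"
  shows "isometry_betw g (proj_space n) (proj_dist n) (proj_space n) (proj_dist n)"
  using assms by (auto simp: isometry_betw_def proj_isometry_def proj_dist_def frob_def)

definition twist_factor :: "nat \<Rightarrow> 'f::composition_algebra \<Rightarrow> nat \<Rightarrow> 'f" where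
  "twist_factor m u i = (if i = 0 then u else if i = m then hconj u else 1)"

text \<open>Conjugation by the diagonal matrix with entries $u$ at $0$, $u^*$ at $m$ and $1$ elsewhere;
  the diagonal of a Hermitian matrix is real and thus fixed.\<close>

definition twist :: "nat \<Rightarrow> 'f::composition_algebra \<Rightarrow> 'f sqmat \<Rightarrow> 'f sqmat" where
  "twist m u X = (\<lambda>i j. if i = j then X i j else (twist_factor m u i * X i j) * hconj (twist_factor m u j))"

text \<open>The instance of associativity by which a twist respects matrix products. Three distinct
  indices suffice because diagonal entries are real multiples of 1. The bound on m leaves the factor
  at index 1 equal to 1.\<close>

definition twist_compatible :: "'f::composition_algebra itself \<Rightarrow> nat \<Rightarrow> bool" where
  "twist_compatible T n \<longleftrightarrow> (\<forall>m i j k (u::'f) x y. 2 \<le> m \<longrightarrow> m \<le> n \<longrightarrow> i \<le> n \<longrightarrow> j \<le> n \<longrightarrow> k \<le> n \<longrightarrow>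
     norm u = 1 \<longrightarrow> i \<noteq> j \<longrightarrow> i \<noteq> k \<longrightarrow> j \<noteq> k \<longrightarrow>
     ((twist_factor m u i * x) * hconj (twist_factor m u k)) * ((twist_factor m u k * y) * hconj (twist_factor m u j))
       = (twist_factor m u i * (x * y)) * hconj (twist_factor m u j))"

lemma norm_twist_factor: "norm u = 1 \<Longrightarrow> norm (twist_factor m u i) = 1"
  by (simp add: twist_factor_def)

lemma twist_compatible_assoc: "twist_compatible TYPE('f::assoc_composition_algebra) n"
  unfolding twist_compatible_def
proof (intro allI impI)
  fix m i j k :: nat and u x y :: 'f
  assume "norm u = 1"
  define v where "v = twist_factor m u k"
  have "norm v = 1" using \<open>norm u = 1\<close> by (simp add: v_def norm_twist_factor)
  then show "((twist_factor m u i * x) * hconj (twist_factor m u k)) * ((twist_factor m u k * y) * hconj (twist_factor m u j))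
       = (twist_factor m u i * (x * y)) * hconj (twist_factor m u j)"
    unfolding v_def[symmetric] by (simp add: hmult_assoc hconj_cancel_left)
qed

text \<open>Three distinct indices must be 0, 1, 2, with factors u, 1 and the conjugate of u. Of the
  six orderings, two are instances of each of the left, right and middle Moufang identities.\<close>

lemma twist_compatible_plane: "twist_compatible TYPE('f::composition_algebra) 2"
  unfolding twist_compatible_def
proof (intro allI impI)
  fix m i j k :: nat and u x y :: 'f
  assume m: "2 \<le> m" "m \<le> 2" and ijk: "i \<le> 2" "j \<le> 2" "k \<le> 2" "i \<noteq> j" "i \<noteq> k" "j \<noteq> k" and u: "norm u = 1"
  have m2: "m = 2" using m by simp
  have c: "hconj u * (u * z) = z" "u * (hconj u * z) = z" "(z * u) * hconj u = z" "(z * hconj u) * u = z" for z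
    using u by (simp_all add: hconj_cancel_left hconj_cancel_right hconj_cancel_left' hconj_cancel_right')
  have l: "((v * z) * v) * (hconj v * w) = v * (z * w)" if "v = u \<or> v = hconj u" for v z w
    using Moufang_left[of v z "hconj v * w"] that c by auto
  have r: "(w * hconj v) * ((v * z) * v) = (w * z) * v" if "v = u \<or> v = hconj u" for v z w
    using Moufang_right[of "w * hconj v" v z] that c by (auto simp: hmult_flexible)
  have mid: "(v * z) * (w * v) = (v * (z * w)) * v" for v z w :: 'f
    by (rule Moufang_middle)
  have l1: "((u * x) * u) * (hconj u * y) = u * (x * y)" "((hconj u * x) * hconj u) * (u * y) = hconj u * (x * y)"
    using l[of u x y] l[of "hconj u" x y] unfolding hconj_hconj by blast+
  have r1: "(x * hconj u) * ((u * y) * u) = (x * y) * u" "(x * u) * ((hconj u * y) * hconj u) = (x * y) * hconj u"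
    using r[of u x y] r[of "hconj u" x y] unfolding hconj_hconj by blast+
  have tf: "twist_factor m u 0 = u" "twist_factor m u 1 = 1" "twist_factor m u 2 = hconj u"
    by (simp_all add: twist_factor_def m2)
  have "i = 0 \<and> k = 1 \<and> j = 2 \<or> i = 0 \<and> k = 2 \<and> j = 1 \<or> i = 1 \<and> k = 0 \<and> j = 2 \<or>
      i = 1 \<and> k = 2 \<and> j = 0 \<or> i = 2 \<and> k = 0 \<and> j = 1 \<or> i = 2 \<and> k = 1 \<and> j = 0"
  proof -
    have "i \<in> {0, 1, 2}" "j \<in> {0, 1, 2}" "k \<in> {0, 1, 2}" using ijk(1-3) by auto
    then show ?thesis using ijk(4-6) by auto
  qed
  then show "((twist_factor m u i * x) * hconj (twist_factor m u k)) * ((twist_factor m u k * y) * hconj (twist_factor m u j))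
       = (twist_factor m u i * (x * y)) * hconj (twist_factor m u j)"
    by (elim disjE conjE; hypsubst)
      (simp_all only: tf hconj_hconj hconj_one hone_left hone_right l1 r1 mid)
qed

text \<open>On the diagonal the matrix product is a sum of squared norms, which the twist preserves.
  Off the diagonal, the terms with \<open>k = i\<close> or \<open>k = j\<close> contain a real
  diagonal entry, and the remaining ones are governed by \<open>twist_compatible\<close>.\<close>

lemma twist_in_proj_space:
  fixes u :: "'f::composition_algebra"
  assumes tc: "twist_compatible TYPE('f) n" and m: "2 \<le> m" "m \<le> n" and u: "norm u = 1"
    and X: "X \<in> proj_space n"
  shows "twist m u X \<in> proj_space n"
proof -
  define L where "L = twist_factor m u"
  have L: "norm (L i) = 1" for i using u by (simp add: L_def norm_twist_factor)
  \<comment> \<open>If neither factor is 1, then i and j are 0 and m, where the conjugate of L i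
    equals L j, and the flexible law applies.\<close>
  have flex: "(L j * z) * hconj (L i) = L j * (z * hconj (L i))" if "i \<noteq> j" for i j and z :: 'f
    using that m by (auto simp: L_def twist_factor_def hmult_flexible)
  have tw: "twist m u X i j = (L i * X i j) * hconj (L j)" if "i \<noteq> j" for i j
    using that by (simp add: twist_def L_def)
  have twd: "twist m u X i i = X i i" for i by (simp add: twist_def)
  have herm: "twist m u X j i = hconj (twist m u X i j)" if "i \<le> n" "j \<le> n" for i j
  proof (cases "i = j")
    case False
    then show ?thesis using proj_spaceD(2)[OF X that]
      by (simp add: tw hconj_mult flex[OF False])
  qed (use proj_spaceD(2)[OF X, of i i] that twd in auto)
  have nrm: "norm (twist m u X i j) = norm (X i j)" for i j
    by (cases "i = j") (simp_all add: twd tw norm_hmult L)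
  have idem: "(\<Sum>k\<le>n. twist m u X i k * twist m u X k j) = twist m u X i j" if ij: "i \<le> n" "j \<le> n" for i j
  proof (cases "i = j")
    case True
    have "(\<Sum>k\<le>n. twist m u X i k * twist m u X k i) = (\<Sum>k\<le>n. X i k * X k i)"
    proof (rule sum.cong[OF refl])
      fix k assume "k \<in> {..n}"
      then show "twist m u X i k * twist m u X k i = X i k * X k i"
        using herm[of i k] proj_spaceD(2)[OF X, of i k] ij by (simp add: mult_hconj_self nrm)
    qed
    then show ?thesis using proj_spaceD(3)[OF X ij(1) ij(1)] True twd by simp
  next
    case False
    have "(\<Sum>k\<le>n. twist m u X i k * twist m u X k j) = (\<Sum>k\<le>n. (L i * (X i k * X k j)) * hconj (L j))"
    proof (rule sum.cong[OF refl])
      fix k assume k: "k \<in> {..n}"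
      consider "k = i" | "k = j" | "k \<noteq> i" "k \<noteq> j" by blast
      then show "twist m u X i k * twist m u X k j = (L i * (X i k * X k j)) * hconj (L j)"
      proof cases
        case 1
        have d: "X i i = hreal (X i i) *\<^sub>R 1" by (rule proj_diag[OF X ij(1)])
        show ?thesis unfolding 1 twd tw[OF False]
          by (subst (1 2) d) (simp add: hmult_scaleR_left hmult_scaleR_right)
      next
        case 2
        have d: "X j j = hreal (X j j) *\<^sub>R 1" by (rule proj_diag[OF X ij(2)])
        show ?thesis unfolding 2 twd tw[OF False]
          by (subst (1 2) d) (simp add: hmult_scaleR_left hmult_scaleR_right)
      next
        case 3
        then have "((L i * X i k) * hconj (L k)) * ((L k * X k j) * hconj (L j)) = (L i * (X i k * X k j)) * hconj (L j)"
          using tc m ij k u False unfolding twist_compatible_def L_def by auto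
        then show ?thesis using 3 by (simp add: tw)
      qed
    qed
    also have "\<dots> = (L i * (\<Sum>k\<le>n. X i k * X k j)) * hconj (L j)"
      by (simp add: hmult_sum_left hmult_sum_right)
    also have "\<dots> = twist m u X i j" by (simp add: proj_spaceD(3)[OF X ij] tw[OF False])
    finally show ?thesis .
  qed
  show ?thesis
  proof (rule proj_spaceI)
    show "twist m u X i j = 0" if "i > n \<or> j > n" for i j
      using proj_spaceD(1)[OF X that] by (auto simp: twist_def)
    show "(\<Sum>i\<le>n. twist m u X i i) = 1" using proj_spaceD(4)[OF X] by (simp add: twd)
  qed (fact herm idem)+
qed

lemma twist_inverse:
  fixes u :: "'f::composition_algebra"
  assumes "norm u = 1"
  shows "twist m (hconj u) (twist m u X) = X"
proof (intro ext)
  fix i j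
  have c: "hconj u * (u * z) = z" "u * (hconj u * z) = z" "(z * u) * hconj u = z" "(z * hconj u) * u = z" for z
    using assms by (simp_all add: hconj_cancel_left hconj_cancel_right hconj_cancel_left' hconj_cancel_right')
  show "twist m (hconj u) (twist m u X) i j = X i j"
    by (auto simp: twist_def twist_factor_def c hmult_flexible[of u] hmult_flexible[of "hconj u" "X i j"])
qed

lemma twist_isometry:
  fixes u :: "'f::composition_algebra"
  assumes tc: "twist_compatible TYPE('f) n" and m: "2 \<le> m" "m \<le> n" and u: "norm u = 1"
  shows "proj_isometry n (twist m u)"
proof (rule proj_isometryI[where h = "twist m (hconj u)"])
  have u': "norm (hconj u) = 1" using u by simp
  show "twist m u A \<in> proj_space n" if "A \<in> proj_space n" for A
    by (rule twist_in_proj_space[OF tc m u that])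
  show "twist m (hconj u) A \<in> proj_space n" if "A \<in> proj_space n" for A
    by (rule twist_in_proj_space[OF tc m u' that])
  show "twist m (hconj u) (twist m u A) = A" for A by (rule twist_inverse[OF u])
  show "twist m u (twist m (hconj u) A) = A" for A using twist_inverse[OF u'] by simp
  have "norm (twist m u A i j - twist m u B i j) = norm (A i j - B i j)" for A B i j
    by (cases "i = j")
      (simp_all add: twist_def hmult_diff_left[symmetric] hmult_diff_right[symmetric] norm_hmult norm_twist_factor u)
  then show "frob n (twist m u A) (twist m u B) = frob n A B" for A B by (simp add: frob_def)
qed

section \<open>Real rotations of projections\<close>

definition orthogonal_upto :: "nat \<Rightarrow> (nat \<Rightarrow> nat \<Rightarrow> real) \<Rightarrow> bool" where
  "orthogonal_upto n R \<longleftrightarrow>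
     (\<forall>i\<le>n. \<forall>j\<le>n. (\<Sum>k\<le>n. R k i * R k j) = (if i = j then 1 else 0)) \<and>
     (\<forall>i\<le>n. \<forall>j\<le>n. (\<Sum>k\<le>n. R i k * R j k) = (if i = j then 1 else 0))"

lemma orthogonal_upto_transpose: "orthogonal_upto n R \<Longrightarrow> orthogonal_upto n (\<lambda>i j. R j i)"
  by (auto simp: orthogonal_upto_def)

text \<open>The coefficients are real and pass freely through products, so conjugation by a real
  orthogonal matrix respects matrix products even over the octonions.\<close>

lemma orthogonal_sum_bilinear:
  fixes a b :: "nat \<Rightarrow> 'f::composition_algebra"
  assumes "orthogonal_upto n R"
  shows "(\<Sum>j\<le>n. (\<Sum>k\<le>n. R j k *\<^sub>R a k) * (\<Sum>l\<le>n. R j l *\<^sub>R b l)) = (\<Sum>k\<le>n. a k * b k)"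
proof -
  have "(\<Sum>j\<le>n. (\<Sum>k\<le>n. R j k *\<^sub>R a k) * (\<Sum>l\<le>n. R j l *\<^sub>R b l)) =
    (\<Sum>j\<le>n. \<Sum>k\<le>n. \<Sum>l\<le>n. (R j k * R j l) *\<^sub>R (a k * b l))"
    unfolding hmult_sum_left
    by (simp only: hmult_sum_right hmult_scaleR_left hmult_scaleR_right scaleR_scaleR scaleR_sum_right)
      (intro sum.cong refl, simp only: mult.commute)
  also have "\<dots> = (\<Sum>k\<le>n. \<Sum>l\<le>n. \<Sum>j\<le>n. (R j k * R j l) *\<^sub>R (a k * b l))"
    by (subst sum.swap) (intro sum.cong sum.swap refl)
  also have "\<dots> = (\<Sum>k\<le>n. \<Sum>l\<le>n. (if k = l then 1 else 0) *\<^sub>R (a k * b l))"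
    unfolding scaleR_sum_left[symmetric] using assms by (intro sum.cong refl) (simp add: orthogonal_upto_def)
  also have "\<dots> = (\<Sum>k\<le>n. a k * b k)"
    by (simp add: if_distrib[of "\<lambda>x. x *\<^sub>R _"] cong: if_cong)
  finally show ?thesis .
qed

lemma orthogonal_sum_norm:
  fixes a :: "nat \<Rightarrow> 'f::euclidean_space"
  assumes "orthogonal_upto n R"
  shows "(\<Sum>j\<le>n. (norm (\<Sum>k\<le>n. R j k *\<^sub>R a k))\<^sup>2) = (\<Sum>k\<le>n. (norm (a k))\<^sup>2)"
proof -
  have "(\<Sum>j\<le>n. (norm (\<Sum>k\<le>n. R j k *\<^sub>R a k))\<^sup>2) =
    (\<Sum>j\<le>n. \<Sum>k\<le>n. \<Sum>l\<le>n. (R j k * R j l) * inner (a k) (a l))"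
    unfolding power2_norm_eq_inner inner_sum_left
    by (simp only: inner_sum_right inner_scaleR_left inner_scaleR_right sum_distrib_left mult.assoc)
      (intro sum.cong refl, simp only: mult.left_commute)
  also have "\<dots> = (\<Sum>k\<le>n. \<Sum>l\<le>n. \<Sum>j\<le>n. (R j k * R j l) * inner (a k) (a l))"
    by (subst sum.swap) (intro sum.cong sum.swap refl)
  also have "\<dots> = (\<Sum>k\<le>n. \<Sum>l\<le>n. (if k = l then 1 else 0) * inner (a k) (a l))"
    unfolding sum_distrib_right[symmetric] using assms by (intro sum.cong refl) (simp add: orthogonal_upto_def)
  also have "\<dots> = (\<Sum>k\<le>n. (norm (a k))\<^sup>2)"
    by (simp add: if_distrib[of "\<lambda>x. x * _"] power2_norm_eq_inner cong: if_cong)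
  finally show ?thesis .
qed

lemma orthogonal_sum_inverse:
  fixes a :: "nat \<Rightarrow> 'f::real_vector"
  assumes "orthogonal_upto n R" "i \<le> n"
  shows "(\<Sum>j\<le>n. R j i *\<^sub>R (\<Sum>k\<le>n. R j k *\<^sub>R a k)) = a i"
proof -
  have "(\<Sum>j\<le>n. R j i *\<^sub>R (\<Sum>k\<le>n. R j k *\<^sub>R a k)) = (\<Sum>k\<le>n. (\<Sum>j\<le>n. R j i * R j k) *\<^sub>R a k)"
    unfolding scaleR_sum_right scaleR_sum_left scaleR_scaleR by (rule sum.swap)
  also have "\<dots> = (\<Sum>k\<le>n. (if i = k then 1 else 0) *\<^sub>R a k)"
    using assms by (intro sum.cong refl) (simp add: orthogonal_upto_def)
  also have "\<dots> = a i" using assms(2) by (simp add: if_distrib[of "\<lambda>x. x *\<^sub>R _"] cong: if_cong)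
  finally show ?thesis .
qed

definition rotate_mat :: "nat \<Rightarrow> (nat \<Rightarrow> nat \<Rightarrow> real) \<Rightarrow> 'f::composition_algebra sqmat \<Rightarrow> 'f sqmat" where
  "rotate_mat n R X = (\<lambda>i j. if i \<le> n \<and> j \<le> n then \<Sum>k\<le>n. R i k *\<^sub>R (\<Sum>l\<le>n. R j l *\<^sub>R X k l) else 0)"

lemma rotate_mat_eq: "i \<le> n \<Longrightarrow> j \<le> n \<Longrightarrow> rotate_mat n R X i j = (\<Sum>k\<le>n. R i k *\<^sub>R (\<Sum>l\<le>n. R j l *\<^sub>R X k l))"
  by (simp add: rotate_mat_def)

lemma rotate_mat_eq': "i \<le> n \<Longrightarrow> j \<le> n \<Longrightarrow> rotate_mat n R X i j = (\<Sum>l\<le>n. R j l *\<^sub>R (\<Sum>k\<le>n. R i k *\<^sub>R X k l))"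
  unfolding rotate_mat_eq scaleR_sum_right scaleR_scaleR by (subst sum.swap) (simp add: mult.commute)

lemma rotate_mat_in_proj_space:
  fixes X :: "'f::composition_algebra sqmat"
  assumes R: "orthogonal_upto n R" and X: "X \<in> proj_space n"
  shows "rotate_mat n R X \<in> proj_space n"
proof (rule proj_spaceI)
  show "rotate_mat n R X i j = 0" if "i > n \<or> j > n" for i j using that by (auto simp: rotate_mat_def)
  show "rotate_mat n R X j i = hconj (rotate_mat n R X i j)" if ij: "i \<le> n" "j \<le> n" for i j
  proof -
    have "rotate_mat n R X j i = (\<Sum>k\<le>n. R j k *\<^sub>R (\<Sum>l\<le>n. R i l *\<^sub>R hconj (X l k)))"
      unfolding rotate_mat_eq[OF ij(2,1)]
      by (intro sum.cong refl arg_cong2[where f = scaleR], rule proj_spaceD(2)[OF X]) simp_all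
    also have "\<dots> = hconj (rotate_mat n R X i j)"
      unfolding rotate_mat_eq'[OF ij] by (simp add: hconj_sum hconj_scaleR)
    finally show ?thesis .
  qed
  show "(\<Sum>k\<le>n. rotate_mat n R X i k * rotate_mat n R X k j) = rotate_mat n R X i j" if ij: "i \<le> n" "j \<le> n" for i j
  proof -
    \<comment> \<open>The order of summation differs in the two factors, so that the shared index k
      appears in an orthogonal sum in each of them.\<close>
    define a where "a l = (\<Sum>k\<le>n. R i k *\<^sub>R X k l)" for l
    define b where "b k = (\<Sum>l\<le>n. R j l *\<^sub>R X k l)" for k
    have "(\<Sum>k\<le>n. rotate_mat n R X i k * rotate_mat n R X k j) =
      (\<Sum>k\<le>n. (\<Sum>l\<le>n. R k l *\<^sub>R a l) * (\<Sum>l\<le>n. R k l *\<^sub>R b l))"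
      using ij by (intro sum.cong refl arg_cong2[where f = times])
        (simp_all add: rotate_mat_eq' [of i n] rotate_mat_eq[of _ n j] a_def b_def)
    also have "\<dots> = (\<Sum>k\<le>n. a k * b k)" by (rule orthogonal_sum_bilinear[OF R])
    also have "\<dots> = (\<Sum>k\<le>n. \<Sum>p\<le>n. \<Sum>q\<le>n. R i p *\<^sub>R (R j q *\<^sub>R (X p k * X k q)))"
      unfolding a_def b_def hmult_sum_left
      by (simp only: hmult_sum_right hmult_scaleR_left hmult_scaleR_right scaleR_scaleR scaleR_sum_right)
        (intro sum.cong refl, simp only: mult.commute)
    also have "\<dots> = (\<Sum>p\<le>n. \<Sum>q\<le>n. \<Sum>k\<le>n. R i p *\<^sub>R (R j q *\<^sub>R (X p k * X k q)))"
      by (subst sum.swap) (intro sum.cong sum.swap refl)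
    also have "\<dots> = (\<Sum>p\<le>n. \<Sum>q\<le>n. R i p *\<^sub>R (R j q *\<^sub>R X p q))"
      unfolding scaleR_sum_right[symmetric] by (intro sum.cong refl) (simp add: proj_spaceD(3)[OF X])
    also have "\<dots> = rotate_mat n R X i j" unfolding rotate_mat_eq[OF ij] by (simp add: scaleR_sum_right)
    finally show ?thesis .
  qed
  have "(\<Sum>i\<le>n. rotate_mat n R X i i) = (\<Sum>i\<le>n. \<Sum>k\<le>n. \<Sum>l\<le>n. (R i k * R i l) *\<^sub>R X k l)"
    by (intro sum.cong refl) (simp add: rotate_mat_eq scaleR_sum_right)
  also have "\<dots> = (\<Sum>k\<le>n. \<Sum>l\<le>n. \<Sum>i\<le>n. (R i k * R i l) *\<^sub>R X k l)"
    by (subst sum.swap) (intro sum.cong sum.swap refl)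
  also have "\<dots> = (\<Sum>k\<le>n. \<Sum>l\<le>n. (if k = l then 1 else 0) *\<^sub>R X k l)"
    unfolding scaleR_sum_left[symmetric] using R by (intro sum.cong refl) (simp add: orthogonal_upto_def)
  also have "\<dots> = 1" using proj_spaceD(4)[OF X] by (simp add: if_distrib[of "\<lambda>x. x *\<^sub>R _"] cong: if_cong)
  finally show "(\<Sum>i\<le>n. rotate_mat n R X i i) = 1" .
qed

lemma rotate_mat_inverse:
  fixes X :: "'f::composition_algebra sqmat"
  assumes R: "orthogonal_upto n R" and X: "X \<in> proj_space n"
  shows "rotate_mat n (\<lambda>i j. R j i) (rotate_mat n R X) = X"
proof (rule proj_space_eqI)
  show "rotate_mat n (\<lambda>i j. R j i) (rotate_mat n R X) \<in> proj_space n"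
    by (rule rotate_mat_in_proj_space[OF orthogonal_upto_transpose[OF R] rotate_mat_in_proj_space[OF R X]])
  fix i j assume ij: "i \<le> n" "j \<le> n"
  have "rotate_mat n (\<lambda>i j. R j i) (rotate_mat n R X) i j = (\<Sum>k\<le>n. R k i *\<^sub>R (\<Sum>l\<le>n. R l j *\<^sub>R rotate_mat n R X k l))"
    by (rule rotate_mat_eq[OF ij])
  also have "\<dots> = (\<Sum>k\<le>n. R k i *\<^sub>R (\<Sum>l\<le>n. R l j *\<^sub>R (\<Sum>q\<le>n. R l q *\<^sub>R (\<Sum>p\<le>n. R k p *\<^sub>R X p q))))"
    by (intro sum.cong refl arg_cong2[where f = scaleR], rule rotate_mat_eq') simp_all
  also have "\<dots> = (\<Sum>k\<le>n. R k i *\<^sub>R (\<Sum>p\<le>n. R k p *\<^sub>R X p j))"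
    unfolding orthogonal_sum_inverse[OF R ij(2)] ..
  also have "\<dots> = X i j" by (rule orthogonal_sum_inverse[OF R ij(1)])
  finally show "rotate_mat n (\<lambda>i j. R j i) (rotate_mat n R X) i j = X i j" .
qed (rule X)

lemma rotate_mat_isometry:
  assumes R: "orthogonal_upto n R"
  shows "proj_isometry n (rotate_mat n R :: 'f::composition_algebra sqmat \<Rightarrow> _)"
proof (rule proj_isometryI[where h = "rotate_mat n (\<lambda>i j. R j i)"])
  note R' = orthogonal_upto_transpose[OF R]
  show "rotate_mat n R A \<in> proj_space n" "rotate_mat n (\<lambda>i j. R j i) A \<in> proj_space n"
    "rotate_mat n (\<lambda>i j. R j i) (rotate_mat n R A) = A" "rotate_mat n R (rotate_mat n (\<lambda>i j. R j i) A) = A"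
    if "A \<in> proj_space n" for A :: "'f sqmat"
    using rotate_mat_in_proj_space[OF R that] rotate_mat_in_proj_space[OF R' that] rotate_mat_inverse[OF R that]
      rotate_mat_inverse[OF R' that] by simp_all
  fix A B :: "'f sqmat"
  define D where "D k l = A k l - B k l" for k l
  have "frob n (rotate_mat n R A) (rotate_mat n R B) = (\<Sum>i\<le>n. \<Sum>j\<le>n. (norm (\<Sum>k\<le>n. R i k *\<^sub>R (\<Sum>l\<le>n. R j l *\<^sub>R D k l)))\<^sup>2)"
    unfolding frob_def
    by (intro sum.cong refl) (simp add: rotate_mat_eq D_def sum_subtractf scaleR_diff_right)
  also have "\<dots> = (\<Sum>j\<le>n. \<Sum>k\<le>n. (norm (\<Sum>l\<le>n. R j l *\<^sub>R D k l))\<^sup>2)"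
    by (subst sum.swap) (simp add: orthogonal_sum_norm[OF R])
  also have "\<dots> = frob n A B"
    by (subst sum.swap) (simp add: orthogonal_sum_norm[OF R] frob_def D_def)
  finally show "frob n (rotate_mat n R A) (rotate_mat n R B) = frob n A B" .
qed

definition plane_rotation :: "nat \<Rightarrow> nat \<Rightarrow> real \<Rightarrow> real \<Rightarrow> nat \<Rightarrow> nat \<Rightarrow> real" where
  "plane_rotation p q c s i k =
     (if i = p then (if k = p then c else if k = q then s else 0)
      else if i = q then (if k = p then - s else if k = q then c else 0)
      else if i = k then 1 else 0)"

lemma plane_rotation_sum:
  fixes v :: "nat \<Rightarrow> 'f::real_vector"
  assumes "p \<noteq> q" "p \<le> n" "q \<le> n" "i \<le> n"
  shows "(\<Sum>k\<le>n. plane_rotation p q c s i k *\<^sub>R v k) =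
    (if i = p then c *\<^sub>R v p + s *\<^sub>R v q else if i = q then c *\<^sub>R v q - s *\<^sub>R v p else v i)"
proof -
  have two: "(\<Sum>k\<le>n. (if k = p then a else if k = q then b else 0) *\<^sub>R v k) = a *\<^sub>R v p + b *\<^sub>R v q" for a b
  proof -
    have "(\<Sum>k\<le>n. (if k = p then a else if k = q then b else 0) *\<^sub>R v k) =
      (\<Sum>k\<le>n. (if k = p then a *\<^sub>R v k else 0) + (if k = q then b *\<^sub>R v k else 0))"
      using assms(1) by (intro sum.cong) auto
    then show ?thesis using assms by (simp add: sum.distrib)
  qed
  have one: "(\<Sum>k\<le>n. (if i = k then 1 else 0) *\<^sub>R v k) = v i"
    using assms(4) by (simp add: if_distrib[of "\<lambda>x. x *\<^sub>R _"] cong: if_cong)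
  show ?thesis unfolding plane_rotation_def
    using two[of c s] two[of "- s" c] one assms(1) by (auto simp: add.commute)
qed

lemma plane_rotation_orthogonal:
  assumes pq: "p \<noteq> q" "p \<le> n" "q \<le> n" and cs: "c\<^sup>2 + s\<^sup>2 = 1"
  shows "orthogonal_upto n (plane_rotation p q c s)"
proof -
  have 1: "(\<Sum>k\<le>n. plane_rotation p q c s i k * plane_rotation p q c s j k) = (if i = j then 1 else 0)"
    if "i \<le> n" "c\<^sup>2 + s\<^sup>2 = 1" for i j c s
    using plane_rotation_sum[OF pq that(1), of c s "\<lambda>k. plane_rotation p q c s j k"] that(2) pq(1)
    by (auto simp: plane_rotation_def power2_eq_square)
  \<comment> \<open>Transposing a plane rotation reverses its angle.\<close>
  have t: "plane_rotation p q c s k i = plane_rotation p q c (- s) i k" for i k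
    using pq(1) by (auto simp: plane_rotation_def)
  have 2: "(\<Sum>k\<le>n. plane_rotation p q c s k i * plane_rotation p q c s k j) = (if i = j then 1 else 0)"
    if "i \<le> n" for i j
    using 1[OF that, of c "- s" j] cs unfolding t by simp
  show ?thesis unfolding orthogonal_upto_def using 1[OF _ cs] 2 by auto
qed

lemma rotate_mat_plane:
  fixes X :: "'f::composition_algebra sqmat" and c s :: real
  assumes pq: "p \<noteq> q" "p \<le> n" "q \<le> n" and ij: "i \<le> n" "j \<le> n"
  defines "v \<equiv> \<lambda>k. if j = p then c *\<^sub>R X k p + s *\<^sub>R X k q else if j = q then c *\<^sub>R X k q - s *\<^sub>R X k p else X k j"
  shows "rotate_mat n (plane_rotation p q c s) X i j =
    (if i = p then c *\<^sub>R v p + s *\<^sub>R v q else if i = q then c *\<^sub>R v q - s *\<^sub>R v p else v i)"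
  unfolding rotate_mat_eq[OF ij] plane_rotation_sum[OF pq ij(2)] v_def[symmetric] plane_rotation_sum[OF pq ij(1)]
  by (simp add: v_def)

text \<open>The geodesic from the projection onto the axis $0$ towards the unit vector $\varepsilon$ in the axis $i$.\<close>

definition proj_geodesic :: "nat \<Rightarrow> 'f::composition_algebra \<Rightarrow> real \<Rightarrow> 'f sqmat" where
  "proj_geodesic i \<epsilon> s = (\<lambda>k l.
     if k = 0 \<and> l = 0 then (cos (s / 2))\<^sup>2 *\<^sub>R 1
     else if k = 0 \<and> l = i then (cos (s / 2) * sin (s / 2)) *\<^sub>R \<epsilon>
     else if k = i \<and> l = 0 then (cos (s / 2) * sin (s / 2)) *\<^sub>R hconj \<epsilon>
     else if k = i \<and> l = i then (sin (s / 2))\<^sup>2 *\<^sub>R 1 else 0)"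

definition axis0 :: "'f::composition_algebra sqmat" where
  "axis0 = (\<lambda>k l. if k = 0 \<and> l = 0 then 1 else 0)"

lemma proj_geodesic_0 [simp]: "proj_geodesic i \<epsilon> 0 = axis0"
  by (auto simp: proj_geodesic_def axis0_def fun_eq_iff)

lemma sum_atMost_two:
  fixes f :: "nat \<Rightarrow> 'b::comm_monoid_add"
  assumes "1 \<le> i" "i \<le> n" "\<And>k. k \<le> n \<Longrightarrow> k \<noteq> 0 \<Longrightarrow> k \<noteq> i \<Longrightarrow> f k = 0"
  shows "(\<Sum>k\<le>n. f k) = f 0 + f i"
proof -
  have "(\<Sum>k\<le>n. f k) = (\<Sum>k\<in>{0, i}. f k)"
    using assms by (intro sum.mono_neutral_right) auto
  then show ?thesis using assms(1) by simp
qed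

lemma proj_geodesic_in:
  fixes \<epsilon> :: "'f::composition_algebra"
  assumes i: "1 \<le> i" "i \<le> n" and \<epsilon>: "norm \<epsilon> = 1"
  shows "proj_geodesic i \<epsilon> s \<in> proj_space n"
proof (rule proj_spaceI)
  define c where "c = cos (s / 2)"
  define z where "z = sin (s / 2)"
  have cz: "c * c + z * z = 1" unfolding c_def z_def power2_eq_square[symmetric] by simp
  define p where "p = proj_geodesic i \<epsilon> s"
  have p: "p 0 0 = (c * c) *\<^sub>R 1" "p 0 i = (c * z) *\<^sub>R \<epsilon>" "p i 0 = (c * z) *\<^sub>R hconj \<epsilon>" "p i i = (z * z) *\<^sub>R 1"
    using i by (auto simp: p_def proj_geodesic_def c_def z_def power2_eq_square)
  have p0: "p k l = 0" if "k \<noteq> 0 \<and> k \<noteq> i \<or> l \<noteq> 0 \<and> l \<noteq> i" for k l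
    using that by (auto simp: p_def proj_geodesic_def)
  show "proj_geodesic i \<epsilon> s k l = 0" if "k > n \<or> l > n" for k l
    using p0[of k l] that i by (auto simp: p_def)
  show "proj_geodesic i \<epsilon> s l k = hconj (proj_geodesic i \<epsilon> s k l)" for k l
    using i by (auto simp: proj_geodesic_def hconj_scaleR)
  show "(\<Sum>m\<le>n. proj_geodesic i \<epsilon> s k m * proj_geodesic i \<epsilon> s m l) = proj_geodesic i \<epsilon> s k l" if "k \<le> n" "l \<le> n" for k l
  proof -
    have e: "\<epsilon> * hconj \<epsilon> = 1" "hconj \<epsilon> * \<epsilon> = 1" using \<epsilon> by (simp_all add: mult_hconj_self hconj_mult_self)
    have "(\<Sum>m\<le>n. p k m * p m l) = p k 0 * p 0 l + p k i * p i l"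
      by (rule sum_atMost_two[OF i]) (simp add: p0)
    also have "\<dots> = p k l"
    proof (cases "k \<noteq> 0 \<and> k \<noteq> i \<or> l \<noteq> 0 \<and> l \<noteq> i")
      case True
      then show ?thesis using p0 by (metis add.right_neutral hmult_zero_left hmult_zero_right)
    next
      case False
      have 1: "c * c * (c * c) + c * z * (c * z) = c * c" "c * z * (c * z) + z * z * (z * z) = z * z"
        "c * c * (c * z) + c * z * (z * z) = c * z" "c * z * (c * c) + z * z * (c * z) = c * z"
        using cz by (algebra+)
      have k: "k = 0 \<or> k = i" and l: "l = 0 \<or> l = i" using False by auto
      show ?thesis
        using k l 1 by (elim disjE) (simp_all add: p hmult_scaleR_left hmult_scaleR_right e scaleR_add_left[symmetric])
    qed
    finally show ?thesis unfolding p_def .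
  qed
  have "(\<Sum>m\<le>n. p m m) = p 0 0 + p i i"
    by (rule sum_atMost_two[OF i]) (simp add: p0)
  also have "\<dots> = 1" using cz by (simp add: p scaleR_add_left[symmetric])
  finally show "(\<Sum>m\<le>n. proj_geodesic i \<epsilon> s m m) = 1" unfolding p_def .
qed

lemma axis0_in: "1 \<le> n \<Longrightarrow> (axis0 :: 'f::composition_algebra sqmat) \<in> proj_space n"
  using proj_geodesic_in[of 1 n "1 :: 'f" 0] by simp

text \<open>Projections have Frobenius norm 1, so the squared distance is 2 minus twice the inner
  product, to which only the block of the indices 0 and \<open>i\<close> contributes. Passing from
  s/2 to s yields the coefficients \<open>A\<close>, \<open>B\<close>, \<open>C\<close> of the
  frame.\<close>

lemma frob_proj_geodesic:
  fixes Z :: "'f::composition_algebra sqmat"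
  assumes i: "1 \<le> i" "i \<le> n" and \<epsilon>: "norm \<epsilon> = 1" and Z: "Z \<in> proj_space n"
  shows "frob n (proj_geodesic i \<epsilon> s) Z =
    2 - (hreal (Z 0 0) + hreal (Z i i)) - (hreal (Z 0 0) - hreal (Z i i)) * cos s - 2 * inner \<epsilon> (Z 0 i) * sin s"
proof -
  define p where "p = proj_geodesic i \<epsilon> s"
  define c where "c = cos (s / 2)"
  define z where "z = sin (s / 2)"
  have p: "p 0 0 = c\<^sup>2 *\<^sub>R 1" "p 0 i = (c * z) *\<^sub>R \<epsilon>" "p i 0 = (c * z) *\<^sub>R hconj \<epsilon>" "p i i = z\<^sup>2 *\<^sub>R 1"
    using i by (auto simp: p_def proj_geodesic_def c_def z_def)
  have p0: "p k l = 0" if "k \<noteq> 0 \<and> k \<noteq> i \<or> l \<noteq> 0 \<and> l \<noteq> i" for k l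
    using that by (auto simp: p_def proj_geodesic_def)
  have pP: "p \<in> proj_space n" unfolding p_def by (rule proj_geodesic_in[OF i \<epsilon>])
  have "(norm (p k l - Z k l))\<^sup>2 = (norm (p k l))\<^sup>2 + (norm (Z k l))\<^sup>2 - 2 * inner (p k l) (Z k l)" for k l
    by (simp add: power2_norm_eq_inner inner_diff_left inner_diff_right inner_commute)
  then have "frob n p Z = 1 + 1 - 2 * (\<Sum>k\<le>n. \<Sum>l\<le>n. inner (p k l) (Z k l))"
    unfolding frob_def by (simp add: sum.distrib sum_subtractf proj_norm2[OF pP] proj_norm2[OF Z] sum_distrib_left[symmetric])
  also have "(\<Sum>k\<le>n. \<Sum>l\<le>n. inner (p k l) (Z k l)) =
      (inner (p 0 0) (Z 0 0) + inner (p 0 i) (Z 0 i)) + (inner (p i 0) (Z i 0) + inner (p i i) (Z i i))"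
    by (subst sum_atMost_two[OF i], simp add: p0, subst (1 2) sum_atMost_two[OF i]) (simp_all add: p0)
  also have "\<dots> = c\<^sup>2 * hreal (Z 0 0) + 2 * (c * z) * inner \<epsilon> (Z 0 i) + z\<^sup>2 * hreal (Z i i)"
  proof -
    have "inner (hconj \<epsilon>) (Z i 0) = inner \<epsilon> (Z 0 i)"
      using proj_spaceD(2)[OF Z, of 0 i] i by simp
    then show ?thesis unfolding p by (simp add: hreal_def inner_commute)
  qed
  also have "2 * (c * z) = sin s" using sin_double[of "s / 2"] by (simp add: c_def z_def)
  also have "c\<^sup>2 = (1 + cos s) / 2" using cos_double_cos[of "s / 2"] by (simp add: c_def)
  also have "z\<^sup>2 = (1 - cos s) / 2" using cos_double_sin[of "s / 2"] by (simp add: z_def)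
  finally show ?thesis unfolding p_def by (simp add: field_simps)
qed

lemma frob_axis0:
  assumes "1 \<le> n" "Z \<in> proj_space n"
  shows "frob n axis0 (Z :: 'f::composition_algebra sqmat) = 2 - 2 * hreal (Z 0 0)"
  using frob_proj_geodesic[of 1 n "1 :: 'f" Z 0] assms by simp

lemma proj_diag_le_1:
  assumes "X \<in> proj_space n" "i \<le> n"
  shows "hreal (X i i) \<le> 1"
proof -
  have "hreal (X i i) \<le> (\<Sum>i\<le>n. hreal (X i i))"
    using assms proj_diag_nonneg[OF assms(1)] by (intro member_le_sum) auto
  then show ?thesis using proj_trace[OF assms(1)] by simp
qed

text \<open>The other diagonal entries are nonnegative with sum 0, and a zero diagonal entry
  annihilates its row and column.\<close>

lemma proj_eq_axis0:
  fixes Z :: "'f::composition_algebra sqmat"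
  assumes n: "1 \<le> n" and Z: "Z \<in> proj_space n" and 1: "hreal (Z 0 0) = 1"
  shows "Z = axis0"
proof -
  have z: "hreal (Z i i) = 0" if "i \<le> n" "i \<noteq> 0" for i
  proof -
    have "hreal (Z 0 0) + hreal (Z i i) = (\<Sum>k\<in>{0, i}. hreal (Z k k))" using that by simp
    also have "\<dots> \<le> (\<Sum>k\<le>n. hreal (Z k k))"
      using that proj_diag_nonneg[OF Z] by (intro sum_mono2) auto
    finally show ?thesis using proj_trace[OF Z] proj_diag_nonneg[OF Z that(1)] 1 by simp
  qed
  show ?thesis
  proof (rule proj_space_eqI[OF Z axis0_in[OF n]])
    fix i j assume ij: "i \<le> n" "j \<le> n"
    show "Z i j = axis0 i j"
      using proj_diag[OF Z, of 0] 1 proj_zero_row[OF Z z, of i j] proj_zero_row[OF Z z, of j i] ij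
      by (cases "i = 0"; cases "j = 0") (auto simp: axis0_def)
  qed
qed

lemma twist_axis0 [simp]: "twist m u axis0 = axis0"
  by (auto simp: twist_def axis0_def fun_eq_iff)

lemma rotate_mat_axis0:
  assumes "p \<noteq> q" "1 \<le> p" "1 \<le> q" "p \<le> n" "q \<le> n" "c\<^sup>2 + s\<^sup>2 = 1"
  shows "rotate_mat n (plane_rotation p q c s) axis0 = (axis0 :: 'f::composition_algebra sqmat)"
proof (rule proj_eq_axis0)
  have ax: "(axis0 :: 'f sqmat) \<in> proj_space n" using assms by (intro axis0_in) auto
  show "rotate_mat n (plane_rotation p q c s) (axis0 :: 'f sqmat) \<in> proj_space n"
    by (rule rotate_mat_in_proj_space[OF plane_rotation_orthogonal ax]) (use assms in auto)
  show "hreal (rotate_mat n (plane_rotation p q c s) axis0 0 0 :: 'f) = 1"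
    using assms by (subst rotate_mat_plane) (auto simp: axis0_def)
qed (use assms in auto)

section \<open>Normal form of a pair of projections\<close>

lemma unit_phase:
  fixes x e :: "'f::composition_algebra"
  assumes "norm e = 1"
  obtains u where "norm u = 1" "u * x = norm x *\<^sub>R e"
proof (cases "x = 0")
  case True
  then show ?thesis using that[of 1] by simp
next
  case False
  define u where "u = (1 / norm x) *\<^sub>R (e * hconj x)"
  have "norm u = 1" using assms False by (simp add: u_def norm_hmult)
  moreover have "u * x = norm x *\<^sub>R e"
    using False by (simp add: u_def hmult_scaleR_left hconj_cancel_right' power2_eq_square)
  ultimately show ?thesis using that by blast
qed

lemma unit_phase_right:
  fixes x :: "'f::composition_algebra"
  obtains u where "norm u = 1" "x * u = norm x *\<^sub>R 1"
proof -
  obtain v where v: "norm v = 1" "v * hconj x = norm (hconj x) *\<^sub>R 1"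
    using unit_phase[of "1 :: 'f" "hconj x"] by auto
  have "x * hconj v = norm x *\<^sub>R 1" using arg_cong[OF v(2), of hconj] by (simp add: hconj_mult hconj_scaleR)
  then show ?thesis using that[of "hconj v"] v(1) by simp
qed

context
  fixes n :: nat and T :: "'f::composition_algebra itself"
  assumes n: "2 \<le> n" and tc: "twist_compatible T n"
begin

lemma twist_compatible_TYPE: "twist_compatible TYPE('f) n"
  using tc by (simp add: twist_compatible_def)

text \<open>A twist makes the entry (1, m) real and nonnegative; by rank one it is sqrt a sqrt b.
  The block of 1 and m is then a real matrix built from the vector (sqrt a, sqrt b), and a plane
  rotation turns this vector onto axis 1.\<close>

lemma kill_diagonal:
  fixes X :: "'f sqmat"
  assumes X: "X \<in> proj_space n" and m: "2 \<le> m" "m \<le> n"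
  shows "\<exists>g :: 'f sqmat \<Rightarrow> 'f sqmat. proj_isometry n g \<and> g axis0 = axis0 \<and> g X m m = 0 \<and>
    (\<forall>i\<le>n. m < i \<longrightarrow> g X i i = X i i)"
proof -
  obtain u where u: "norm u = 1" "X 1 m * u = norm (X 1 m) *\<^sub>R 1" using unit_phase_right by blast
  define Y where "Y = twist m u X"
  define y where "y = norm (X 1 m)"
  have Y: "Y \<in> proj_space n" unfolding Y_def by (rule twist_in_proj_space[OF twist_compatible_TYPE m u(1) X])
  have Yd: "Y i i = X i i" for i by (simp add: Y_def twist_def)
  have Y1m: "Y 1 m = y *\<^sub>R 1" using m u by (simp add: Y_def twist_def twist_factor_def y_def)
  have Ym1: "Y m 1 = y *\<^sub>R 1" using proj_spaceD(2)[OF Y, of 1 m] m Y1m by (simp add: hconj_scaleR)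
  define a where "a = hreal (X 1 1)"
  define b where "b = hreal (X m m)"
  have ab: "a \<ge> 0" "b \<ge> 0" using proj_diag_nonneg[OF X] m by (auto simp: a_def b_def)
  have "y\<^sup>2 = a * b" using proj_rank_one[OF X, of 1 m] m by (simp add: y_def a_def b_def)
  then have y: "y = sqrt a * sqrt b" by (metis real_sqrt_mult real_sqrt_unique norm_ge_zero y_def)
  have Y11: "Y 1 1 = a *\<^sub>R 1" using proj_diag[OF X, of 1] m by (simp add: Yd a_def)
  have Ymm: "Y m m = b *\<^sub>R 1" using proj_diag[OF X, of m] m by (simp add: Yd b_def)
  \<comment> \<open>The rotation follows the direction of (sqrt a, sqrt b). If this vector is 0, the
    identity serves.\<close>
  obtain c s where cs: "c\<^sup>2 + s\<^sup>2 = 1" "c * sqrt b = s * sqrt a"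
  proof (cases "a + b = 0")
    case True
    then have "a = 0" "b = 0" using ab by auto
    then show ?thesis using that[of 1 0] by simp
  next
    case False
    then have "a + b > 0" using ab by simp
    then have "(sqrt a / sqrt (a + b))\<^sup>2 + (sqrt b / sqrt (a + b))\<^sup>2 = 1"
      using ab by (simp add: power_divide add_divide_distrib[symmetric])
    then show ?thesis using that[of "sqrt a / sqrt (a + b)" "sqrt b / sqrt (a + b)"] by simp
  qed
  have o: "orthogonal_upto n (plane_rotation 1 m c s)"
    using m cs(1) by (intro plane_rotation_orthogonal) auto
  define g where "g = rotate_mat n (plane_rotation 1 m c s) \<circ> twist m u"
  have gm: "1 \<noteq> m" "1 \<le> n" using m by auto
  have "proj_isometry n g"
    unfolding g_def by (rule proj_isometry_comp[OF rotate_mat_isometry[OF o] twist_isometry[OF twist_compatible_TYPE m u(1)]])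
  moreover have "g axis0 = axis0"
    unfolding g_def using m cs(1) by (simp add: rotate_mat_axis0)
  moreover have "g X m m = 0"
  proof -
    have "g X m m = c *\<^sub>R (c *\<^sub>R Y m m - s *\<^sub>R Y m 1) - s *\<^sub>R (c *\<^sub>R Y 1 m - s *\<^sub>R Y 1 1)"
      unfolding g_def comp_def Y_def[symmetric] using gm m by (subst rotate_mat_plane) auto
    also have "\<dots> = (c * (c * b - s * y) - s * (c * y - s * a)) *\<^sub>R 1"
      unfolding Ym1 Y1m Y11 Ymm by (simp only: scaleR_scaleR scaleR_diff_left[symmetric])
    also have "c * (c * b - s * y) - s * (c * y - s * a) = (c * sqrt b - s * sqrt a)\<^sup>2"
    proof -
      have "b = sqrt b * sqrt b" "a = sqrt a * sqrt a" using ab by simp_all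
      then show ?thesis unfolding y power2_eq_square by (simp add: algebra_simps)
    qed
    also have "\<dots> = 0" using cs(2) by simp
    finally show ?thesis by simp
  qed
  moreover have "g X i i = X i i" if "i \<le> n" "m < i" for i
    unfolding g_def comp_def Y_def[symmetric] using gm m that
    by (subst rotate_mat_plane) (auto simp: Yd)
  ultimately show ?thesis by blast
qed

text \<open>Works downwards from index n to index 2: \<open>kill_diagonal\<close> leaves the
  diagonal beyond m unchanged, so the zeros already made persist.\<close>

lemma kill_diagonals:
  fixes X :: "'f sqmat"
  assumes X: "X \<in> proj_space n"
  shows "k \<le> n - 1 \<Longrightarrow> \<exists>g :: 'f sqmat \<Rightarrow> 'f sqmat. proj_isometry n g \<and> g axis0 = axis0 \<and> (\<forall>i\<le>n. n - k < i \<longrightarrow> g X i i = 0)"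
proof (induction k)
  case 0
  show ?case by (intro exI[of _ "\<lambda>x. x"]) (auto simp: proj_isometry_id)
next
  case (Suc k)
  then obtain g :: "'f sqmat \<Rightarrow> 'f sqmat" where g: "proj_isometry n g" "g axis0 = axis0" "\<And>i. i \<le> n \<Longrightarrow> n - k < i \<Longrightarrow> g X i i = 0" by auto
  define m where "m = n - k"
  have m: "2 \<le> m" "m \<le> n" using Suc.prems n by (auto simp: m_def)
  obtain h :: "'f sqmat \<Rightarrow> 'f sqmat" where h: "proj_isometry n h" "h axis0 = axis0" "h (g X) m m = 0" "\<And>i. i \<le> n \<Longrightarrow> m < i \<Longrightarrow> h (g X) i i = g X i i"
    using kill_diagonal[OF proj_isometry_in[OF g(1) X] m] by blast
  have "(h \<circ> g) X i i = 0" if "i \<le> n" "n - Suc k < i" for i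
  proof (cases "i = m")
    case False
    then have "m < i" using that by (auto simp: m_def)
    then show ?thesis using h(4)[of i] g(3)[of i] that by (simp add: m_def)
  qed (use h in simp)
  moreover have "(h \<circ> g) axis0 = axis0" using h(2) g(2) by simp
  ultimately show ?case using proj_isometry_comp[OF h(1) g(1)] by blast
qed

text \<open>Once the diagonal vanishes beyond index 1, only the block of 0 and 1 is left. A last
  twist, for which index 2 must exist, gives its off-diagonal entry the direction \<epsilon>; trace
  1 and rank one leave a single real parameter, which the distance from \<open>axis0\<close>
  fixes.\<close>

lemma proj_normal_form:
  fixes X :: "'f sqmat" and \<epsilon> :: 'f
  assumes X: "X \<in> proj_space n" and \<epsilon>: "norm \<epsilon> = 1"
  shows "\<exists>g :: 'f sqmat \<Rightarrow> 'f sqmat. proj_isometry n g \<and> g axis0 = axis0 \<and> g X = proj_geodesic 1 \<epsilon> (proj_dist n axis0 X)"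
proof -
  have ax: "(axis0 :: 'f sqmat) \<in> proj_space n" using n by (intro axis0_in) auto
  obtain g :: "'f sqmat \<Rightarrow> 'f sqmat" where g: "proj_isometry n g" "g axis0 = axis0" "\<And>i. i \<le> n \<Longrightarrow> 1 < i \<Longrightarrow> g X i i = 0"
    using kill_diagonals[OF X, of "n - 1"] n by auto
  define x where "x = g X 0 1"
  obtain u where u: "norm u = 1" "u * x = norm x *\<^sub>R \<epsilon>" using unit_phase[OF \<epsilon>] by blast
  define h where "h = twist 2 u \<circ> g"
  have h: "proj_isometry n h"
    unfolding h_def using n by (intro proj_isometry_comp twist_isometry twist_compatible_TYPE u g) auto
  have h0: "h axis0 = axis0" by (simp add: h_def g(2))
  define Y where "Y = h X"
  have Y: "Y \<in> proj_space n" unfolding Y_def by (rule proj_isometry_in[OF h X])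
  have Yd: "Y i i = 0" if "i \<le> n" "1 < i" for i using g(3)[OF that] by (simp add: Y_def h_def twist_def)
  have Y01: "Y 0 1 = norm x *\<^sub>R \<epsilon>" using u(2) by (simp add: Y_def h_def twist_def twist_factor_def x_def)
  define a where "a = hreal (Y 0 0)"
  have a: "0 \<le> a" "a \<le> 1" using proj_diag_nonneg[OF Y] proj_diag_le_1[OF Y] by (auto simp: a_def)
  have Y00: "Y 0 0 = a *\<^sub>R 1" using proj_diag[OF Y, of 0] by (simp add: a_def)
  have "(\<Sum>i\<le>n. hreal (Y i i)) = hreal (Y 0 0) + hreal (Y 1 1)"
    using n by (intro sum_atMost_two) (auto simp: Yd)
  then have tr: "hreal (Y 1 1) = 1 - a" using proj_trace[OF Y] by (simp add: a_def)
  have Y11: "Y 1 1 = (1 - a) *\<^sub>R 1" using proj_diag[OF Y, of 1] n tr by simp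
  have "(norm x)\<^sup>2 = a * (1 - a)"
    using proj_rank_one[OF Y, of 0 1] n \<epsilon> unfolding Y01 tr a_def[symmetric] by simp
  then have x: "norm x = sqrt a * sqrt (1 - a)" by (metis norm_ge_zero real_sqrt_mult real_sqrt_unique)
  have Y10: "Y 1 0 = norm x *\<^sub>R hconj \<epsilon>" using proj_spaceD(2)[OF Y, of 0 1] n unfolding Y01 by (simp add: hconj_scaleR)
  define s where "s = proj_dist n axis0 X"
  have "frob n axis0 X = frob n axis0 Y"
    using h X ax h0 by (auto simp: proj_isometry_def Y_def)
  also have "\<dots> = 2 - 2 * a" using n Y by (simp add: frob_axis0 a_def)
  finally have "s = 2 * arcsin (sqrt (2 * (1 - a)) / sqrt 2)"
    by (simp add: s_def proj_dist_def frob_def)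
  also have "sqrt (2 * (1 - a)) / sqrt 2 = sqrt (1 - a)" unfolding real_sqrt_mult by simp
  finally have s: "s / 2 = arcsin (sqrt (1 - a))" by simp
  have sc: "sin (s / 2) = sqrt (1 - a)" "cos (s / 2) = sqrt a"
  proof -
    have b: "-1 \<le> sqrt (1 - a)" "sqrt (1 - a) \<le> 1"
      using a by (auto intro: order_trans[of _ 0])
    show "sin (s / 2) = sqrt (1 - a)" unfolding s by (rule sin_arcsin[OF b])
    show "cos (s / 2) = sqrt a" unfolding s cos_arcsin[OF b] using a by simp
  qed
  have "Y = proj_geodesic 1 \<epsilon> s"
  proof (rule proj_space_eqI[OF Y proj_geodesic_in])
    fix i j assume ij: "i \<le> n" "j \<le> n"
    consider "i \<in> {0, 1}" "j \<in> {0, 1}" | "1 < i" | "1 < j" by fastforce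
    then show "Y i j = proj_geodesic 1 \<epsilon> s i j"
    proof cases
      case 1
      then show ?thesis using a by (auto simp: Y00 Y01[unfolded One_nat_def] Y10[unfolded One_nat_def] Y11[unfolded One_nat_def]
            proj_geodesic_def sc x mult.commute)
    next
      case 2
      then show ?thesis using proj_zero_row(1)[OF Y _ ij] Yd[OF ij(1)] by (auto simp: proj_geodesic_def)
    next
      case 3
      then show ?thesis using proj_zero_row(2)[OF Y _ ij(2,1)] Yd[OF ij(2)] by (auto simp: proj_geodesic_def)
    qed
  qed (use n \<epsilon> in auto)
  then show ?thesis using h h0 by (auto simp: Y_def s_def)
qed

text \<open>The normal form puts X on a geodesic through \<open>axis0\<close>, and a rotation of the
  axes 0 and 1 by the half angle s/2 carries it to \<open>axis0\<close>. The normal form of the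
  image of Y keeps \<open>axis0\<close> fixed.\<close>

lemma proj_move:
  fixes X Y :: "'f sqmat" and \<epsilon> :: 'f
  assumes X: "X \<in> proj_space n" and Y: "Y \<in> proj_space n" and \<epsilon>: "norm \<epsilon> = 1"
  shows "\<exists>g :: 'f sqmat \<Rightarrow> 'f sqmat. proj_isometry n g \<and> g X = axis0 \<and> g Y = proj_geodesic 1 \<epsilon> (proj_dist n X Y)"
proof -
  obtain g :: "'f sqmat \<Rightarrow> 'f sqmat" and s where g: "proj_isometry n g" "g X = proj_geodesic 1 1 s"
    using proj_normal_form[OF X, of 1] by auto
  define c where "c = cos (s / 2)"
  define z where "z = sin (s / 2)"
  have cz: "c\<^sup>2 + z\<^sup>2 = 1" by (simp add: c_def z_def)
  define h :: "'f sqmat \<Rightarrow> 'f sqmat" where "h = rotate_mat n (plane_rotation 0 1 c z)"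
  have o: "orthogonal_upto n (plane_rotation 0 1 c z)"
    using n cz by (intro plane_rotation_orthogonal) auto
  have h: "proj_isometry n h" unfolding h_def by (rule rotate_mat_isometry[OF o])
  have "h (g X) = axis0"
  proof (rule proj_eq_axis0)
    show "1 \<le> n" using n by simp
    show "h (g X) \<in> proj_space n" by (intro proj_isometry_in[OF h] proj_isometry_in[OF g(1)] X)
    have p: "proj_geodesic 1 1 s 0 0 = (c\<^sup>2) *\<^sub>R (1::'f)" "proj_geodesic 1 1 s 0 1 = (c * z) *\<^sub>R (1::'f)"
      "proj_geodesic 1 1 s 1 0 = (c * z) *\<^sub>R (1::'f)" "proj_geodesic 1 1 s 1 1 = (z\<^sup>2) *\<^sub>R (1::'f)"
      by (auto simp: proj_geodesic_def c_def z_def)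
    have "h (g X) 0 0 = c *\<^sub>R (c *\<^sub>R proj_geodesic 1 1 s 0 0 + z *\<^sub>R proj_geodesic 1 1 s 0 1) + z *\<^sub>R (c *\<^sub>R proj_geodesic 1 1 s 1 0 + z *\<^sub>R proj_geodesic 1 1 s 1 1)"
      unfolding h_def g(2) using n by (subst rotate_mat_plane) auto
    also have "\<dots> = (c * (c * c\<^sup>2 + z * (c * z)) + z * (c * (c * z) + z * z\<^sup>2)) *\<^sub>R 1"
      unfolding p by (simp only: scaleR_scaleR scaleR_add_left[symmetric])
    also have "c * (c * c\<^sup>2 + z * (c * z)) + z * (c * (c * z) + z * z\<^sup>2) = (c\<^sup>2 + z\<^sup>2)\<^sup>2"
      by (simp add: power2_eq_square algebra_simps)
    finally show "hreal (h (g X) 0 0) = 1" by (simp add: cz)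
  qed
  moreover obtain k :: "'f sqmat \<Rightarrow> 'f sqmat" where k: "proj_isometry n k" "k axis0 = axis0"
    "k (h (g Y)) = proj_geodesic 1 \<epsilon> (proj_dist n axis0 (h (g Y)))"
    using proj_normal_form[OF proj_isometry_in[OF h proj_isometry_in[OF g(1) Y]] \<epsilon>] by blast
  moreover have hg: "proj_isometry n (h \<circ> g)" by (rule proj_isometry_comp[OF h g(1)])
  moreover have "proj_dist n ((h \<circ> g) X) ((h \<circ> g) Y) = proj_dist n X Y"
    using isometry_betw_proj[OF hg] X Y by (auto simp: isometry_betw_def)
  ultimately show ?thesis
    using proj_isometry_comp[OF k(1) hg] by (intro exI[of _ "k \<circ> (h \<circ> g)"]) simp
qed

text \<open>After X is moved to \<open>axis0\<close> the upper bound is the nonnegativity of a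
  diagonal entry. It keeps the argument of the arcsine in [0, 1].\<close>

lemma frob_range:
  fixes X Y :: "'f sqmat"
  assumes X: "X \<in> proj_space n" and Y: "Y \<in> proj_space n"
  shows "0 \<le> frob n X Y" "frob n X Y \<le> 2"
proof -
  show "0 \<le> frob n X Y" by (auto simp: frob_def intro!: sum_nonneg)
  obtain g :: "'f sqmat \<Rightarrow> 'f sqmat" where g: "proj_isometry n g" "g X = axis0" using proj_move[OF X Y, of 1] by auto
  have gY: "g Y \<in> proj_space n" by (rule proj_isometry_in[OF g(1) Y])
  have "frob n X Y = frob n axis0 (g Y)" using g X Y by (auto simp: proj_isometry_def)
  also have "\<dots> = 2 - 2 * hreal (g Y 0 0)" using n gY by (simp add: frob_axis0)
  finally show "frob n X Y \<le> 2" using proj_diag_nonneg[OF gY, of 0] by simp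
qed

lemma proj_dist_range:
  fixes X Y :: "'f sqmat"
  assumes X: "X \<in> proj_space n" and Y: "Y \<in> proj_space n"
  shows "proj_dist n X Y \<in> {0..pi}" "cos (proj_dist n X Y) = 1 - frob n X Y"
proof -
  define w where "w = sqrt (frob n X Y) / sqrt 2"
  have w: "0 \<le> w" "w \<le> 1" using frob_range[OF X Y] by (auto simp: w_def divide_le_eq)
  have d: "proj_dist n X Y = 2 * arcsin w" by (simp add: proj_dist_def w_def frob_def)
  have "arcsin w \<le> pi / 2" "0 \<le> arcsin w" using w arcsin_ubound[of w] arcsin_le_arcsin[of 0 w] by auto
  then show "proj_dist n X Y \<in> {0..pi}" unfolding d by auto
  have "cos (proj_dist n X Y) = 1 - 2 * (sin (arcsin w))\<^sup>2" unfolding d by (rule cos_double_sin)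
  also have "sin (arcsin w) = w" using w by (intro sin_arcsin) auto
  also have "w\<^sup>2 = frob n X Y / 2" using frob_range(1)[OF X Y] by (simp add: w_def power_divide)
  finally show "cos (proj_dist n X Y) = 1 - frob n X Y" by simp
qed

end

section \<open>Frames of the two-point homogeneous spaces\<close>

lemma sum_div_mod:
  fixes f :: "nat \<Rightarrow> nat \<Rightarrow> 'b::comm_monoid_add"
  assumes "k > 0"
  shows "(\<Sum>u<m * k. f (u div k) (u mod k)) = (\<Sum>i<m. \<Sum>j<k. f i j)"
proof (induction m)
  case (Suc m)
  have "{..<Suc m * k} = {..<m * k} \<union> (\<lambda>j. m * k + j) ` {..<k}"
  proof (intro equalityI subsetI)
    fix u assume "u \<in> {..<Suc m * k}"
    then show "u \<in> {..<m * k} \<union> (\<lambda>j. m * k + j) ` {..<k}"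
      by (cases "u < m * k") (auto intro!: image_eqI[where x = "u - m * k"])
  qed auto
  then have "(\<Sum>u<Suc m * k. f (u div k) (u mod k)) =
      (\<Sum>u<m * k. f (u div k) (u mod k)) + (\<Sum>u\<in>(\<lambda>j. m * k + j) ` {..<k}. f (u div k) (u mod k))"
    by (simp only:) (rule sum.union_disjoint; auto)
  also have "(\<Sum>u\<in>(\<lambda>j. m * k + j) ` {..<k}. f (u div k) (u mod k)) = (\<Sum>j<k. f m j)"
    using assms by (subst sum.reindex) (auto simp: inj_on_def intro!: sum.cong)
  finally show ?case using Suc.IH by simp
qed simp

lemma euclidean_enumerated_norm:
  fixes x :: "'f::euclidean_space"
  assumes "bij_betw e {..<DIM('f)} (Basis :: 'f set)"
  shows "(\<Sum>j<DIM('f). (inner (e j) x)\<^sup>2) = (norm x)\<^sup>2"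
proof -
  have "(\<Sum>j<DIM('f). (inner (e j) x)\<^sup>2) = (\<Sum>b\<in>Basis. (inner b x)\<^sup>2)"
    by (rule sum.reindex_bij_betw[OF assms])
  also have "\<dots> = (norm x)\<^sup>2"
    unfolding power2_norm_eq_inner euclidean_inner[of x x] by (simp add: power2_eq_square inner_commute)
  finally show ?thesis .
qed

text \<open>The index u encodes a pair: the axis u div D + 1 and the basis vector of the algebra
  with number u mod D. Since t = 2 Z_00 - 1, \<open>sum_B\<close> is the trace condition, and
  \<open>sum_C\<close> follows from the norm of row 0, summed over an orthonormal basis of the
  algebra.\<close>

lemma proj_space_frame:
  fixes T :: "'f::composition_algebra itself"
  assumes n: "2 \<le> n" and tc: "twist_compatible T n"
  shows "\<exists>\<gamma> A B C. two_point_frame (proj_space n :: 'f sqmat set) (proj_dist n) (n * DIM('f)) DIM('f) \<gamma> A B C"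
proof -
  define D where "D = DIM('f)"
  have D: "D \<ge> 1" by (simp add: D_def Suc_leI)
  obtain e :: "nat \<Rightarrow> 'f" where e: "bij_betw e {..<DIM('f)} Basis"
    using ex_bij_betw_nat_finite[OF finite_Basis, where 'a1 = 'f] by (auto simp: atLeast0LessThan)
  have en: "norm (e (u mod D)) = 1" for u
  proof -
    have "e (u mod D) \<in> Basis" using bij_betw_apply[OF e, of "u mod D"] D by (simp add: D_def)
    then show ?thesis by simp
  qed
  define \<gamma> where "\<gamma> u s = proj_geodesic (u div D + 1) (e (u mod D)) s" for u s
  define A where "A u Z = hreal (Z 0 0 :: 'f) + hreal (Z (u div D + 1) (u div D + 1)) - 1" for u and Z :: "'f sqmat"
  define B where "B u Z = hreal (Z 0 0 :: 'f) - hreal (Z (u div D + 1) (u div D + 1))" for u and Z :: "'f sqmat"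
  define C where "C u Z = 2 * inner (e (u mod D)) (Z 0 (u div D + 1))" for u and Z :: "'f sqmat"
  have idx: "1 \<le> u div D + 1 \<and> u div D + 1 \<le> n" if "u < n * D" for u
    using that D less_mult_imp_div_less[of u n D] by simp
  have gin: "\<gamma> u s \<in> proj_space n" if "u < n * D" for u s
    unfolding \<gamma>_def using idx[OF that] en by (intro proj_geodesic_in) auto
  note range = proj_dist_range[OF n tc]
  have g0: "\<gamma> u 0 = axis0" for u by (simp add: \<gamma>_def)
  have ax: "(axis0 :: 'f sqmat) \<in> proj_space n" using n by (intro axis0_in) auto
  have t0: "cos (proj_dist n axis0 Z) = 2 * hreal (Z 0 0) - 1" if "Z \<in> proj_space n" for Z :: "'f sqmat"
    using range(2)[OF ax that] frob_axis0[of n Z] that n by simp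
  have "two_point_frame (proj_space n :: 'f sqmat set) (proj_dist n) (n * D) D \<gamma> A B C"
  proof
    show "1 \<le> n * D" "1 \<le> D" using n D by auto
    show "proj_dist n X Y \<in> {0..pi}" if "X \<in> proj_space n" "Y \<in> proj_space n" for X Y :: "'f sqmat"
      by (rule range(1)[OF that])
    show "proj_dist n X Y = proj_dist n Y X" for X Y :: "'f sqmat"
      by (simp add: proj_dist_def norm_minus_commute)
    show "\<gamma> u s \<in> proj_space n" if "u < n * D" for u s by (rule gin[OF that])
    show "\<gamma> u 0 = \<gamma> 0 0" for u by (simp add: g0)
    show "cos (proj_dist n (\<gamma> u s) Z) = A u Z + B u Z * cos s + C u Z * sin s"
      if "u < n * D" "Z \<in> proj_space n" for u s Z
      using range(2)[OF gin[OF that(1), of s] that(2)] frob_proj_geodesic[OF _ _ en that(2), of "u div D + 1" u s] idx[OF that(1)]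
      by (simp add: \<gamma>_def A_def B_def C_def algebra_simps)
    show "cos (proj_dist n (\<gamma> 0 0) (\<gamma> 0 s)) = cos s" for s
    proof -
      have "cos (proj_dist n (\<gamma> 0 0) (\<gamma> 0 s)) = 2 * (cos (s / 2))\<^sup>2 - 1"
        unfolding g0 using gin[of 0 s] n D by (subst t0) (auto simp: \<gamma>_def proj_geodesic_def)
      then show ?thesis using cos_double_cos[of "s / 2"] by simp
    qed
    show "(\<Sum>u<n * D. B u Z) = (real (n * D) - real D) / 2 + (real (n * D) + real D) / 2 * cos (proj_dist n (\<gamma> 0 0) Z)"
      if Z: "Z \<in> proj_space n" for Z
    proof -
      have "(\<Sum>i\<le>n. hreal (Z i i)) = hreal (Z 0 0) + (\<Sum>i<n. hreal (Z (Suc i) (Suc i)))"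
        by (simp add: sum.atMost_shift)
      then have tr: "(\<Sum>i<n. hreal (Z (Suc i) (Suc i))) = 1 - hreal (Z 0 0)" using proj_trace[OF Z] by simp
      have "(\<Sum>u<n * D. B u Z) = (\<Sum>i<n. \<Sum>j<D. hreal (Z 0 0) - hreal (Z (i + 1) (i + 1)))"
        unfolding B_def using sum_div_mod[of D "\<lambda>i j. hreal (Z 0 0) - hreal (Z (i + 1) (i + 1))" n] D by simp
      also have "\<dots> = real D * (real n * hreal (Z 0 0) - (1 - hreal (Z 0 0)))"
        by (simp add: sum_distrib_left[symmetric] sum_subtractf tr)
      finally show ?thesis unfolding g0 t0[OF Z] by (simp add: field_simps)
    qed
    show "(\<Sum>u<n * D. (C u Z)\<^sup>2) = 1 - (cos (proj_dist n (\<gamma> 0 0) Z))\<^sup>2" if Z: "Z \<in> proj_space n" for Z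
    proof -
      have "(\<Sum>k\<le>n. (norm (Z 0 k))\<^sup>2) = (norm (Z 0 0))\<^sup>2 + (\<Sum>i<n. (norm (Z 0 (Suc i)))\<^sup>2)"
        by (simp add: sum.atMost_shift)
      moreover have "(norm (Z 0 0))\<^sup>2 = (hreal (Z 0 0))\<^sup>2"
        using proj_rank_one[OF Z, of 0 0] by (simp add: power2_eq_square)
      ultimately have r: "(\<Sum>i<n. (norm (Z 0 (Suc i)))\<^sup>2) = hreal (Z 0 0) - (hreal (Z 0 0))\<^sup>2"
        using proj_row_norm[OF Z, of 0] by simp
      have "(\<Sum>u<n * D. (C u Z)\<^sup>2) = (\<Sum>i<n. \<Sum>j<D. (2 * inner (e j) (Z 0 (i + 1)))\<^sup>2)"
        unfolding C_def using sum_div_mod[of D "\<lambda>i j. (2 * inner (e j) (Z 0 (i + 1)))\<^sup>2" n] D by simp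
      also have "\<dots> = (\<Sum>i<n. 4 * (norm (Z 0 (Suc i)))\<^sup>2)"
        using euclidean_enumerated_norm[OF e]
        by (simp add: power_mult_distrib sum_distrib_left[symmetric] D_def)
      also have "\<dots> = 4 * (hreal (Z 0 0) - (hreal (Z 0 0))\<^sup>2)" by (simp add: sum_distrib_left[symmetric] r)
      finally show ?thesis unfolding g0 t0[OF Z] by (simp add: power2_eq_square algebra_simps)
    qed
    show "\<exists>g. isometry_betw g (proj_space n) (proj_dist n) (proj_space n) (proj_dist n) \<and>
        g X = \<gamma> 0 0 \<and> g Y = \<gamma> 0 (proj_dist n X Y)" if XY: "X \<in> proj_space n" "Y \<in> proj_space n" for X Y :: "'f sqmat"
    proof -
      obtain g :: "'f sqmat \<Rightarrow> 'f sqmat" where "proj_isometry n g" "g X = axis0" "g Y = proj_geodesic 1 (e 0) (proj_dist n X Y)"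
        using proj_move[OF n tc XY, of "e 0"] en[of 0] by auto
      then show ?thesis using isometry_betw_proj[of n g] by (auto simp: g0 \<gamma>_def)
    qed
  qed
  then show ?thesis unfolding D_def by blast
qed

section \<open>The spheres\<close>

definition sphere_inner :: "nat \<Rightarrow> (nat \<Rightarrow> real) \<Rightarrow> (nat \<Rightarrow> real) \<Rightarrow> real" where
  "sphere_inner d x y = (\<Sum>i\<le>d. x i * y i)"

definition reflect :: "nat \<Rightarrow> (nat \<Rightarrow> real) \<Rightarrow> (nat \<Rightarrow> real) \<Rightarrow> nat \<Rightarrow> real" where
  "reflect d v x = (\<lambda>i. if i \<le> d then x i - 2 * sphere_inner d v x / sphere_inner d v v * v i else 0)"

lemma sphere_inner_commute: "sphere_inner d x y = sphere_inner d y x"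
  by (simp add: sphere_inner_def mult.commute)

lemma std_sphere_iff: "x \<in> std_sphere d \<longleftrightarrow> (\<forall>i>d. x i = 0) \<and> sphere_inner d x x = 1"
  by (simp add: std_sphere_def sphere_inner_def power2_eq_square)

lemma sphere_inner_reflect_left:
  "sphere_inner d (reflect d v x) y = sphere_inner d x y - 2 * sphere_inner d v x / sphere_inner d v v * sphere_inner d v y"
  by (simp add: sphere_inner_def reflect_def left_diff_distrib sum_subtractf sum_distrib_left mult.assoc)

lemma sphere_inner_reflect:
  assumes "sphere_inner d v v \<noteq> 0"
  shows "sphere_inner d (reflect d v x) (reflect d v y) = sphere_inner d x y"
proof -
  have 1: "sphere_inner d v (reflect d v y) = - sphere_inner d v y"
    using sphere_inner_reflect_left[of d v y v] assms by (simp add: sphere_inner_commute)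
  have 2: "sphere_inner d x (reflect d v y) = sphere_inner d x y - 2 * sphere_inner d v y / sphere_inner d v v * sphere_inner d v x"
    using sphere_inner_reflect_left[of d v y x] by (simp add: sphere_inner_commute)
  show ?thesis unfolding sphere_inner_reflect_left 1 2 using assms by (simp add: field_simps)
qed

lemma reflect_reflect:
  assumes "sphere_inner d v v \<noteq> 0" "\<And>i. i > d \<Longrightarrow> x i = 0"
  shows "reflect d v (reflect d v x) = x"
proof
  fix i
  have "sphere_inner d v (reflect d v x) = - sphere_inner d v x"
    using sphere_inner_reflect_left[of d v x v] assms(1) by (simp add: sphere_inner_commute)
  then show "reflect d v (reflect d v x) i = x i"
    using assms(2)[of i] by (auto simp: reflect_def)
qed

lemma reflect_isometry:
  assumes "sphere_inner d v v \<noteq> 0"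
  shows "isometry_betw (reflect d v) (std_sphere d) (sphere_dist d) (std_sphere d) (sphere_dist d)"
proof -
  have "reflect d v x \<in> std_sphere d" if "x \<in> std_sphere d" for x
    using that sphere_inner_reflect[OF assms, of x x] by (auto simp: std_sphere_iff reflect_def)
  moreover have "reflect d v (reflect d v x) = x" if "x \<in> std_sphere d" for x
    using that by (intro reflect_reflect[OF assms]) (auto simp: std_sphere_iff)
  ultimately have "bij_betw (reflect d v) (std_sphere d) (std_sphere d)"
    by (intro bij_betw_byWitness[where f' = "reflect d v"]) auto
  then show ?thesis
    using sphere_inner_reflect[OF assms] by (auto simp: isometry_betw_def sphere_dist_def sphere_inner_def)
qed

lemma isometry_betw_comp:
  assumes "isometry_betw f X \<rho> Y \<sigma>" "isometry_betw g Y \<sigma> Z \<tau>"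
  shows "isometry_betw (g \<circ> f) X \<rho> Z \<tau>"
proof -
  have "f x \<in> Y" if "x \<in> X" for x using assms(1) that by (auto simp: isometry_betw_def bij_betw_def)
  then show ?thesis using assms by (auto simp: isometry_betw_def intro: bij_betw_trans)
qed

lemma isometry_betw_inv:
  assumes "isometry_betw f X \<rho> Y \<sigma>"
  shows "isometry_betw (inv_into X f) Y \<sigma> X \<rho>"
proof -
  have b: "bij_betw f X Y" using assms by (simp add: isometry_betw_def)
  have "\<rho> (inv_into X f x) (inv_into X f y) = \<sigma> x y" if "x \<in> Y" "y \<in> Y" for x y
    using assms that b bij_betw_inv_into_right[OF b] bij_betwE[OF bij_betw_inv_into[OF b]]
    unfolding isometry_betw_def by metis
  then show ?thesis using bij_betw_inv_into[OF b] by (simp add: isometry_betw_def)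
qed

text \<open>The reflection in the hyperplane orthogonal to $x - y$.\<close>

lemma sphere_reflection_exists:
  assumes "x \<in> std_sphere d" "y \<in> std_sphere d"
  obtains g where "isometry_betw g (std_sphere d) (sphere_dist d) (std_sphere d) (sphere_dist d)" "g x = y"
    "\<And>z. z \<in> std_sphere d \<Longrightarrow> sphere_inner d z x = sphere_inner d z y \<Longrightarrow> g z = z"
proof (cases "x = y")
  case True
  have "isometry_betw (\<lambda>x. x) (std_sphere d) (sphere_dist d) (std_sphere d) (sphere_dist d)"
    by (simp add: isometry_betw_def bij_betw_def)
  then show ?thesis using that True by blast
next
  case False
  define v where "v = (\<lambda>i. x i - y i)"
  obtain i where i: "x i \<noteq> y i" using False by blast
  have "i \<le> d" using i assms by (metis not_le std_sphere_iff)
  then have "sphere_inner d v v > 0"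
    unfolding sphere_inner_def using i
    by (intro sum_pos2[of _ i]) (auto simp: v_def power2_eq_square[symmetric])
  then have v: "sphere_inner d v v \<noteq> 0" by simp
  have vv: "sphere_inner d v z = sphere_inner d x z - sphere_inner d y z" for z
    by (simp add: sphere_inner_def v_def left_diff_distrib sum_subtractf)
  \<comment> \<open>For unit vectors (x - y, x - y) = 2 (x - y, x), so the reflection subtracts
    exactly x - y from x.\<close>
  have "sphere_inner d v v = 2 * sphere_inner d v x"
    using assms unfolding vv by (simp add: sphere_inner_commute[of d _ v] vv std_sphere_iff sphere_inner_commute[of d y x])
  then have "2 * sphere_inner d v x / sphere_inner d v v = 1" using v by simp
  then have "reflect d v x = y"
    using assms by (auto simp: reflect_def fun_eq_iff v_def std_sphere_iff)
  moreover have "reflect d v z = z" if "z \<in> std_sphere d" "sphere_inner d z x = sphere_inner d z y" for z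
  proof -
    have "sphere_inner d v z = 0"
      unfolding vv using that(2) sphere_inner_commute[of d z x] sphere_inner_commute[of d z y] by simp
    then show ?thesis using that by (auto simp: reflect_def fun_eq_iff std_sphere_iff)
  qed
  ultimately show ?thesis using that reflect_isometry[OF v] by blast
qed

lemma sphere_inner_bounds:
  assumes "x \<in> std_sphere d" "y \<in> std_sphere d"
  shows "-1 \<le> sphere_inner d x y" "sphere_inner d x y \<le> 1"
proof -
  have "(sphere_inner d x y)\<^sup>2 \<le> sphere_inner d x x * sphere_inner d y y"
    unfolding sphere_inner_def using Cauchy_Schwarz_ineq_sum[of x y "{..d}"] by (simp add: power2_eq_square)
  then have "\<bar>sphere_inner d x y\<bar> \<le> 1" using assms by (simp add: std_sphere_iff abs_square_le_1)
  then show "-1 \<le> sphere_inner d x y" "sphere_inner d x y \<le> 1" by auto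
qed

text \<open>The curves are great circles from the pole in the coordinate directions, so A is 0, B is
  y_0 for every u, and C is the coordinate y_(u + 1). A pair is moved by two reflections; the second
  fixes the pole because it exchanges two points equally far from it.\<close>

lemma sphere_frame:
  assumes d: "d \<ge> 1"
  shows "\<exists>\<gamma> A B C. two_point_frame (std_sphere d) (sphere_dist d) d d \<gamma> A B C"
proof -
  define \<gamma> where "\<gamma> u s = (\<lambda>i. if i = 0 then cos s else if i = Suc u then sin s else 0)" for u and s :: real
  have gi: "sphere_inner d (\<gamma> u s) y = y 0 * cos s + y (Suc u) * sin s" if "u < d" for u s y
  proof -
    have "sphere_inner d (\<gamma> u s) y = (\<Sum>i\<in>{0, Suc u}. \<gamma> u s i * y i)"
      unfolding sphere_inner_def using that by (intro sum.mono_neutral_right) (auto simp: \<gamma>_def)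
    then show ?thesis by (simp add: \<gamma>_def)
  qed
  have gin: "\<gamma> u s \<in> std_sphere d" if "u < d" for u s
    using that gi[OF that, of s "\<gamma> u s"] sin_cos_squared_add[of s]
    by (auto simp: std_sphere_iff \<gamma>_def power2_eq_square algebra_simps)
  have dc: "sphere_dist d x y = arccos (sphere_inner d x y)" for x y
    by (simp add: sphere_dist_def sphere_inner_def)
  have tc: "cos (sphere_dist d x y) = sphere_inner d x y" if "x \<in> std_sphere d" "y \<in> std_sphere d" for x y
    using sphere_inner_bounds[OF that] by (simp add: dc)
  have d0: "0 < d" using d by simp
  have g0: "\<gamma> u 0 = \<gamma> 0 0" for u by (auto simp: \<gamma>_def)
  have t0: "cos (sphere_dist d (\<gamma> 0 0) y) = y 0" if "y \<in> std_sphere d" for y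
    using tc[OF gin[OF d0] that] gi[OF d0, of 0 y] by simp
  have "two_point_frame (std_sphere d) (sphere_dist d) d d \<gamma> (\<lambda>u y. 0) (\<lambda>u y. y 0) (\<lambda>u y. y (Suc u))"
  proof
    show "sphere_dist d x y \<in> {0..pi}" if "x \<in> std_sphere d" "y \<in> std_sphere d" for x y
      using sphere_inner_bounds[OF that] by (simp add: dc arccos_lbound arccos_ubound)
    show "sphere_dist d x y = sphere_dist d y x" for x y
      by (simp add: dc sphere_inner_commute)
    show "cos (sphere_dist d (\<gamma> u s) y) = 0 + y 0 * cos s + y (Suc u) * sin s" if "u < d" "y \<in> std_sphere d" for u s y
      using tc[OF gin[OF that(1)] that(2)] gi[OF that(1)] by simp
    show "cos (sphere_dist d (\<gamma> 0 0) (\<gamma> 0 s)) = cos s" for s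
      using t0[OF gin[OF d0]] by (simp add: \<gamma>_def)
    show "(\<Sum>u<d. y 0) = (real d - real d) / 2 + (real d + real d) / 2 * cos (sphere_dist d (\<gamma> 0 0) y)"
      if "y \<in> std_sphere d" for y
      using t0[OF that] by simp
    show "(\<Sum>u<d. (y (Suc u))\<^sup>2) = 1 - (cos (sphere_dist d (\<gamma> 0 0) y))\<^sup>2" if "y \<in> std_sphere d" for y
      using t0[OF that] that by (simp add: std_sphere_def sum.atMost_shift)
    show "\<exists>g. isometry_betw g (std_sphere d) (sphere_dist d) (std_sphere d) (sphere_dist d) \<and>
        g x = \<gamma> 0 0 \<and> g y = \<gamma> 0 (sphere_dist d x y)" if x: "x \<in> std_sphere d" and y: "y \<in> std_sphere d" for x y
    proof -
      obtain g where g: "isometry_betw g (std_sphere d) (sphere_dist d) (std_sphere d) (sphere_dist d)" "g x = \<gamma> 0 0"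
        using sphere_reflection_exists[OF x gin[OF d0, of 0]] by blast
      define s where "s = sphere_dist d x y"
      have gy: "g y \<in> std_sphere d" using g(1) y by (auto simp: isometry_betw_def bij_betw_def)
      have "s = sphere_dist d (\<gamma> 0 0) (g y)" using g x y by (auto simp: isometry_betw_def s_def)
      then have c: "cos s = sphere_inner d (\<gamma> 0 0) (g y)" using tc[OF gin[OF d0] gy] by simp
      obtain h where h: "isometry_betw h (std_sphere d) (sphere_dist d) (std_sphere d) (sphere_dist d)" "h (g y) = \<gamma> 0 s"
        "\<And>z. z \<in> std_sphere d \<Longrightarrow> sphere_inner d z (g y) = sphere_inner d z (\<gamma> 0 s) \<Longrightarrow> h z = z"
        using sphere_reflection_exists[OF gy gin[OF d0, of s]] by blast
      have "sphere_inner d (\<gamma> 0 0) (\<gamma> 0 s) = cos s" using gi[OF d0, of 0 "\<gamma> 0 s"] by (simp add: \<gamma>_def)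
      then have "h (\<gamma> 0 0) = \<gamma> 0 0" using h(3)[OF gin[OF d0, of 0]] c by simp
      then show ?thesis using isometry_betw_comp[OF g(1) h(1)] g(2) h(2)
        by (intro exI[of _ "h \<circ> g"]) (simp add: s_def)
    qed
  qed (use d gin g0 in auto)
  then show ?thesis by blast
qed

text \<open>The assumptions of a frame are expressed through points and distances alone, so they
  pull back along an isometry onto the model.\<close>

lemma two_point_frame_transfer:
  assumes f: "isometry_betw f Q \<theta> M \<sigma>" and M: "two_point_frame M \<sigma> d d0 \<gamma> A B C"
  shows "two_point_frame Q \<theta> d d0 (\<lambda>u s. inv_into Q f (\<gamma> u s)) (\<lambda>u y. A u (f y)) (\<lambda>u y. B u (f y)) (\<lambda>u y. C u (f y))"
proof -
  interpret M: two_point_frame M \<sigma> d d0 \<gamma> A B C by (rule M)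
  have b: "bij_betw f Q M" and dist: "\<And>x y. x \<in> Q \<Longrightarrow> y \<in> Q \<Longrightarrow> \<theta> x y = \<sigma> (f x) (f y)"
    using f by (auto simp: isometry_betw_def)
  have fin: "f x \<in> M" if "x \<in> Q" for x using b that by (auto simp: bij_betw_def)
  have iin: "inv_into Q f z \<in> Q" "f (inv_into Q f z) = z" if "z \<in> M" for z
    using b that by (auto simp: bij_betw_def inv_into_into f_inv_into_f)
  have d: "0 < d" using M.dims by simp
  note g = M.geodesic_in
  show ?thesis
  proof
    show "1 \<le> d" "1 \<le> d0" by (rule M.dims)+
    show "\<theta> x y \<in> {0..pi}" "\<theta> x y = \<theta> y x" if "x \<in> Q" "y \<in> Q" for x y
      using that dist fin M.dist_range M.dist_sym by simp_all
    show "inv_into Q f (\<gamma> u s) \<in> Q" if "u < d" for u s by (rule iin(1)[OF g[OF that]])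
    show "inv_into Q f (\<gamma> u 0) = inv_into Q f (\<gamma> 0 0)" if "u < d" for u
      using M.geodesic_0[OF that] by simp
    show "cos (\<theta> (inv_into Q f (\<gamma> u s)) y) = A u (f y) + B u (f y) * cos s + C u (f y) * sin s"
      if "u < d" "y \<in> Q" for u s y
      using M.geodesic_cos[OF that(1) fin[OF that(2)]] dist[OF iin(1)[OF g[OF that(1)]] that(2)] iin(2)[OF g[OF that(1)]] by simp
    show "cos (\<theta> (inv_into Q f (\<gamma> 0 0)) (inv_into Q f (\<gamma> 0 s))) = cos s" for s
      using M.geodesic_unit dist[OF iin(1)[OF g[OF d]] iin(1)[OF g[OF d]]] iin(2)[OF g[OF d]] by simp
    show "(\<Sum>u<d. B u (f y)) = (real d - real d0) / 2 + (real d + real d0) / 2 * cos (\<theta> (inv_into Q f (\<gamma> 0 0)) y)"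
      if "y \<in> Q" for y
      using M.sum_B[OF fin[OF that]] dist[OF iin(1)[OF g[OF d]] that] iin(2)[OF g[OF d]] by simp
    show "(\<Sum>u<d. (C u (f y))\<^sup>2) = 1 - (cos (\<theta> (inv_into Q f (\<gamma> 0 0)) y))\<^sup>2" if "y \<in> Q" for y
      using M.sum_C[OF fin[OF that]] dist[OF iin(1)[OF g[OF d]] that] iin(2)[OF g[OF d]] by simp
    show "\<exists>g. isometry_betw g Q \<theta> Q \<theta> \<and> g x = inv_into Q f (\<gamma> 0 0) \<and> g y = inv_into Q f (\<gamma> 0 (\<theta> x y))"
      if xy: "x \<in> Q" "y \<in> Q" for x y
    proof -
      obtain h where h: "isometry_betw h M \<sigma> M \<sigma>" "h (f x) = \<gamma> 0 0" "h (f y) = \<gamma> 0 (\<sigma> (f x) (f y))"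
        using M.move[OF fin[OF xy(1)] fin[OF xy(2)]] by blast
      have "isometry_betw (inv_into Q f \<circ> (h \<circ> f)) Q \<theta> Q \<theta>"
        by (rule isometry_betw_comp[OF isometry_betw_comp[OF f h(1)] isometry_betw_inv[OF f]])
      then show ?thesis using h(2,3) dist[OF xy] by (intro exI[of _ "inv_into Q f \<circ> (h \<circ> f)"]) simp
    qed
  qed
qed

lemma two_point_frame_isometric:
  assumes "isometric Q \<theta> M \<sigma>" "\<exists>\<gamma> A B C. two_point_frame M \<sigma> d d0 \<gamma> A B C"
  shows "\<exists>\<gamma> A B C. two_point_frame Q \<theta> d d0 \<gamma> A B C"
  using assms two_point_frame_transfer unfolding isometric_def by blast

text \<open>Real, complex and quaternionic twists are compatible by associativity in every
  dimension; the octonions are covered by the case of the plane.\<close>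

lemma two_point_homogeneous_frame:
  assumes "two_point_homogeneous Q \<theta> d d0"
  shows "\<exists>\<gamma> A B C. two_point_frame Q \<theta> d d0 \<gamma> A B C"
  using assms
proof cases
  case Sphere
  then show ?thesis using two_point_frame_isometric[OF _ sphere_frame] by simp
next
  case Real_Proj
  then show ?thesis
    using two_point_frame_isometric[OF _ proj_space_frame[OF _ twist_compatible_assoc[where 'f = real]]] by simp
next
  case (Complex_Proj n)
  then show ?thesis
    using two_point_frame_isometric[OF _ proj_space_frame[OF _ twist_compatible_assoc[where 'f = complex]]] by simp
next
  case (Quaternion_Proj n)
  then show ?thesis
    using two_point_frame_isometric[OF _ proj_space_frame[OF _ twist_compatible_assoc[where 'f = quaternion]]] by simp
next
  case Octonion_Plane
  then show ?thesis
    using two_point_frame_isometric[OF _ proj_space_frame[OF _ twist_compatible_plane[where 'f = octonion]]] by simp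
qed

section \<open>The expansions\<close>

theorem theorem8p1:
  fixes Q :: "'a set" and \<theta> :: "'a \<Rightarrow> 'a \<Rightarrow> real" and \<mu> :: "'a measure"
    and d d0 :: nat and \<alpha> \<beta> :: real and y1 y2 :: 'a
  assumes Q: "two_point_homogeneous Q \<theta> d d0"
    and \<mu>: "invariant_measure Q \<theta> \<mu>"
    and \<alpha>: "\<alpha> = 1 / 2 * real d - 1"
    and \<beta>: "\<beta> = 1 / 2 * real d0 - 1"
    and y1: "y1 \<in> Q" and y2: "y2 \<in> Q"
  shows
    "(\<forall>r\<in>{0..pi}.
       let c = (\<lambda>l. 1 / (real l)\<^sup>2 * jacobi_M \<alpha> \<beta> l * coeff_a d d0 l r);
           \<phi> = (\<lambda>l. jacobi \<alpha> \<beta> l (cos (\<theta> y1 y2)) / jacobi \<alpha> \<beta> l 1)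
       in summable (\<lambda>k. c (Suc k) * \<phi> (Suc k)) \<and>
          summable (\<lambda>k. c (Suc k) * (1 - \<phi> (Suc k))) \<and>
          lam Q \<theta> \<mu> r y1 y2 = \<kappa> d d0 * (\<Sum>k. c (Suc k) * \<phi> (Suc k)) \<and>
          symdiff_metric Q \<theta> \<mu> r y1 y2 =
            average \<mu> (symdiff_metric Q \<theta> \<mu> r) - \<kappa> d d0 * (\<Sum>k. c (Suc k) * \<phi> (Suc k)) \<and>
          symdiff_metric Q \<theta> \<mu> r y1 y2 = \<kappa> d d0 * (\<Sum>k. c (Suc k) * (1 - \<phi> (Suc k))) \<and>
          (\<forall>y\<in>Q. average \<mu> (symdiff_metric Q \<theta> \<mu> r) =
             measure \<mu> (metric_ball Q \<theta> y r) * (1 - measure \<mu> (metric_ball Q \<theta> y r)))) \<and>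
     (\<forall>\<eta>\<in>weight_class d d0.
       let c = (\<lambda>l. 1 / (real l)\<^sup>2 * jacobi_M \<alpha> \<beta> l * coeff_A d d0 l \<eta>);
           \<phi> = (\<lambda>l. jacobi \<alpha> \<beta> l (cos (\<theta> y1 y2)) / jacobi \<alpha> \<beta> l 1)
       in summable (\<lambda>k. c (Suc k) * \<phi> (Suc k)) \<and>
          summable (\<lambda>k. c (Suc k) * (1 - \<phi> (Suc k))) \<and>
          lam_weighted Q \<theta> \<mu> \<eta> y1 y2 = \<kappa> d d0 * (\<Sum>k. c (Suc k) * \<phi> (Suc k)) \<and>
          symdiff_metric_weighted Q \<theta> \<mu> \<eta> y1 y2 =
            average \<mu> (symdiff_metric_weighted Q \<theta> \<mu> \<eta>)
              - \<kappa> d d0 * (\<Sum>k. c (Suc k) * \<phi> (Suc k)) \<and>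
          symdiff_metric_weighted Q \<theta> \<mu> \<eta> y1 y2 =
            \<kappa> d d0 * (\<Sum>k. c (Suc k) * (1 - \<phi> (Suc k))))"
proof -
  obtain \<gamma> A B C where "two_point_frame Q \<theta> d d0 \<gamma> A B C"
    using two_point_homogeneous_frame[OF Q] by blast
  then interpret M: two_point_measure Q \<theta> d d0 \<gamma> A B C \<mu>
    by (intro two_point_measure.intro two_point_measure_axioms.intro \<mu>)
  have \<alpha>\<beta>: "real d / 2 - 1 = \<alpha>" "real d0 / 2 - 1 = \<beta>" using \<alpha> \<beta> by simp_all
  have c: "M.series_coeff r k = 1 / (real (Suc k))\<^sup>2 * jacobi_M \<alpha> \<beta> (Suc k) * coeff_a d d0 (Suc k) r" for r k
    unfolding M.series_coeff_def \<alpha>\<beta> ..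
  have C: "M.weighted_coeff \<eta> k = 1 / (real (Suc k))\<^sup>2 * jacobi_M \<alpha> \<beta> (Suc k) * coeff_A d d0 (Suc k) \<eta>" for \<eta> k
    unfolding M.weighted_coeff_def \<alpha>\<beta> ..
  have p: "M.zonal l z = jacobi \<alpha> \<beta> l z / jacobi \<alpha> \<beta> l 1" for l z
    unfolding M.zonal_def poly_jacobi_poly \<alpha>\<beta> ..
  show ?thesis unfolding Let_def
  proof (intro conjI ballI)
    fix r :: real assume r: "r \<in> {0..pi}"
    \<comment> \<open>All claims for a fixed radius come from two series: the coefficients alone,
      and the kernel at (y1, y2).\<close>
    note e = M.series_expansions[OF M.series_coeff_sums[OF r] M.lam_sums[OF y1 y2 r], unfolded c p]
    show "summable (\<lambda>k. 1 / (real (Suc k))\<^sup>2 * jacobi_M \<alpha> \<beta> (Suc k) * coeff_a d d0 (Suc k) r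
        * (jacobi \<alpha> \<beta> (Suc k) (cos (\<theta> y1 y2)) / jacobi \<alpha> \<beta> (Suc k) 1))"
      "summable (\<lambda>k. 1 / (real (Suc k))\<^sup>2 * jacobi_M \<alpha> \<beta> (Suc k) * coeff_a d d0 (Suc k) r
        * (1 - jacobi \<alpha> \<beta> (Suc k) (cos (\<theta> y1 y2)) / jacobi \<alpha> \<beta> (Suc k) 1))"
      "lam Q \<theta> \<mu> r y1 y2 = \<kappa> d d0 * (\<Sum>k. 1 / (real (Suc k))\<^sup>2 * jacobi_M \<alpha> \<beta> (Suc k) * coeff_a d d0 (Suc k) r
        * (jacobi \<alpha> \<beta> (Suc k) (cos (\<theta> y1 y2)) / jacobi \<alpha> \<beta> (Suc k) 1))"
      by (rule e(1-3))+
    show "symdiff_metric Q \<theta> \<mu> r y1 y2 = average \<mu> (symdiff_metric Q \<theta> \<mu> r)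
        - \<kappa> d d0 * (\<Sum>k. 1 / (real (Suc k))\<^sup>2 * jacobi_M \<alpha> \<beta> (Suc k) * coeff_a d d0 (Suc k) r
        * (jacobi \<alpha> \<beta> (Suc k) (cos (\<theta> y1 y2)) / jacobi \<alpha> \<beta> (Suc k) 1))"
      unfolding M.symdiff_metric_eq[OF y1 y2 r] M.average_symdiff_metric[OF r] e(3) ..
    show "symdiff_metric Q \<theta> \<mu> r y1 y2 = \<kappa> d d0 * (\<Sum>k. 1 / (real (Suc k))\<^sup>2 * jacobi_M \<alpha> \<beta> (Suc k) * coeff_a d d0 (Suc k) r
        * (1 - jacobi \<alpha> \<beta> (Suc k) (cos (\<theta> y1 y2)) / jacobi \<alpha> \<beta> (Suc k) 1))"
      unfolding M.symdiff_metric_eq[OF y1 y2 r] by (rule e(4))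
    show "average \<mu> (symdiff_metric Q \<theta> \<mu> r) =
        measure \<mu> (metric_ball Q \<theta> y r) * (1 - measure \<mu> (metric_ball Q \<theta> y r))" if "y \<in> Q" for y
      unfolding M.average_symdiff_metric[OF r] M.measure_metric_ball[OF that r] ..
  next
    fix \<eta> assume \<eta>: "\<eta> \<in> weight_class d d0"
    note e = M.series_expansions[OF M.weighted_coeff_sums[OF \<eta>] M.lam_weighted_sums(1)[OF \<eta> y1 y2], unfolded C p]
    show "summable (\<lambda>k. 1 / (real (Suc k))\<^sup>2 * jacobi_M \<alpha> \<beta> (Suc k) * coeff_A d d0 (Suc k) \<eta>
        * (jacobi \<alpha> \<beta> (Suc k) (cos (\<theta> y1 y2)) / jacobi \<alpha> \<beta> (Suc k) 1))"
      "summable (\<lambda>k. 1 / (real (Suc k))\<^sup>2 * jacobi_M \<alpha> \<beta> (Suc k) * coeff_A d d0 (Suc k) \<eta>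
        * (1 - jacobi \<alpha> \<beta> (Suc k) (cos (\<theta> y1 y2)) / jacobi \<alpha> \<beta> (Suc k) 1))"
      "lam_weighted Q \<theta> \<mu> \<eta> y1 y2 = \<kappa> d d0 * (\<Sum>k. 1 / (real (Suc k))\<^sup>2 * jacobi_M \<alpha> \<beta> (Suc k) * coeff_A d d0 (Suc k) \<eta>
        * (jacobi \<alpha> \<beta> (Suc k) (cos (\<theta> y1 y2)) / jacobi \<alpha> \<beta> (Suc k) 1))"
      by (rule e(1-3))+
    show "symdiff_metric_weighted Q \<theta> \<mu> \<eta> y1 y2 = average \<mu> (symdiff_metric_weighted Q \<theta> \<mu> \<eta>)
        - \<kappa> d d0 * (\<Sum>k. 1 / (real (Suc k))\<^sup>2 * jacobi_M \<alpha> \<beta> (Suc k) * coeff_A d d0 (Suc k) \<eta>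
        * (jacobi \<alpha> \<beta> (Suc k) (cos (\<theta> y1 y2)) / jacobi \<alpha> \<beta> (Suc k) 1))"
      unfolding M.symdiff_metric_weighted_eq[OF \<eta> y1 y2] M.average_symdiff_metric_weighted[OF \<eta>] e(3) ..
    show "symdiff_metric_weighted Q \<theta> \<mu> \<eta> y1 y2 = \<kappa> d d0 * (\<Sum>k. 1 / (real (Suc k))\<^sup>2 * jacobi_M \<alpha> \<beta> (Suc k) * coeff_A d d0 (Suc k) \<eta>
        * (1 - jacobi \<alpha> \<beta> (Suc k) (cos (\<theta> y1 y2)) / jacobi \<alpha> \<beta> (Suc k) 1))"
      unfolding M.symdiff_metric_weighted_eq[OF \<eta> y1 y2] by (rule e(4))
  qed
qed

end
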